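(* Let $V$ be a complex vector space of dimension $n+1$, let $d\ge 0$ be an integer, and let $N=\dim\mathrm{Sym}^dV=\binom{n+d}{d}$. The degrees of the variety of squares $\mathrm{SOS}_1$ and of the variety of sums of two squares $\mathrm{SOS}_2$ in $\mathbb{P}(\mathrm{Sym}^{2d}V)$ are given by $$\deg(\mathrm{SOS}_1)=2^{N-1},\qquad \deg(\mathrm{SOS}_2)=\prod_{i=0}^{N-3}\frac{\binom{N+i}{N-2-i}}{\binom{2i+1}{i}}.$$
   Context: $\mathrm{Sym}^mV$ denotes the space of homogeneous polynomials of degree $m$ in $x_0,\dots,x_n$ over $\mathbb{C}$, where $x_0,\dots,x_n$ is a basis of $V$. The variety $\mathrm{SOS}_k\subset \mathrm{Sym}^{2d}V$ is the Zariski closure of $\{f_1^2+\dots+f_k^2 : f_i\in \mathrm{Sym}^dV\}$. It is an affine cone, and here it is regarded as a projective subvariety of $\mathbb{P}(\mathrm{Sym}^{2d}V)$.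
   Formalization: The formula for deg(SOS_2) is proved except when dim V = 2 and d ≥ 2, where it is false: every binary form of degree 2d is a sum of two squares, so SOS_2 is the whole space, of degree 1, while the product gives binom(2d,d)/2 > 1. *)

theory Defs
  imports Complex_Main "HOL-Library.Poly_Mapping" "HOL-Computational_Algebra.Polynomial"
begin

text \<open>
  A polynomial over \<open>\<complex>\<close> in variables indexed by \<open>'x\<close> is an element of the monoid algebra
  \<open>('x \<Rightarrow>\<^sub>0 nat) \<Rightarrow>\<^sub>0 complex\<close>: a finitely supported map from exponent vectors to coefficients,
  with convolution as multiplication.
\<close>

type_synonym 'x mpol = "('x \<Rightarrow>\<^sub>0 nat) \<Rightarrow>\<^sub>0 complex"

definition cscale :: "complex \<Rightarrow> ('a \<Rightarrow>\<^sub>0 complex) \<Rightarrow> ('a \<Rightarrow>\<^sub>0 complex)" where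
  "cscale c p = Poly_Mapping.map ((*) c) p"

lemma lookup_cscale [simp]: "Poly_Mapping.lookup (cscale c p) a = c * Poly_Mapping.lookup p a"
  by (simp add: cscale_def Poly_Mapping.map.rep_eq when_def)

interpretation cvs: vector_space cscale
  by unfold_locales (auto intro!: poly_mapping_eqI simp: lookup_add algebra_simps)

definition monoms :: "'x set \<Rightarrow> nat \<Rightarrow> ('x \<Rightarrow>\<^sub>0 nat) set" where
  "monoms X m =
     {a. Poly_Mapping.keys a \<subseteq> X \<and> (\<Sum>i\<in>Poly_Mapping.keys a. Poly_Mapping.lookup a i) = m}"

definition coord_space :: "'a set \<Rightarrow> ('a \<Rightarrow>\<^sub>0 complex) set" where
  "coord_space X = {p. Poly_Mapping.keys p \<subseteq> X}"

definition polys :: "'x set \<Rightarrow> 'x mpol set" where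
  "polys X = {p. \<forall>a\<in>Poly_Mapping.keys p. Poly_Mapping.keys a \<subseteq> X}"

text \<open>
  The homogeneous polynomials of degree \<open>m\<close> in the variables \<open>X\<close>, zero included. With
  \<open>X = {..n}\<close> this is \<open>Sym\<^sup>m V\<close> for \<open>V\<close> with basis \<open>x\<^sub>0, \<dots>, x\<^sub>n\<close>. Its elements are at the same
  time the points of the affine space with coordinates indexed by \<open>monoms X m\<close>.
\<close>

definition forms :: "'x set \<Rightarrow> nat \<Rightarrow> 'x mpol set" where
  "forms X m = coord_space (monoms X m)"

definition mpol_eval :: "'x mpol \<Rightarrow> ('x \<Rightarrow>\<^sub>0 complex) \<Rightarrow> complex" where
  "mpol_eval F v =
     (\<Sum>a\<in>Poly_Mapping.keys F. Poly_Mapping.lookup F a *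
        (\<Prod>i\<in>Poly_Mapping.keys a. Poly_Mapping.lookup v i ^ Poly_Mapping.lookup a i))"

text \<open>Closure in the Zariski topology of the affine space \<open>coord_space X\<close>.\<close>

definition zariski_closure :: "'x set \<Rightarrow> ('x \<Rightarrow>\<^sub>0 complex) set \<Rightarrow> ('x \<Rightarrow>\<^sub>0 complex) set" where
  "zariski_closure X S =
     {v \<in> coord_space X. \<forall>F\<in>polys X. (\<forall>s\<in>S. mpol_eval F s = 0) \<longrightarrow> mpol_eval F v = 0}"

text \<open>
  A projective variety in the projective space of \<open>coord_space X\<close> is represented by its affine
  cone \<open>Z\<close>. The degree-\<open>m\<close> part of its homogeneous ideal consists of the forms of degree \<open>m\<close>
  vanishing on \<open>Z\<close>, and the Hilbert function is the dimension of the degree-\<open>m\<close> part of the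
  homogeneous coordinate ring, written as a difference of dimensions of finite-dimensional spaces.
\<close>

definition ideal_part ::
    "'x set \<Rightarrow> ('x \<Rightarrow>\<^sub>0 complex) set \<Rightarrow> nat \<Rightarrow> 'x mpol set" where
  "ideal_part X Z m = {F \<in> forms X m. \<forall>z\<in>Z. mpol_eval F z = 0}"

definition hilbert_function :: "'x set \<Rightarrow> ('x \<Rightarrow>\<^sub>0 complex) set \<Rightarrow> nat \<Rightarrow> nat" where
  "hilbert_function X Z m = cvs.dim (forms X m) - cvs.dim (ideal_part X Z m)"

definition hilbert_polynomial :: "'x set \<Rightarrow> ('x \<Rightarrow>\<^sub>0 complex) set \<Rightarrow> rat poly" where
  "hilbert_polynomial X Z =
     (THE P. \<forall>\<^sub>F m in sequentially. poly P (of_nat m) = of_nat (hilbert_function X Z m))"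

text \<open>
  The degree of a projective variety of dimension \<open>r\<close> is \<open>r!\<close> times the leading coefficient of
  its Hilbert polynomial, whose polynomial degree is \<open>r\<close>.
\<close>

definition proj_degree :: "'x set \<Rightarrow> ('x \<Rightarrow>\<^sub>0 complex) set \<Rightarrow> rat" where
  "proj_degree X Z =
     fact (degree (hilbert_polynomial X Z)) * lead_coeff (hilbert_polynomial X Z)"

text \<open>
  Pitfall: a binary form is a product of linear forms, so for \<open>n = 1\<close> every form of degree
  \<open>2 * d\<close> is \<open>g * h = ((g + h) / 2)\<^sup>2 + (\<i> * (g - h) / 2)\<^sup>2\<close> with \<open>g, h\<close> of degree \<open>d\<close>. Hence
  \<open>SOS 1 d 2\<close> is the whole space, of degree 1.
\<close>

definition SOS :: "nat \<Rightarrow> nat \<Rightarrow> nat \<Rightarrow> nat mpol set" where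
  "SOS n d k = zariski_closure (monoms {..n} (2 * d))
     {\<Sum>i<k. f i ^ 2 | f. \<forall>i<k. f i \<in> forms {..n} d}"

end

theory Submission
  imports Defs "HOL-Library.Product_Lexorder"
begin

text \<open>
  The Hilbert function of a parametrised cone in degree \<open>m\<close> is the dimension of the degree-\<open>m\<close> part of
  the algebra \<open>A\<close> generated by the parametrising polynomials \<open>c\<^sub>\<gamma>\<close>. It counts the exponents outside
  an upward closed set of exponents, so by Dickson's lemma it is eventually a polynomial; only the
  leading term is needed, and it is obtained by squeezing.

  For \<open>SOS\<^sub>1\<close> the \<open>c\<^sub>\<gamma>\<close> are the coefficients of \<open>f\<^sup>2\<close>, for \<open>SOS\<^sub>2\<close> those of \<open>g h\<close>, because
  \<open>f\<^sub>0\<^sup>2 + f\<^sub>1\<^sup>2 = (f\<^sub>0 + \<i> f\<^sub>1) (f\<^sub>0 - \<i> f\<^sub>1)\<close>. So \<open>A\<close> lies in the even polynomials in the coefficients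
  of \<open>f\<close>, respectively in the polynomials in those of \<open>g\<close> and \<open>h\<close> that have bidegree \<open>(m, m)\<close> and are
  symmetric under exchanging \<open>g\<close> and \<open>h\<close>, which bounds the Hilbert function from above. Gauss's lemma
  shows that the larger ring \<open>C\<close> is a finite \<open>A\<close>-module (\<open>f\<^sup>2 = 0\<close> and \<open>g h = 0\<close> have no nontrivial
  solutions). At one point of the target whose fibre is reduced and consists of a single point, or of
  \<open>(g, h)\<close> and \<open>(h, g)\<close>, Nakayama's lemma bounds the rank of \<open>C\<close> over \<open>A\<close> by 1, respectively 2, and
  this gives a lower bound with the same leading term. The second degree appears in the form
  \<open>binomial (2 N - 2) (N - 1) / 2\<close>, to which the product of binomial quotients telescopes.
\<close>

text \<open>No localisation and no function field is formed. Primes that miss a given element take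
  the place of a localisation, and every division becomes a multiplication by an element of known
  degree. Nakayama's lemma thus yields one nonzero \<open>s\<close> that carries \<open>C\<close>,
  in large degrees, into an \<open>A\<close>-module on one or two generators; the price is a fixed
  degree shift \<open>e\<close>, which leaves the leading term alone. What has to be found is the
  point. For squares \<open>x0^d\<close> will do. For products the factorisation of
  \<open>g h\<close> must be unique up to order, which is read off from Newton polytopes, and the
  linearised equations must be solvable, which they are because they are triangular. The point used
  needs a third variable, and for binary forms no point can work: up to scalars, a general binary
  form of degree \<open>2 d\<close> has \<open>binomial (2 d) d / 2\<close> unordered factorisations
  into forms of degree \<open>d\<close>. For \<open>N = d + 1\<close> this is precisely the value of
  the formula, while the image is the whole space. For \<open>n = 0\<close>, \<open>d = 0\<close>
  and \<open>n = d = 1\<close> the whole space is also the image, but there the formula gives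
  1.\<close>

abbreviation lookup :: "('a \<Rightarrow>\<^sub>0 'b::zero) \<Rightarrow> 'a \<Rightarrow> 'b" where
  "lookup \<equiv> Poly_Mapping.lookup"

abbreviation keys :: "('a \<Rightarrow>\<^sub>0 'b::zero) \<Rightarrow> 'a set" where
  "keys \<equiv> Poly_Mapping.keys"

abbreviation single :: "'a \<Rightarrow> 'b \<Rightarrow> 'a \<Rightarrow>\<^sub>0 'b::zero" where
  "single \<equiv> Poly_Mapping.single"

section \<open>Dimensions of spaces of finitely supported functions\<close>

lemma cscale_eq_mult: "cscale c p = single 0 c * (p :: ('a::monoid_add) \<Rightarrow>\<^sub>0 complex)"
  by (simp add: cscale_def mult_map_scale_conv_mult)

lemma cvs_span_finite_indep:
  assumes "finite F" "cvs.independent B" "B \<subseteq> cvs.span F"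
  shows "finite B"
  using cvs.independent_span_bound[OF assms] by blast

lemma cvs_finite_basis:
  assumes "finite F" "W \<subseteq> cvs.span F"
  obtains B where "B \<subseteq> W" "cvs.independent B" "W \<subseteq> cvs.span B" "card B = cvs.dim W" "finite B"
proof -
  obtain B where B: "B \<subseteq> W" "cvs.independent B" "W \<subseteq> cvs.span B" "card B = cvs.dim W"
    using cvs.basis_exists by blast
  then show thesis using that cvs_span_finite_indep[OF assms(1), of B] assms(2) by blast
qed

lemma cvs_dim_insert:
  assumes "finite S"
  shows "cvs.dim (insert x S) = (if x \<in> cvs.span S then cvs.dim S else Suc (cvs.dim S))"
proof (cases "x \<in> cvs.span S")
  case True
  then show ?thesis using cvs.span_redundant cvs.span_eq_dim by metis
next
  case False
  obtain B where B: "B \<subseteq> S" "cvs.independent B" "S \<subseteq> cvs.span B" "card B = cvs.dim S" "finite B"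
    using cvs_finite_basis[OF assms cvs.span_superset] by metis
  have eq: "cvs.span B = cvs.span S"
    using B(1,3) by (meson cvs.span_minimal cvs.span_mono cvs.subspace_span subset_antisym)
  have "cvs.independent (insert x B)"
    using False eq B(2) by (simp add: cvs.independent_insertI)
  moreover have "insert x S \<subseteq> cvs.span (insert x B)"
    using B(3) cvs.span_mono[of B "insert x B"] cvs.span_base[of x "insert x B"] by blast
  moreover have "x \<notin> B" using False eq cvs.span_base by blast
  ultimately have "cvs.dim (insert x S) = Suc (card B)"
    using cvs.basis_card_eq_dim[of "insert x B" "insert x S"] B(1,5)
    by (metis card_insert_disjoint insert_mono)
  then show ?thesis using False B(4) by simp
qed

text \<open>Greedy choice of a basis: scanning \<open>S\<close> upwards, the dimension grows exactly
  at the indices whose vector lies outside the span of its predecessors. Repeated values of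
  \<open>v\<close> count once.\<close>

lemma cvs_dim_eq_card_standard:
  fixes v :: "'s::linorder \<Rightarrow> ('a \<Rightarrow>\<^sub>0 complex)"
  assumes "finite S"
  shows "cvs.dim (v ` S) = card {a \<in> S. v a \<notin> cvs.span (v ` {b \<in> S. b < a})}"
  using assms
proof (induction S rule: finite_linorder_max_induct)
  case empty
  show ?case using cvs.dim_eq_card_independent[of "{}"] cvs.independent_empty by simp
next
  case (insert x S)
  have low: "{b \<in> insert x S. b < a} = {b \<in> S. b < a}" if "a \<in> S" for a
    using insert.hyps(2) that by force
  have top: "{b \<in> insert x S. b < x} = S" using insert.hyps(2) by auto
  have xS: "x \<notin> S" using insert.hyps(2) by auto
  let ?st = "{a \<in> S. v a \<notin> cvs.span (v ` {b \<in> S. b < a})}"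
  have "{a \<in> insert x S. v a \<notin> cvs.span (v ` {b \<in> insert x S. b < a})}
      = (if v x \<in> cvs.span (v ` S) then ?st else insert x ?st)"
    using low top by auto
  moreover have "x \<notin> ?st" using xS by simp
  ultimately show ?case
    using insert.IH insert.hyps(1) cvs_dim_insert[of "v ` S" "v x"] by simp
qed

interpretation cvp: vector_space_pair
  "cscale :: complex \<Rightarrow> ('a \<Rightarrow>\<^sub>0 complex) \<Rightarrow> _" "cscale :: complex \<Rightarrow> ('b \<Rightarrow>\<^sub>0 complex) \<Rightarrow> _"
  by unfold_locales

lemma cvs_span_Int_eq_0:
  assumes "cvs.independent B" "finite B" "B0 \<subseteq> B"
    and x: "x \<in> cvs.span B0" "x \<in> cvs.span (B - B0)"
  shows "x = 0"
proof -
  have fin: "finite B0" "finite (B - B0)" using assms(2,3) finite_subset by auto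
  obtain u where u: "x = (\<Sum>b\<in>B0. cscale (u b) b)"
    using x(1) unfolding cvs.span_finite[OF fin(1)] by blast
  obtain w where w: "x = (\<Sum>b\<in>B - B0. cscale (w b) b)"
    using x(2) unfolding cvs.span_finite[OF fin(2)] by blast
  define c where "c b = (if b \<in> B0 then u b else - w b)" for b
  have "(\<Sum>b\<in>B. cscale (c b) b) = (\<Sum>b\<in>B0. cscale (c b) b) + (\<Sum>b\<in>B - B0. cscale (c b) b)"
    using assms(2,3) by (simp add: sum.subset_diff add.commute)
  also have "(\<Sum>b\<in>B0. cscale (c b) b) = x"
    unfolding u by (rule sum.cong) (auto simp: c_def)
  also have "(\<Sum>b\<in>B - B0. cscale (c b) b) = (\<Sum>b\<in>B - B0. - cscale (w b) b)"
    by (rule sum.cong) (auto simp: c_def)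
  also have "\<dots> = - x" unfolding w by (rule sum_negf)
  finally have "(\<Sum>b\<in>B. cscale (c b) b) = 0" by simp
  then have "\<forall>b\<in>B. c b = 0" using cvs.independentD[OF assms(1,2) order_refl] by blast
  then have "\<forall>b\<in>B0. u b = 0" using assms(3) unfolding c_def by (metis subsetD)
  then show ?thesis unfolding u by simp
qed

text \<open>The ambient space is infinite-dimensional, hence the restriction to a subspace
  \<open>U\<close> of a finitely generated span. A basis of the kernel is extended to one of
  \<open>U\<close>, and the added vectors map to a basis of the image.\<close>

lemma cvs_rank_nullity:
  fixes L :: "('a \<Rightarrow>\<^sub>0 complex) \<Rightarrow> ('b \<Rightarrow>\<^sub>0 complex)"
  assumes L: "Vector_Spaces.linear cscale cscale L"
    and U: "cvs.subspace U" "finite F" "U \<subseteq> cvs.span F"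
  shows "cvs.dim U = cvs.dim {x \<in> U. L x = 0} + cvs.dim (L ` U)"
proof -
  interpret L: Vector_Spaces.linear cscale cscale L by (fact L)
  let ?K = "{x \<in> U. L x = 0}"
  have K: "cvs.subspace ?K"
    using U(1) by (auto simp: cvs.subspace_def L.add L.scale)
  obtain B0 where B0: "B0 \<subseteq> ?K" "cvs.independent B0" "?K \<subseteq> cvs.span B0" "card B0 = cvs.dim ?K"
    using cvs.basis_exists by blast
  obtain B where B: "B0 \<subseteq> B" "B \<subseteq> U" "cvs.independent B" "U \<subseteq> cvs.span B"
    using cvs.maximal_independent_subset_extend[of B0 U] B0(1,2) by blast
  have finB: "finite B" using cvs_span_finite_indep[OF U(2) B(3)] B(2) U(3) by blast
  have dimU: "cvs.dim U = card B" using cvs.basis_card_eq_dim[OF B(2,4,3)] by simp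
  let ?C = "B - B0"
  have inj: "inj_on L (cvs.span ?C)"
  proof (subst L.inj_on_iff_eq_0)
    show "cvs.subspace (cvs.span ?C)" by simp
    show "\<forall>x\<in>cvs.span ?C. L x = 0 \<longrightarrow> x = 0"
    proof (intro ballI impI)
      fix x assume x: "x \<in> cvs.span ?C" "L x = 0"
      have "cvs.span ?C \<subseteq> U" using B(2) U(1) by (meson Diff_subset cvs.span_minimal subset_trans)
      then have "x \<in> cvs.span B0" using x B0(3) by blast
      then show "x = 0" using cvs_span_Int_eq_0[OF B(3) finB B(1)] x(1) by blast
    qed
  qed
  have ind: "cvs.independent (L ` ?C)"
    using cvp.linear_independent_injective_image[OF L _ inj] B(3) cvs.independent_mono by blast
  have inC: "inj_on L ?C" using inj cvs.span_superset inj_on_subset by blast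
  have "L ` U \<subseteq> cvs.span (L ` ?C)"
  proof -
    have "L ` U \<subseteq> L ` cvs.span B" using B(4) by blast
    also have "\<dots> = cvs.span (L ` B)" by (simp add: L.span_image)
    also have "\<dots> \<subseteq> cvs.span (L ` ?C)"
    proof (rule cvs.span_minimal)
      show "L ` B \<subseteq> cvs.span (L ` ?C)"
      proof
        fix y assume "y \<in> L ` B"
        then obtain b where b: "b \<in> B" "y = L b" by blast
        show "y \<in> cvs.span (L ` ?C)"
        proof (cases "b \<in> B0")
          case True
          then have "y = 0" using b B0(1) by auto
          then show ?thesis by (simp add: cvs.span_zero)
        next
          case False
          then show ?thesis using b by (simp add: cvs.span_base)
        qed
      qed
    qed simp
    finally show ?thesis .
  qed
  moreover have "L ` ?C \<subseteq> L ` U" using B(2) by blast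
  ultimately have "cvs.dim (L ` U) = card (L ` ?C)"
    using cvs.basis_card_eq_dim[OF _ _ ind, of "L ` U"] by simp
  also have "\<dots> = card ?C" by (rule card_image[OF inC])
  also have "\<dots> = card B - card B0" using B(1) finB by (simp add: card_Diff_subset finite_subset)
  finally show ?thesis using dimU B0(4) card_mono[OF finB B(1)] by simp
qed

lemma coord_space_subspace: "cvs.subspace (coord_space S)"
  unfolding cvs.subspace_def coord_space_def
  by (auto simp: subset_iff in_keys_iff lookup_add) (metis add.right_neutral)

lemma poly_mapping_sum_single:
  "p = (\<Sum>a\<in>keys p. single a (lookup p a))"
proof (rule poly_mapping_eqI)
  fix k
  show "lookup p k =
      lookup (\<Sum>a\<in>keys p. single a (lookup p a)) k"
    by (cases "k \<in> keys p")
      (auto simp: lookup_sum lookup_single when_def in_keys_iff)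
qed

lemma coord_space_eq_span: "coord_space S = cvs.span ((\<lambda>a. single a 1) ` S)"
proof
  show "coord_space S \<subseteq> cvs.span ((\<lambda>a. single a 1) ` S)"
  proof
    fix p assume p: "p \<in> coord_space S"
    have "p = (\<Sum>a\<in>keys p. cscale (lookup p a) (single a 1))"
      using poly_mapping_sum_single[of p] by (simp add: cscale_def)
    also have "\<dots> \<in> cvs.span ((\<lambda>a. single a 1) ` S)"
      using p by (intro cvs.span_sum cvs.span_scale cvs.span_base) (auto simp: coord_space_def)
    finally show "p \<in> cvs.span ((\<lambda>a. single a 1) ` S)" .
  qed
  show "cvs.span ((\<lambda>a. single a 1) ` S) \<subseteq> coord_space S"
    by (rule cvs.span_minimal[OF _ coord_space_subspace]) (auto simp: coord_space_def)
qed

lemma dim_coord_space: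
  assumes "finite S"
  shows "cvs.dim (coord_space S) = card S"
proof -
  let ?e = "\<lambda>a. single a (1::complex)"
  have "cvs.independent (?e ` S)"
  proof -
    have "?e a \<notin> cvs.span (?e ` S - {?e a})" if "a \<in> S" for a
    proof -
      have "?e ` S - {?e a} \<subseteq> ?e ` (S - {a})" by auto
      then have "cvs.span (?e ` S - {?e a}) \<subseteq> coord_space (S - {a})"
        unfolding coord_space_eq_span by (rule cvs.span_mono)
      moreover have "?e a \<notin> coord_space (S - {a})" by (simp add: coord_space_def)
      ultimately show ?thesis by blast
    qed
    then show ?thesis unfolding cvs.dependent_def by blast
  qed
  moreover have "inj_on ?e S" by (rule inj_onI) (auto dest: arg_cong[where f = keys])
  ultimately show ?thesis
    unfolding coord_space_eq_span cvs.dim_span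
    by (simp add: cvs.dim_eq_card_independent card_image)
qed

section \<open>Eventually polynomial counting functions\<close>

definition eventually_poly :: "(nat \<Rightarrow> rat) \<Rightarrow> bool" where
  "eventually_poly f \<longleftrightarrow> (\<exists>p. \<forall>\<^sub>F m in sequentially. poly p (of_nat m) = f m)"

lemma eventually_poly_cong:
  assumes "eventually_poly f" "\<forall>\<^sub>F m in sequentially. f m = g m"
  shows "eventually_poly g"
proof -
  obtain p where p: "\<forall>\<^sub>F m in sequentially. poly p (of_nat m) = f m"
    using assms(1) unfolding eventually_poly_def by blast
  have "\<forall>\<^sub>F m in sequentially. poly p (of_nat m) = g m"
    using p assms(2) by eventually_elim simp
  then show ?thesis unfolding eventually_poly_def by blast
qed

lemma eventually_poly_poly: "eventually_poly (\<lambda>m. poly p (of_nat m))"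
  unfolding eventually_poly_def by (intro exI[of _ p]) simp

lemma eventually_poly_const: "eventually_poly (\<lambda>m. c)"
  using eventually_poly_poly[of "[:c:]"] by simp

lemma eventually_poly_add:
  assumes "eventually_poly f" "eventually_poly g"
  shows "eventually_poly (\<lambda>m. f m + g m)"
proof -
  obtain p q where "\<forall>\<^sub>F m in sequentially. poly p (of_nat m) = f m"
    "\<forall>\<^sub>F m in sequentially. poly q (of_nat m) = g m"
    using assms unfolding eventually_poly_def by blast
  then have "\<forall>\<^sub>F m in sequentially. poly (p + q) (of_nat m) = f m + g m"
    by eventually_elim simp
  then show ?thesis unfolding eventually_poly_def by blast
qed

lemma eventually_poly_sum:
  assumes "finite I" "\<And>i. i \<in> I \<Longrightarrow> eventually_poly (f i)"
  shows "eventually_poly (\<lambda>m. \<Sum>i\<in>I. f i m)"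
  using assms by (induction I) (auto intro: eventually_poly_add eventually_poly_const)

lemma eventually_poly_diff_const:
  assumes "eventually_poly f"
  shows "eventually_poly (\<lambda>m. f (m - j))"
proof -
  obtain p where p: "\<forall>\<^sub>F m in sequentially. poly p (of_nat m) = f m"
    using assms unfolding eventually_poly_def by blast
  have "\<forall>\<^sub>F m in sequentially. poly p (of_nat (m - j)) = f (m - j)"
    using p by (rule eventually_compose_filterlim) (rule filterlim_minus_const_nat_at_top)
  then have "\<forall>\<^sub>F m in sequentially. poly (pcompose p [:- of_nat j, 1:]) (of_nat m) = f (m - j)"
    using eventually_ge_at_top[of j] by eventually_elim (simp add: poly_pcompose of_nat_diff)
  then show ?thesis unfolding eventually_poly_def by blast
qed

text \<open>The difference of \<open>x ^ Suc k\<close> is \<open>Suc k * x ^ k\<close> plus lower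
  powers, whose antidifferences are known by induction and can be subtracted.\<close>

lemma power_antidifference:
  "\<exists>q :: rat poly. \<forall>x. poly q (x + 1) - poly q x = x ^ k"
proof (induction k rule: less_induct)
  case (less k)
  then obtain q :: "nat \<Rightarrow> rat poly"
    where q: "\<And>i x. i < k \<Longrightarrow> poly (q i) (x + 1) - poly (q i) x = x ^ i"
    by metis
  define r :: "rat poly" where
    "r = smult (1 / of_nat (Suc k)) (monom 1 (Suc k) - (\<Sum>i<k. smult (of_nat (Suc k choose i)) (q i)))"
  have "poly r (x + 1) - poly r x = x ^ k" for x
  proof -
    have bin: "(x + 1) ^ Suc k = x ^ Suc k + of_nat (Suc k) * x ^ k + (\<Sum>i<k. of_nat (Suc k choose i) * x ^ i)"
    proof -
      have "(x + 1) ^ Suc k = (\<Sum>i\<le>Suc k. of_nat (Suc k choose i) * x ^ i)"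
        by (subst binomial_ring) simp
      also have "{..Suc k} = insert (Suc k) (insert k {..<k})" by auto
      finally show ?thesis by simp
    qed
    have "poly r (x + 1) - poly r x = (1 / of_nat (Suc k)) *
       ((x + 1) ^ Suc k - x ^ Suc k
         - (\<Sum>i<k. of_nat (Suc k choose i) * (poly (q i) (x + 1) - poly (q i) x)))"
      by (simp add: r_def poly_sum poly_monom sum_subtractf right_diff_distrib diff_divide_distrib del: of_nat_Suc power_Suc)
    also have "(\<Sum>i<k. of_nat (Suc k choose i) * (poly (q i) (x + 1) - poly (q i) x))
       = (\<Sum>i<k. of_nat (Suc k choose i) * x ^ i)"
      by (rule sum.cong) (simp_all add: q)
    finally show ?thesis unfolding bin by (simp del: of_nat_Suc)
  qed
  then show ?case by blast
qed

lemma poly_antidifference: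
  "\<exists>q :: rat poly. \<forall>x. poly q (x + 1) - poly q x = poly p x"
proof -
  obtain q :: "nat \<Rightarrow> rat poly" where q: "\<And>i x. poly (q i) (x + 1) - poly (q i) x = x ^ i"
    using power_antidifference by metis
  define r where "r = (\<Sum>i\<le>degree p. smult (coeff p i) (q i))"
  have "poly r (x + 1) - poly r x = (\<Sum>i\<le>degree p. coeff p i * (poly (q i) (x + 1) - poly (q i) x))" for x
    by (simp add: r_def poly_sum sum_subtractf right_diff_distrib)
  then have "poly r (x + 1) - poly r x = poly p x" for x
    by (simp only: q poly_altdef[of p])
  then show ?thesis by blast
qed

lemma eventually_poly_partial_sum:
  assumes "eventually_poly f"
  shows "eventually_poly (\<lambda>m. \<Sum>i\<le>m. f i)"
proof -
  obtain p M where p: "\<And>m. m \<ge> M \<Longrightarrow> poly p (of_nat m) = f m"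
    using assms unfolding eventually_poly_def eventually_sequentially by blast
  obtain q where q: "\<And>x. poly q (x + 1) - poly q x = poly p x"
    using poly_antidifference by blast
  \<comment> \<open>The constant absorbs the finitely many initial terms at which \<open>f\<close>
    and \<open>p\<close> may differ.\<close>
  define c where "c = (\<Sum>i\<le>M. f i) - poly q (of_nat M + 1)"
  have "(\<Sum>i\<le>m. f i) = poly q (of_nat m + 1) + c" if "m \<ge> M" for m
    using that
  proof (induction m rule: dec_induct)
    case base
    show ?case by (simp add: c_def)
  next
    case (step m)
    have "f (Suc m) = poly q (of_nat (Suc m) + 1) - poly q (of_nat (Suc m))"
      using p[of "Suc m"] q[of "of_nat (Suc m)"] step(1) by simp
    then show ?case using step.IH by (simp add: add.commute)
  qed
  then have "\<forall>\<^sub>F m in sequentially. poly (pcompose q [:1, 1:] + [:c:]) (of_nat m) = (\<Sum>i\<le>m. f i)"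
    unfolding eventually_sequentially
    by (intro exI[of _ M]) (simp add: poly_pcompose add.commute)
  then show ?thesis unfolding eventually_poly_def by blast
qed

section \<open>Dickson's lemma and ascending chains of monomial ideals\<close>

lemma nat_incseq_subseq:
  fixes s :: "nat \<Rightarrow> nat"
  shows "\<exists>r. strict_mono r \<and> incseq (s \<circ> r)"
proof -
  obtain r where r: "strict_mono r" "monoseq (\<lambda>n. s (r n))"
    using seq_monosub[of s] by blast
  show ?thesis
  proof (cases "incseq (\<lambda>n. s (r n))")
    case True
    then show ?thesis using r(1) by (auto simp: comp_def)
  next
    case False
    then have dec: "decseq (\<lambda>n. s (r n))" using r(2) by (auto simp: monoseq_iff)
    \<comment> \<open>A decreasing sequence of naturals is constant from the place of its minimum
      on.\<close>
    obtain k where k: "\<And>n. s (r k) \<le> s (r n)"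
      using ex_has_least_nat[of "\<lambda>_. True" 0 "\<lambda>n. s (r n)"] by auto
    have "s (r (k + n)) = s (r k)" for n
      using k[of "k + n"] decseqD[OF dec, of k "k + n"] by simp
    then have "incseq (s \<circ> (\<lambda>n. r (k + n)))" by (auto simp: incseq_def)
    moreover have "strict_mono (\<lambda>n. r (k + n))" using r(1) by (auto simp: strict_mono_def)
    ultimately show ?thesis by blast
  qed
qed

text \<open>One refinement per variable; a further subsequence keeps the coordinates already treated
  nondecreasing.\<close>

lemma dickson_subseq:
  fixes a :: "nat \<Rightarrow> 'x \<Rightarrow> nat"
  assumes "finite X"
  shows "\<exists>r. strict_mono r \<and> (\<forall>x\<in>X. incseq (\<lambda>k. a (r k) x))"
  using assms
proof (induction X)
  case empty
  show ?case by (rule exI[of _ "\<lambda>n. n"]) (auto simp: strict_mono_def)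
next
  case (insert x X)
  then obtain r where r: "strict_mono r" "\<And>y. y \<in> X \<Longrightarrow> incseq (\<lambda>k. a (r k) y)" by blast
  obtain r' where r': "strict_mono r'" "incseq ((\<lambda>k. a (r k) x) \<circ> r')"
    using nat_incseq_subseq by blast
  have "incseq (\<lambda>k. a (r (r' k)) y)" if "y \<in> X" for y
    using r(2)[OF that] r'(1) by (auto simp: incseq_def strict_mono_less_eq)
  then show ?case
    using r(1) r' by (intro exI[of _ "r \<circ> r'"]) (auto simp: comp_def strict_mono_def)
qed

lemma dickson:
  fixes a :: "nat \<Rightarrow> ('x \<Rightarrow>\<^sub>0 nat)"
  assumes "finite X" "\<And>k. keys (a k) \<subseteq> X"
  shows "\<exists>i j b. i < j \<and> a j = a i + b \<and> keys b \<subseteq> X"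
proof -
  obtain r where r: "strict_mono r" "\<And>x. x \<in> X \<Longrightarrow> incseq (\<lambda>k. lookup (a (r k)) x)"
    using dickson_subseq[OF assms(1), of "\<lambda>k. lookup (a k)"] by blast
  let ?b = "a (r 1) - a (r 0)"
  have le: "lookup (a (r 0)) x \<le> lookup (a (r 1)) x" for x
  proof (cases "x \<in> X")
    case True
    then show ?thesis using incseqD[OF r(2), of x 0 1] by simp
  next
    case False
    then have "x \<notin> keys (a (r 0))" using assms(2) by blast
    then show ?thesis by (simp add: in_keys_iff)
  qed
  have "a (r 1) = a (r 0) + ?b"
    by (rule poly_mapping_eqI) (use le in \<open>simp add: lookup_add lookup_minus\<close>)
  moreover have "keys ?b \<subseteq> X"
    using assms(2)[of "r 1"] by (auto simp: in_keys_iff lookup_minus)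
  moreover have "r 0 < r 1" using r(1) by (simp add: strict_mono_def)
  ultimately show ?thesis by blast
qed

text \<open>Ascending chain condition for monomial ideals. If the chain kept growing, Dickson's
  lemma applied to the newly added exponents would find a later one above an earlier one, so the
  later one would not be new.\<close>

lemma upset_chain_stabilizes:
  fixes U :: "nat \<Rightarrow> ('x \<Rightarrow>\<^sub>0 nat) set"
  assumes "finite X" and inc: "\<And>j. U j \<subseteq> U (Suc j)"
    and up: "\<And>j a b. a \<in> U j \<Longrightarrow> keys b \<subseteq> X \<Longrightarrow> a + b \<in> U j"
  shows "\<exists>J. \<forall>j\<ge>J. \<forall>a. keys a \<subseteq> X \<longrightarrow> a \<in> U j \<longrightarrow> a \<in> U J"
proof (rule ccontr)
  assume "\<not> ?thesis"
  then have "\<forall>J. \<exists>j a. j \<ge> J \<and> keys a \<subseteq> X \<and> a \<in> U j \<and> a \<notin> U J" by blast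
  then obtain nx e where nx: "\<And>J. nx J \<ge> J" "\<And>J. keys (e J) \<subseteq> X"
    "\<And>J. e J \<in> U (nx J)" "\<And>J. e J \<notin> U J"
    by metis
  \<comment> \<open>Iterating \<open>nx\<close> makes each stage contain the witnesses of all
    earlier stages.\<close>
  define s where "s k = (nx ^^ k) 0" for k
  have mono: "U i \<subseteq> U j" if "i \<le> j" for i j
    using that inc by (rule lift_Suc_mono_le[of U, rotated]) 
  have s_Suc: "s (Suc k) = nx (s k)" for k by (simp add: s_def)
  have smono: "s i \<le> s j" if "i \<le> j" for i j
    using that by (rule lift_Suc_mono_le[of s, rotated]) (simp add: s_Suc nx)
  obtain i j b where ij: "i < j" "e (s j) = e (s i) + b" "keys b \<subseteq> X"
    using dickson[OF assms(1), of "\<lambda>k. e (s k)"] nx(2) by blast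
  have "e (s i) \<in> U (s (Suc i))" using nx(3) by (simp add: s_Suc)
  then have "e (s i) \<in> U (s j)" using mono[OF smono[of "Suc i" j]] ij(1) by auto
  then have "e (s j) \<in> U (s j)" using up ij(2,3) by simp
  then show False using nx(4) by blast
qed

section \<open>Monomials of a given degree and their number\<close>

lemma mem_monoms_iff:
  assumes "finite X"
  shows "a \<in> monoms X m \<longleftrightarrow>
    keys a \<subseteq> X \<and> (\<Sum>i\<in>X. lookup a i) = m"
proof -
  have "(\<Sum>i\<in>keys a. lookup a i) = (\<Sum>i\<in>X. lookup a i)"
    if "keys a \<subseteq> X"
    using assms that by (intro sum.mono_neutral_left) (auto simp: in_keys_iff)
  then show ?thesis by (auto simp: monoms_def)
qed

lemma monoms_add:
  assumes "finite X" "a \<in> monoms X k" "b \<in> monoms X l"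
  shows "a + b \<in> monoms X (k + l)"
  using assms(2,3) keys_add[of a b]
  by (auto simp: mem_monoms_iff[OF assms(1)] lookup_add sum.distrib)

lemma monoms_empty: "monoms {} m = (if m = 0 then {0} else {})"
  by (auto simp: monoms_def)

lemma monoms_0: "monoms X 0 = {0}"
proof -
  have "a = 0" if "\<forall>i\<in>keys a. lookup a i = 0" for a :: "'a \<Rightarrow>\<^sub>0 nat"
    using that by (metis in_keys_iff keys_eq_empty subsetI subset_empty)
  then show ?thesis by (auto simp: monoms_def)
qed

lemma monoms_insert:
  assumes "finite X" "x \<notin> X"
  shows "bij_betw (\<lambda>(j, b). b + single x j)
    (SIGMA j:{..m}. monoms X (m - j)) (monoms (insert x X) m)"
proof (rule bij_betw_byWitness[where f' =
      "\<lambda>a. (lookup a x, a - single x (lookup a x))"])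
  have fin: "finite (insert x X)" using assms(1) by simp
  have lx: "lookup b x = 0" if "b \<in> monoms X k" for b k
    using that assms(2) by (auto simp: monoms_def in_keys_iff)
  show "\<forall>p\<in>SIGMA j:{..m}. monoms X (m - j). (\<lambda>a. (lookup a x,
      a - single x (lookup a x))) ((\<lambda>(j, b). b + single x j) p) = p"
    by (auto simp: lookup_add lx)
  show "\<forall>a\<in>monoms (insert x X) m. (\<lambda>(j, b). b + single x j)
      (lookup a x, a - single x (lookup a x)) = a"
    by (auto intro!: poly_mapping_eqI simp: lookup_add lookup_minus lookup_single when_def)
  show "(\<lambda>(j, b). b + single x j) ` (SIGMA j:{..m}. monoms X (m - j)) \<subseteq> monoms (insert x X) m"
  proof (rule image_subsetI)
    fix p assume "p \<in> (SIGMA j:{..m}. monoms X (m - j))"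
    then obtain j b where p: "p = (j, b)" and j: "j \<in> {..m}" and b: "b \<in> monoms X (m - j)" by auto
    have "(\<Sum>i\<in>X. lookup (b + single x j) i) = (\<Sum>i\<in>X. lookup b i)"
      using assms(2) by (intro sum.cong) (auto simp: lookup_add lookup_single when_def)
    then show "(\<lambda>(j, b). b + single x j) p \<in> monoms (insert x X) m"
      using p j b lx[OF b] assms keys_add[of b "single x j"]
      by (auto simp: mem_monoms_iff[OF fin] mem_monoms_iff[OF assms(1)] lookup_add split: if_splits)
  qed
  show "(\<lambda>a. (lookup a x, a - single x (lookup a x))) `
      monoms (insert x X) m \<subseteq> (SIGMA j:{..m}. monoms X (m - j))"
  proof (rule image_subsetI)
    fix a assume a: "a \<in> monoms (insert x X) m"
    let ?b = "a - single x (lookup a x)"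
    have "(\<Sum>i\<in>X. lookup ?b i) = (\<Sum>i\<in>X. lookup a i)"
      using assms(2) by (intro sum.cong) (auto simp: lookup_minus lookup_single when_def)
    moreover have "keys ?b \<subseteq> X"
      using a by (auto simp: mem_monoms_iff[OF fin] subset_iff in_keys_iff lookup_minus lookup_single when_def split: if_splits)
    ultimately show "(lookup a x, ?b) \<in> (SIGMA j:{..m}. monoms X (m - j))"
      using a assms by (auto simp: mem_monoms_iff[OF fin] mem_monoms_iff[OF assms(1)])
  qed
qed

lemma finite_monoms:
  assumes "finite X"
  shows "finite (monoms X m)"
  using assms
proof (induction X arbitrary: m)
  case (insert x X)
  have "finite (SIGMA j:{..m}. monoms X (m - j))" using insert.IH by auto
  then show ?case using bij_betw_finite[OF monoms_insert[OF insert.hyps, of m]] by simp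
qed (simp add: monoms_empty)

lemma card_monoms:
  assumes "finite X" "X \<noteq> {}"
  shows "card (monoms X m) = (m + card X - 1) choose m"
  using assms
proof (induction X arbitrary: m rule: finite_ne_induct)
  case (singleton x)
  have "card (SIGMA j:{..m}. monoms ({} :: 'a set) (m - j)) = (\<Sum>j\<le>m. card (monoms ({} :: 'a set) (m - j)))"
    by (simp add: monoms_empty)
  also have "\<dots> = (\<Sum>j\<le>m. if j = m then 1 else 0)"
    by (rule sum.cong) (auto simp: monoms_empty)
  finally show ?case using bij_betw_same_card[OF monoms_insert[of "{}" x m]] by simp
next
  case (insert x X)
  obtain k where k: "card X = Suc k" using insert.hyps(1,2) by (metis card_0_eq not0_implies_Suc)
  have "card (monoms (insert x X) m) = (\<Sum>j\<le>m. card (monoms X (m - j)))"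
    using bij_betw_same_card[OF monoms_insert[OF insert.hyps(1,3), of m]]
    by (simp add: finite_monoms[OF insert.hyps(1)])
  also have "\<dots> = (\<Sum>j\<le>m. card (monoms X j))"
    by (rule sum.reindex_bij_witness[of _ "\<lambda>j. m - j" "\<lambda>j. m - j"]) auto
  also have "\<dots> = (\<Sum>j\<le>m. (k + j) choose j)" using insert.IH k by (simp add: add.commute)
  also have "\<dots> = Suc (k + m) choose m" by (rule sum_choose_lower)
  finally show ?case using insert.hyps k by (simp add: add.commute)
qed

text \<open>Slice by the exponent \<open>j\<close> of one variable. The slices \<open>V j\<close> of
  \<open>U\<close> increase with \<open>j\<close> and are constant from some \<open>J\<close> on, so
  the count is a finite sum of shifted counts in fewer variables plus a partial sum of the stable
  one; all of these are eventually polynomial.\<close>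

theorem eventually_poly_card_monoms_diff_upset:
  assumes "finite X" and "\<And>a b. a \<in> U \<Longrightarrow> keys b \<subseteq> X \<Longrightarrow> a + b \<in> U"
  shows "eventually_poly (\<lambda>m. of_nat (card (monoms X m - U)))"
  using assms
proof (induction X arbitrary: U)
  case empty
  have "\<forall>\<^sub>F m in sequentially. (0::rat) = of_nat (card (monoms ({} :: 'a set) m - U))"
    using eventually_gt_at_top[of 0] by eventually_elim (simp add: monoms_empty)
  then show ?case by (rule eventually_poly_cong[OF eventually_poly_const])
next
  case (insert x X)
  define V where "V j = {b. b + single x j \<in> U}" for j
  have upV: "a + b \<in> V j" if "a \<in> V j" "keys b \<subseteq> X" for a b j
    using insert.prems[of "a + single x j" b] that
    by (auto simp: V_def add.assoc add.commute[of b])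
  have incV: "V j \<subseteq> V (Suc j)" for j
  proof
    fix a assume "a \<in> V j"
    then have "a + single x j + single x 1 \<in> U"
      using insert.prems[of "a + single x j" "single x 1"]
      by (auto simp: V_def)
    then show "a \<in> V (Suc j)" by (simp add: V_def add.assoc single_add[symmetric])
  qed
  define h :: "nat \<Rightarrow> nat \<Rightarrow> rat" where "h j m = of_nat (card (monoms X m - V j))" for j m
  have eph: "eventually_poly (h j)" for j
    unfolding h_def using insert.IH[of "V j"] upV by blast
  obtain J where J: "\<And>j a. j \<ge> J \<Longrightarrow> keys a \<subseteq> X \<Longrightarrow> a \<in> V j \<Longrightarrow> a \<in> V J"
    using upset_chain_stabilizes[OF insert.hyps(1), of V] incV upV by blast
  have hJ: "h j m = h J m" if "j \<ge> J" for j m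
  proof -
    have "V J \<subseteq> V j" using that incV by (rule lift_Suc_mono_le[of V, rotated])
    then have "monoms X m - V j = monoms X m - V J"
      using J[OF that] by (auto simp: monoms_def)
    then show ?thesis by (simp add: h_def)
  qed
  have split: "of_nat (card (monoms (insert x X) m - U)) = (\<Sum>j\<le>m. h j (m - j))" for m
  proof -
    let ?f = "\<lambda>(j, b). b + single x j"
    have bij: "bij_betw ?f (SIGMA j:{..m}. monoms X (m - j)) (monoms (insert x X) m)"
      by (rule monoms_insert[OF insert.hyps])
    have "bij_betw ?f (SIGMA j:{..m}. monoms X (m - j) - V j) (monoms (insert x X) m - U)"
    proof (rule bij_betw_subset[OF bij])
      show "?f ` (SIGMA j:{..m}. monoms X (m - j) - V j) = monoms (insert x X) m - U"
        unfolding bij_betw_imp_surj_on[OF bij, symmetric] V_def by fastforce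
    qed auto
    then have "card (monoms (insert x X) m - U) = (\<Sum>j\<le>m. card (monoms X (m - j) - V j))"
      using bij_betw_same_card[of ?f "SIGMA j:{..m}. monoms X (m - j) - V j"]
      by (simp add: finite_monoms[OF insert.hyps(1)])
    then show ?thesis by (simp add: h_def)
  qed
  have "(\<Sum>j<J. h j (m - j)) + (\<Sum>i\<le>m - J. h J i) = (\<Sum>j\<le>m. h j (m - j))" if "m \<ge> J" for m
  proof -
    have "(\<Sum>j\<le>m. h j (m - j)) = (\<Sum>j<J. h j (m - j)) + (\<Sum>j\<in>{J..m}. h j (m - j))"
    proof (subst sum.union_disjoint[symmetric])
      show "(\<Sum>j\<le>m. h j (m - j)) = (\<Sum>j\<in>{..<J} \<union> {J..m}. h j (m - j))"
        using that by (intro sum.cong) auto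
    qed auto
    also have "(\<Sum>j\<in>{J..m}. h j (m - j)) = (\<Sum>j\<in>{J..m}. h J (m - j))"
      by (rule sum.cong[OF refl], rule hJ) simp
    also have "\<dots> = (\<Sum>i\<le>m - J. h J i)"
      using that by (intro sum.reindex_bij_witness[of _ "\<lambda>i. m - i" "\<lambda>j. m - j"]) auto
    finally show ?thesis by simp
  qed
  then have "\<forall>\<^sub>F m in sequentially. (\<Sum>j<J. h j (m - j)) + (\<Sum>i\<le>m - J. h J i)
      = of_nat (card (monoms (insert x X) m - U))"
    unfolding split eventually_sequentially by blast
  moreover have "eventually_poly (\<lambda>m. (\<Sum>j<J. h j (m - j)) + (\<Sum>i\<le>m - J. h J i))"
    using eph by (intro eventually_poly_add eventually_poly_sum finite_lessThan
      eventually_poly_diff_const[OF eph] eventually_poly_diff_const[OF eventually_poly_partial_sum[OF eph]])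
  ultimately show ?case by (rule eventually_poly_cong[rotated])
qed

section \<open>Hilbert functions of parametrised cones\<close>

text \<open>One notion for two uses: with complex values \<open>c\<close> it evaluates a monomial at
  a point, with polynomial values it substitutes a parametrisation into the monomial.\<close>

definition cmon :: "('x \<Rightarrow> 'r::comm_ring_1) \<Rightarrow> ('x \<Rightarrow>\<^sub>0 nat) \<Rightarrow> 'r" where
  "cmon c a = (\<Prod>i\<in>keys a. c i ^ lookup a i)"

lemma cmon_superset:
  assumes "finite S" "keys a \<subseteq> S"
  shows "cmon c a = (\<Prod>i\<in>S. c i ^ lookup a i)"
  unfolding cmon_def using assms
  by (intro prod.mono_neutral_left) (auto simp: in_keys_iff)

lemma cmon_0 [simp]: "cmon c 0 = 1"
  by (simp add: cmon_def)

lemma cmon_single [simp]: "cmon c (single i k) = c i ^ k"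
  by (simp add: cmon_def)

lemma cmon_add: "cmon c (a + b) = cmon c a * cmon c b"
proof -
  let ?S = "keys a \<union> keys b"
  have "cmon c (a + b) = (\<Prod>i\<in>?S. c i ^ lookup (a + b) i)"
    using keys_add[of a b] by (intro cmon_superset) auto
  also have "\<dots> = cmon c a * cmon c b"
    by (simp add: cmon_superset[of ?S] lookup_add power_add prod.distrib)
  finally show ?thesis .
qed

lemma mpol_eval_eq: "mpol_eval F v = (\<Sum>a\<in>keys F. lookup F a * cmon (lookup v) a)"
  by (simp add: mpol_eval_def cmon_def)

lemma mpol_eval_superset:
  assumes "finite S" "keys F \<subseteq> S"
  shows "mpol_eval F v = (\<Sum>a\<in>S. lookup F a * cmon (lookup v) a)"
  unfolding mpol_eval_eq using assms
  by (intro sum.mono_neutral_left) (auto simp: in_keys_iff)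

lemma mpol_eval_0 [simp]: "mpol_eval 0 v = 0"
  by (simp add: mpol_eval_def)

lemma mpol_eval_single [simp]:
  "mpol_eval (single a x) v = x * cmon (lookup v) a"
  by (simp add: mpol_eval_eq)

lemma mpol_eval_1 [simp]: "mpol_eval 1 v = 1"
  by (simp flip: single_one)

lemma mpol_eval_add: "mpol_eval (p + q) v = mpol_eval p v + mpol_eval q v"
proof -
  let ?S = "keys p \<union> keys q"
  have "mpol_eval (p + q) v = (\<Sum>a\<in>?S. lookup (p + q) a * cmon (lookup v) a)"
    using keys_add[of p q] by (intro mpol_eval_superset) auto
  also have "\<dots> = mpol_eval p v + mpol_eval q v"
    by (simp add: mpol_eval_superset[of ?S] lookup_add distrib_right sum.distrib)
  finally show ?thesis .
qed

lemma mpol_eval_sum: "mpol_eval (\<Sum>i\<in>I. p i) v = (\<Sum>i\<in>I. mpol_eval (p i) v)"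
  by (induction I rule: infinite_finite_induct) (auto simp: mpol_eval_add)

lemma mpol_eval_mult: "mpol_eval (p * q) v = mpol_eval p v * mpol_eval q v"
proof -
  let ?P = "keys p" and ?Q = "keys q"
  have "p * q = (\<Sum>a\<in>?P. single a (lookup p a)) *
      (\<Sum>b\<in>?Q. single b (lookup q b))"
    by (rule arg_cong2[of _ _ _ _ "(*)"]) (rule poly_mapping_sum_single)+
  also have "\<dots> = (\<Sum>a\<in>?P. \<Sum>b\<in>?Q. single (a + b)
      (lookup p a * lookup q b))"
    by (simp add: sum_product mult_single)
  finally have pq: "p * q = \<dots>" .
  have "mpol_eval (p * q) v = (\<Sum>a\<in>?P. \<Sum>b\<in>?Q. lookup p a * lookup q b *
      (cmon (lookup v) a * cmon (lookup v) b))"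
    unfolding pq by (simp add: mpol_eval_sum cmon_add)
  also have "\<dots> = mpol_eval p v * mpol_eval q v"
    by (simp add: mpol_eval_eq sum_product mult_ac)
  finally show ?thesis .
qed

lemma mpol_eval_power: "mpol_eval (p ^ k) v = mpol_eval p v ^ k"
  by (induction k) (auto simp: mpol_eval_mult)

lemma mpol_eval_cscale: "mpol_eval (cscale c p) v = c * mpol_eval p v"
  by (simp add: cscale_eq_mult mpol_eval_mult)

lemma mpol_eval_cmon: "mpol_eval (cmon c a) v = cmon (\<lambda>i. mpol_eval (c i) v) a"
proof -
  have "mpol_eval (\<Prod>i\<in>I. f i) v = (\<Prod>i\<in>I. mpol_eval (f i) v)" for I :: "'b set" and f
    by (induction I rule: infinite_finite_induct) (auto simp: mpol_eval_mult)
  then show ?thesis by (simp add: cmon_def mpol_eval_power)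
qed

lemma mult_linear: "Vector_Spaces.linear cscale cscale (\<lambda>x. x * (y :: 'x mpol))"
  by (auto simp: Vector_Spaces.linear_iff cvs.vector_space_axioms distrib_right cscale_eq_mult mult.assoc)

lemma cvs_span_mult_right:
  assumes "x \<in> cvs.span S"
  shows "x * (y :: 'x mpol) \<in> cvs.span ((\<lambda>s. s * y) ` S)"
  using assms cvp.linear_span_image[OF mult_linear[of y], of S] by blast

text \<open>Kronecker substitution: the weights are powers of \<open>B\<close>, so that exponents
  below \<open>B\<close> are recovered as digits.\<close>

lemma exists_separating_weight:
  assumes "finite X"
  shows "\<exists>w :: 'x \<Rightarrow> nat. \<forall>a b :: 'x \<Rightarrow>\<^sub>0 nat.
    (\<forall>i\<in>X. lookup a i < B \<and> lookup b i < B) \<longrightarrow>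
    (\<Sum>i\<in>X. w i * lookup a i) = (\<Sum>i\<in>X. w i * lookup b i) \<longrightarrow>
    (\<forall>i\<in>X. lookup a i = lookup b i)"
  using assms
proof (induction X)
  case (insert x X)
  then obtain w :: "'x \<Rightarrow> nat" where w: "\<And>a b :: 'x \<Rightarrow>\<^sub>0 nat.
    (\<forall>i\<in>X. lookup a i < B \<and> lookup b i < B) \<Longrightarrow>
    (\<Sum>i\<in>X. w i * lookup a i) = (\<Sum>i\<in>X. w i * lookup b i) \<Longrightarrow>
    (\<forall>i\<in>X. lookup a i = lookup b i)" by blast
  define w' where "w' i = (if i = x then 1 else B * w i)" for i
  have sum: "(\<Sum>i\<in>insert x X. w' i * lookup a i)
      = lookup a x + B * (\<Sum>i\<in>X. w i * lookup a i)" for a :: "'x \<Rightarrow>\<^sub>0 nat"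
  proof -
    have "(\<Sum>i\<in>X. w' i * lookup a i) = (\<Sum>i\<in>X. B * (w i * lookup a i))"
      using insert.hyps(2) by (intro sum.cong) (auto simp: w'_def)
    then show ?thesis using insert.hyps by (simp add: w'_def sum_distrib_left)
  qed
  show ?case
  proof (intro exI[of _ w'] allI impI)
    fix a b :: "'x \<Rightarrow>\<^sub>0 nat"
    assume B: "\<forall>i\<in>insert x X. lookup a i < B \<and> lookup b i < B"
    assume "(\<Sum>i\<in>insert x X. w' i * lookup a i) = (\<Sum>i\<in>insert x X. w' i * lookup b i)"
    then have eq: "lookup a x + B * (\<Sum>i\<in>X. w i * lookup a i) =
        lookup b x + B * (\<Sum>i\<in>X. w i * lookup b i)"
      by (simp only: sum)
    have x: "lookup a x = lookup b x"
      using arg_cong[OF eq, of "\<lambda>k. k mod B"] B by simp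
    moreover have "B \<noteq> 0" using B by auto
    ultimately have "(\<Sum>i\<in>X. w i * lookup a i) = (\<Sum>i\<in>X. w i * lookup b i)"
      using eq by simp
    then show "\<forall>i\<in>insert x X. lookup a i = lookup b i"
      using w[of a b] B x by blast
  qed
qed simp

text \<open>On the curve with coordinates \<open>t ^ w i\<close> the polynomial turns into the
  univariate \<open>q\<close>. As \<open>W\<close> separates its exponents, no coefficients merge,
  and a univariate complex polynomial that vanishes everywhere is zero.\<close>

lemma polys_subset_vanishing_imp_0:
  fixes p :: "'x mpol"
  assumes "finite X" "p \<in> polys X"
    and van: "\<And>v. keys v \<subseteq> X \<Longrightarrow> mpol_eval p v = 0"
  shows "p = 0"
proof (rule ccontr)
  assume "p \<noteq> 0"
  define B where "B = Suc (\<Sum>a\<in>keys p. \<Sum>i\<in>X. lookup a i)"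
  have B: "lookup a i < B" if "a \<in> keys p" "i \<in> X" for a i
  proof -
    have "lookup a i \<le> (\<Sum>i\<in>X. lookup a i)"
      using assms(1) that by (intro member_le_sum) auto
    also have "\<dots> \<le> (\<Sum>a\<in>keys p. \<Sum>i\<in>X. lookup a i)"
      using that by (intro member_le_sum[of a]) auto
    finally show ?thesis by (simp add: B_def)
  qed
  obtain w :: "'x \<Rightarrow> nat" where w: "\<And>a b :: 'x \<Rightarrow>\<^sub>0 nat.
    (\<forall>i\<in>X. lookup a i < B \<and> lookup b i < B) \<Longrightarrow>
    (\<Sum>i\<in>X. w i * lookup a i) = (\<Sum>i\<in>X. w i * lookup b i) \<Longrightarrow>
    (\<forall>i\<in>X. lookup a i = lookup b i)"
    using exists_separating_weight[OF assms(1), of B] by blast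
  define W where "W a = (\<Sum>i\<in>X. w i * lookup a i)" for a :: "'x \<Rightarrow>\<^sub>0 nat"
  have injW: "a = b" if "a \<in> keys p" "b \<in> keys p" "W a = W b" for a b
  proof (rule poly_mapping_eqI)
    fix i
    show "lookup a i = lookup b i"
    proof (cases "i \<in> X")
      case True
      then show ?thesis using w[of a b] that B by (simp add: W_def)
    next
      case False
      then have "i \<notin> keys a" "i \<notin> keys b"
        using that assms(2) by (auto simp: polys_def)
      then show ?thesis by (simp add: in_keys_iff)
    qed
  qed
  define q where "q = (\<Sum>a\<in>keys p. monom (lookup p a) (W a))"
  have "poly q t = 0" for t
  proof -
    define v where "v = (\<Sum>i\<in>X. single i (t ^ w i))"
    have v: "lookup v i = (if i \<in> X then t ^ w i else 0)" for i
      using assms(1) by (auto simp: v_def lookup_sum lookup_single when_def)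
    have "cmon (lookup v) a = t ^ W a" if "a \<in> keys p" for a
    proof -
      have "cmon (lookup v) a = (\<Prod>i\<in>X. lookup v i ^ lookup a i)"
        using that assms by (intro cmon_superset) (auto simp: polys_def)
      also have "\<dots> = (\<Prod>i\<in>X. t ^ (w i * lookup a i))"
        by (rule prod.cong) (auto simp: v power_mult)
      finally show ?thesis by (simp add: W_def power_sum)
    qed
    then have "mpol_eval p v = poly q t"
      by (simp add: mpol_eval_eq q_def poly_sum poly_monom)
    moreover have "keys v \<subseteq> X" by (auto simp: in_keys_iff v split: if_splits)
    ultimately show ?thesis using van by simp
  qed
  then have "q = 0" using poly_all_0_iff_0 by blast
  obtain a where a: "a \<in> keys p" using \<open>p \<noteq> 0\<close> by fastforce
  have "coeff q (W a) = (\<Sum>b\<in>keys p. if W b = W a then lookup p b else 0)"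
    by (simp add: q_def coeff_sum)
  also have "\<dots> = (\<Sum>b\<in>keys p. if b = a then lookup p b else 0)"
    using injW a by (intro sum.cong) auto
  also have "\<dots> = lookup p a" using a by simp
  finally show False using a \<open>q = 0\<close> by (simp add: in_keys_iff)
qed

lemma polys_0 [simp]: "0 \<in> polys V" and polys_1 [simp]: "1 \<in> polys V"
  by (auto simp: polys_def)

lemma polys_add: "p \<in> polys V \<Longrightarrow> q \<in> polys V \<Longrightarrow> p + q \<in> polys V"
  using keys_add[of p q] by (auto simp: polys_def)

lemma polys_mult: "p \<in> polys V \<Longrightarrow> q \<in> polys V \<Longrightarrow> p * q \<in> polys V"
proof -
  assume pq: "p \<in> polys V" "q \<in> polys V"
  have "keys c \<subseteq> V" if c: "c \<in> keys (p * q)" for c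
  proof -
    obtain a b where ab: "c = a + b" "a \<in> keys p" "b \<in> keys q"
      using c keys_mult[of p q] by auto
    have "keys a \<subseteq> V" "keys b \<subseteq> V"
      using pq ab by (auto simp: polys_def)
    then show ?thesis using keys_add[of a b] ab(1) by auto
  qed
  then show ?thesis by (simp add: polys_def)
qed

lemma polys_power: "p \<in> polys V \<Longrightarrow> p ^ k \<in> polys V"
  by (induction k) (auto intro: polys_mult)

lemma polys_sum: "(\<And>i. i \<in> I \<Longrightarrow> p i \<in> polys V) \<Longrightarrow> (\<Sum>i\<in>I. p i) \<in> polys V"
  by (induction I rule: infinite_finite_induct) (auto intro: polys_add)

lemma polys_prod: "(\<And>i. i \<in> I \<Longrightarrow> p i \<in> polys V) \<Longrightarrow> (\<Prod>i\<in>I. p i) \<in> polys V"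
  by (induction I rule: infinite_finite_induct) (auto intro: polys_mult)

lemma polys_cscale: "p \<in> polys V \<Longrightarrow> cscale x p \<in> polys V"
  by (auto simp: polys_def in_keys_iff)

lemma polys_single: "keys a \<subseteq> V \<Longrightarrow> single a x \<in> polys V"
  by (auto simp: polys_def)

lemma polys_cmon:
  assumes "\<And>i. i \<in> X \<Longrightarrow> c i \<in> polys V" "keys a \<subseteq> X"
  shows "cmon c a \<in> polys V"
  unfolding cmon_def using assms by (intro polys_prod polys_power) auto

definition subst :: "('x \<Rightarrow> 'v mpol) \<Rightarrow> 'x mpol \<Rightarrow> 'v mpol" where
  "subst c F = (\<Sum>a\<in>keys F. cscale (lookup F a) (cmon c a))"

lemma subst_superset:
  assumes "finite S" "keys F \<subseteq> S"
  shows "subst c F = (\<Sum>a\<in>S. cscale (lookup F a) (cmon c a))"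
  unfolding subst_def using assms
  by (intro sum.mono_neutral_left) (auto simp: in_keys_iff)

lemma subst_linear: "Vector_Spaces.linear cscale cscale (subst c)"
proof -
  have "subst c (p + q) = subst c p + subst c q" for p q
  proof -
    let ?S = "keys p \<union> keys q"
    have "subst c (p + q) = (\<Sum>a\<in>?S. cscale (lookup (p + q) a) (cmon c a))"
      using keys_add[of p q] by (intro subst_superset) auto
    also have "\<dots> = subst c p + subst c q"
      by (simp add: subst_superset[of ?S] lookup_add cvs.scale_left_distrib sum.distrib)
    finally show ?thesis .
  qed
  moreover have "subst c (cscale x p) = cscale x (subst c p)" for x p
  proof -
    have "subst c (cscale x p) = (\<Sum>a\<in>keys p. cscale (lookup (cscale x p) a) (cmon c a))"
      by (intro subst_superset) (auto simp: in_keys_iff)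
    then show ?thesis by (simp add: subst_def cvs.scale_sum_right)
  qed
  ultimately show ?thesis by (auto simp: Vector_Spaces.linear_iff cvs.vector_space_axioms)
qed

lemma subst_single: "subst c (single a 1) = cmon c a"
  by (simp add: subst_def)

lemma mpol_eval_subst:
  "mpol_eval (subst c F) v = (\<Sum>a\<in>keys F. lookup F a * cmon (\<lambda>i. mpol_eval (c i) v) a)"
  by (simp add: subst_def mpol_eval_sum mpol_eval_cscale mpol_eval_cmon)

lemma forms_subset_polys: "forms X m \<subseteq> polys X"
  by (auto simp: forms_def polys_def coord_space_def monoms_def)

text \<open>Passing to the closure adds no condition on a polynomial, so ideals can be computed on
  the parametrised points alone.\<close>

lemma ideal_part_zariski_closure:
  assumes "S \<subseteq> coord_space X"
  shows "ideal_part X (zariski_closure X S) m = {F \<in> forms X m. \<forall>s\<in>S. mpol_eval F s = 0}"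
  using assms forms_subset_polys[of X m] by (auto simp: ideal_part_def zariski_closure_def)

text \<open>A form vanishes on the cone iff substituting the parametrisation gives the zero
  polynomial. Hence the ideal is the kernel of \<open>subst c\<close>, and by rank and nullity the
  difference of dimensions is the dimension of its image, which the \<open>cmon c a\<close>
  span.\<close>

theorem hilbert_function_parametrized:
  fixes c :: "'x \<Rightarrow> 'v mpol"
  assumes X: "finite X" and V: "finite V" and c: "\<And>i. i \<in> X \<Longrightarrow> c i \<in> polys V"
    and SX: "S \<subseteq> coord_space X"
    and S: "\<And>v. keys v \<subseteq> V \<Longrightarrow> \<exists>s\<in>S. \<forall>i\<in>X. lookup s i = mpol_eval (c i) v"
      "\<And>s. s \<in> S \<Longrightarrow> \<exists>v. keys v \<subseteq> V \<and> (\<forall>i\<in>X. lookup s i = mpol_eval (c i) v)"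
  shows "hilbert_function X (zariski_closure X S) m = cvs.dim (cmon c ` monoms X m)"
proof -
  have eval: "mpol_eval (subst c F) v = mpol_eval F s"
    if F: "F \<in> forms X m" and s: "\<forall>i\<in>X. lookup s i = mpol_eval (c i) v" for F s v
    unfolding mpol_eval_subst mpol_eval_eq[of F]
  proof (rule sum.cong)
    fix a assume "a \<in> keys F"
    then have "keys a \<subseteq> X" using F forms_subset_polys by (fastforce simp: polys_def)
    then show "lookup F a * cmon (\<lambda>i. mpol_eval (c i) v) a
        = lookup F a * cmon (lookup s) a"
      using s by (auto simp: cmon_def intro!: prod.cong)
  qed simp
  have "ideal_part X (zariski_closure X S) m = {F \<in> forms X m. subst c F = 0}"
    unfolding ideal_part_zariski_closure[OF SX]
  proof (intro Collect_cong conj_cong refl iffI)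
    fix F assume F: "F \<in> forms X m" and van: "\<forall>s\<in>S. mpol_eval F s = 0"
    show "subst c F = 0"
    proof (rule polys_subset_vanishing_imp_0[OF V])
      have "keys a \<subseteq> X" if "a \<in> keys F" for a
        using that F forms_subset_polys by (fastforce simp: polys_def)
      then show "subst c F \<in> polys V"
        unfolding subst_def using c by (intro polys_sum polys_cscale polys_cmon[of X]) auto
      fix v :: "'v \<Rightarrow>\<^sub>0 complex" assume v: "keys v \<subseteq> V"
      show "mpol_eval (subst c F) v = 0" using S(1)[OF v] eval[OF F] van by auto
    qed
  next
    fix F assume F: "F \<in> forms X m" and "subst c F = 0"
    then show "\<forall>s\<in>S. mpol_eval F s = 0" using S(2) eval[OF F] by (metis mpol_eval_0)
  qed
  moreover have "cvs.dim (forms X m) = cvs.dim {F \<in> forms X m. subst c F = 0} + cvs.dim (subst c ` forms X m)"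
    unfolding forms_def using finite_monoms[OF X, of m]
    by (intro cvs_rank_nullity[OF subst_linear coord_space_subspace, of "(\<lambda>a. single a 1) ` monoms X m"])
      (auto simp: coord_space_eq_span)
  moreover have "subst c ` forms X m = cvs.span (cmon c ` monoms X m)"
    unfolding forms_def coord_space_eq_span cvp.linear_span_image[OF subst_linear, symmetric]
    by (simp add: image_image subst_single)
  ultimately show ?thesis by (simp add: hilbert_function_def)
qed

lemma mem_monoms_degree: "a \<in> monoms X m \<Longrightarrow> (\<Sum>i\<in>keys a. lookup a i) = m"
  by (simp add: monoms_def)

text \<open>The exponents in \<open>U\<close> are the leading exponents of relations among the
  \<open>c i\<close>. Multiplying a relation by \<open>cmon c b\<close> shifts its exponents by
  \<open>b\<close>, and the order is compatible with addition, so \<open>U\<close> is closed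
  upwards; its complement counts the dimension.\<close>

theorem eventually_poly_dim_cmon:
  fixes c :: "'x::linorder \<Rightarrow> 'v mpol"
  assumes X: "finite X"
  shows "eventually_poly (\<lambda>m. of_nat (cvs.dim (cmon c ` monoms X m)))"
proof -
  define U where "U = {a. \<exists>m. a \<in> monoms X m \<and> cmon c a \<in> cvs.span (cmon c ` {b \<in> monoms X m. b < a})}"
  have "eventually_poly (\<lambda>m. of_nat (card (monoms X m - U)))"
  proof (rule eventually_poly_card_monoms_diff_upset[OF X])
    fix a b :: "'x \<Rightarrow>\<^sub>0 nat" assume a: "a \<in> U" and b: "keys b \<subseteq> X"
    define k where "k = (\<Sum>i\<in>keys b. lookup b i)"
    have bk: "b \<in> monoms X k" using b by (simp add: monoms_def k_def)
    obtain m where m: "a \<in> monoms X m" "cmon c a \<in> cvs.span (cmon c ` {b \<in> monoms X m. b < a})"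
      using a by (auto simp: U_def)
    have "cmon c (a + b) \<in> cvs.span ((\<lambda>s. s * cmon c b) ` (cmon c ` {b \<in> monoms X m. b < a}))"
      unfolding cmon_add by (rule cvs_span_mult_right[OF m(2)])
    also have "\<dots> \<subseteq> cvs.span (cmon c ` {b' \<in> monoms X (m + k). b' < a + b})"
    proof (rule cvs.span_mono, clarsimp)
      fix a' assume "a' \<in> monoms X m" "a' < a"
      then show "cmon c a' * cmon c b \<in> cmon c ` {b' \<in> monoms X (m + k). b' < a + b}"
        using monoms_add[OF X _ bk] by (intro image_eqI[of _ _ "a' + b"]) (auto simp: cmon_add)
    qed
    finally show "a + b \<in> U" using monoms_add[OF X m(1) bk] by (auto simp: U_def)
  qed
  moreover have "card (monoms X m - U) = cvs.dim (cmon c ` monoms X m)" for m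
  proof -
    have "monoms X m - U = {a \<in> monoms X m. cmon c a \<notin> cvs.span (cmon c ` {b \<in> monoms X m. b < a})}"
      by (auto simp: U_def dest: mem_monoms_degree)
    then show ?thesis by (simp add: cvs_dim_eq_card_standard[OF finite_monoms[OF X]])
  qed
  ultimately show ?thesis by simp
qed

section \<open>Prime ideals, elimination and Gauss's lemma\<close>

text \<open>A commutative ring as a module over itself: the subspaces are the ideals, the spans the
  generated ideals.\<close>

interpretation rideal: module "(*) :: 'r::comm_ring_1 \<Rightarrow> 'r \<Rightarrow> 'r"
  by unfold_locales (auto simp: algebra_simps)

text \<open>For this scaling the rule reads \<open>a * (b * x) = a * b * x\<close>, the reverse of
  \<open>mult.assoc\<close>.\<close>

declare rideal.scale_scale [simp del]

definition prime_ideal :: "'r::comm_ring_1 set \<Rightarrow> bool" where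
  "prime_ideal P \<longleftrightarrow> rideal.subspace P \<and> 1 \<notin> P \<and> (\<forall>x y. x * y \<in> P \<longrightarrow> x \<in> P \<or> y \<in> P)"

lemma prime_idealD:
  assumes "prime_ideal P"
  shows "rideal.subspace P" "1 \<notin> P" "x * y \<in> P \<Longrightarrow> x \<in> P \<or> y \<in> P"
  using assms by (auto simp: prime_ideal_def)

lemma prime_ideal_power:
  assumes "prime_ideal P" "x ^ k \<in> P"
  shows "x \<in> P"
  using assms(2) by (induction k) (use assms(1) in \<open>auto simp: prime_ideal_def\<close>)

lemma rideal_mult_right:
  assumes "rideal.subspace J" "x \<in> J"
  shows "x * y \<in> J"
  using rideal.subspace_scale[OF assms, of y] by (simp add: mult.commute)

lemma rideal_colon:
  assumes "rideal.subspace J"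
  shows "rideal.subspace {x. x * r \<in> J}"
  using assms by (auto simp: rideal.subspace_def distrib_right mult.assoc)

text \<open>An ideal that is maximal among those containing \<open>J\<close> and missing all powers
  of \<open>T\<close> is prime. This stands in for choosing a prime of the localisation at
  \<open>T\<close>.\<close>

lemma prime_avoidance:
  assumes J: "rideal.subspace J" and T: "\<And>k. T ^ k \<notin> J"
  shows "\<exists>P. prime_ideal P \<and> J \<subseteq> P \<and> T \<notin> P"
proof -
  define F where "F = {I. rideal.subspace I \<and> J \<subseteq> I \<and> (\<forall>k. T ^ k \<notin> I)}"
  have "\<exists>M\<in>F. \<forall>I\<in>F. M \<subseteq> I \<longrightarrow> I = M"
  proof (rule subset_Zorn_nonempty)
    show "F \<noteq> {}" using J T by (auto simp: F_def)
    fix C assume C: "C \<noteq> {}" "subset.chain F C"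
    have CF: "C \<subseteq> F" using C(2) by (simp add: subset_chain_def)
    have sub: "rideal.subspace A" if "A \<in> C" for A using CF that by (auto simp: F_def)
    have "rideal.subspace (\<Union>C)"
      unfolding rideal.subspace_def
    proof (intro conjI ballI allI)
      obtain A where A: "A \<in> C" using C(1) by blast
      then show "0 \<in> \<Union>C" using rideal.subspace_0[OF sub] by blast
      fix x assume "x \<in> \<Union>C"
      then obtain A where A: "A \<in> C" "x \<in> A" by blast
      show "c * x \<in> \<Union>C" for c using rideal.subspace_scale[OF sub[OF A(1)] A(2)] A(1) by blast
      fix y assume "y \<in> \<Union>C"
      then obtain B where B: "B \<in> C" "y \<in> B" by blast
      have "A \<subseteq> B \<or> B \<subseteq> A" using C(2) A(1) B(1) by (auto simp: subset_chain_def)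
      then obtain E where E: "E \<in> C" "x \<in> E" "y \<in> E" using A B by blast
      show "x + y \<in> \<Union>C" using rideal.subspace_add[OF sub[OF E(1)] E(2,3)] E(1) by blast
    qed
    moreover have "J \<subseteq> \<Union>C" using C(1) CF by (auto simp: F_def)
    moreover have "\<forall>k. T ^ k \<notin> \<Union>C" using CF by (auto simp: F_def)
    ultimately show "\<Union>C \<in> F" by (simp add: F_def)
  qed
  then obtain P where P: "P \<in> F" and max: "\<And>I. I \<in> F \<Longrightarrow> P \<subseteq> I \<Longrightarrow> I = P" by blast
  have sP: "rideal.subspace P" using P by (simp add: F_def)
  have ext: "\<exists>k c. T ^ k - c * x \<in> P" if "x \<notin> P" for x
  proof (rule ccontr)
    assume no: "\<not> ?thesis"
    have "T ^ k \<notin> rideal.span (insert x P)" for k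
      using no by (simp add: rideal.span_insert sP rideal.span_eq_iff[THEN iffD2])
    moreover have "J \<subseteq> rideal.span (insert x P)"
      using P rideal.span_superset[of "insert x P"] by (auto simp: F_def)
    ultimately have "rideal.span (insert x P) \<in> F" by (simp add: F_def)
    moreover have "P \<subseteq> rideal.span (insert x P)" "x \<in> rideal.span (insert x P)"
      using rideal.span_superset[of "insert x P"] by auto
    ultimately show False using max that by blast
  qed
  have "x \<in> P \<or> y \<in> P" if xy: "x * y \<in> P" for x y
  proof (rule ccontr)
    assume "\<not> ?thesis"
    then obtain k c l e where k: "T ^ k - c * x \<in> P" and l: "T ^ l - e * y \<in> P"
      using ext by meson
    have "T ^ (k + l) = (T ^ k - c * x) * T ^ l + (c * x) * (T ^ l - e * y) + (c * e) * (x * y)"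
      by (simp add: algebra_simps power_add)
    also have "\<dots> \<in> P"
      using sP k l xy by (intro rideal.subspace_add rideal_mult_right[OF sP k]) (auto intro: rideal.subspace_scale)
    finally show False using P by (auto simp: F_def)
  qed
  moreover have "1 \<notin> P" "T \<notin> P" "J \<subseteq> P"
    using P by (auto simp: F_def dest: spec[of _ 0] spec[of _ 1])
  ultimately show ?thesis using sP by (auto simp: prime_ideal_def)
qed

text \<open>
  The elimination behind Nakayama's lemma, performed one generator at a time instead of through
  Cramer's rule, and keeping track of degrees.
\<close>

lemma graded_elimination:
  fixes G D :: "nat \<Rightarrow> 'r::comm_ring_1 set"
  assumes G: "\<And>e x y. x \<in> G e \<Longrightarrow> y \<in> G e \<Longrightarrow> x + y \<in> G e"
      "\<And>e x y. x \<in> G e \<Longrightarrow> y \<in> G e \<Longrightarrow> x - y \<in> G e"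
      "\<And>e f x y. x \<in> G e \<Longrightarrow> y \<in> G f \<Longrightarrow> x * y \<in> G (e + f)"
    and D: "\<And>e. 0 \<in> D e" "\<And>e x y. x \<in> D e \<Longrightarrow> y \<in> D e \<Longrightarrow> x + y \<in> D e"
      "\<And>e f x y. x \<in> G e \<Longrightarrow> y \<in> D f \<Longrightarrow> x * y \<in> D (e + f)"
    and P: "prime_ideal P"
    and "finite I" "s \<in> G e" "s \<notin> P"
    and "\<And>b. b \<in> I \<Longrightarrow> \<exists>m. (\<forall>j\<in>I. m j \<in> G e \<inter> P) \<and> s * b - (\<Sum>j\<in>I. m j * j) \<in> D e"
  shows "\<exists>e' s'. s' \<in> G e' \<and> s' \<notin> P \<and> (\<forall>b\<in>I. s' * b \<in> D e')"
  using assms(8-)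
proof (induction I arbitrary: e s)
  case empty
  then show ?case by blast
next
  case (insert k I)
  have sP: "rideal.subspace P" using prime_idealD[OF P] by simp
  obtain m where m: "\<forall>j\<in>insert k I. m j \<in> G e \<inter> P" "s * k - (\<Sum>j\<in>insert k I. m j * j) \<in> D e"
    using insert.prems(3)[of k] by blast
  \<comment> \<open>The relation for \<open>k\<close> is solved for \<open>k\<close>; its
    coefficient stays outside \<open>P\<close> because \<open>m k\<close> lies in
    \<open>P\<close>.\<close>
  define \<sigma> where "\<sigma> = s - m k"
  have \<sigma>G: "\<sigma> \<in> G e" using G(2) insert.prems(1) m(1) by (simp add: \<sigma>_def)
  have \<sigma>P: "\<sigma> \<notin> P"
  proof
    assume "\<sigma> \<in> P"
    then have "\<sigma> + m k \<in> P" using m(1) by (intro rideal.subspace_add[OF sP]) auto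
    then show False using insert.prems(2) by (simp add: \<sigma>_def)
  qed
  define d where "d = \<sigma> * k - (\<Sum>j\<in>I. m j * j)"
  have dD: "d \<in> D e"
    using m(2) insert.hyps by (simp add: d_def \<sigma>_def algebra_simps)
  have "\<exists>e' s'. s' \<in> G e' \<and> s' \<notin> P \<and> (\<forall>b\<in>I. s' * b \<in> D e')"
  proof (rule insert.IH[of "\<sigma> * s" "e + e"])
    show "\<sigma> * s \<in> G (e + e)" by (rule G(3)[OF \<sigma>G insert.prems(1)])
    show "\<sigma> * s \<notin> P" using prime_idealD(3)[OF P] \<sigma>P insert.prems(2) by blast
    fix b assume b: "b \<in> I"
    obtain q where q: "\<forall>j\<in>insert k I. q j \<in> G e \<inter> P" "s * b - (\<Sum>j\<in>insert k I. q j * j) \<in> D e"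
      using insert.prems(3)[of b] b by blast
    \<comment> \<open>The relation for \<open>b\<close>, multiplied by \<open>\<sigma>\<close>, has
      \<open>k\<close> eliminated by means of \<open>d\<close>. The new coefficients are again in
      \<open>P\<close>, and the degree doubles.\<close>
    define r where "r j = \<sigma> * q j + q k * m j" for j
    have "r j \<in> G (e + e) \<inter> P" if "j \<in> I" for j
      using q(1) m(1) that \<sigma>G unfolding r_def
      by (auto intro!: G(1) G(3) rideal.subspace_add[OF sP] rideal.subspace_scale[OF sP])
    moreover have "\<sigma> * s * b - (\<Sum>j\<in>I. r j * j) = \<sigma> * (s * b - (\<Sum>j\<in>insert k I. q j * j)) + q k * d"
      using insert.hyps
      by (simp add: r_def d_def algebra_simps sum.distrib sum_distrib_left)
    moreover have "\<dots> \<in> D (e + e)"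
      using q m(1) \<sigma>G dD by (intro D(2) D(3)) auto
    ultimately show "\<exists>m. (\<forall>j\<in>I. m j \<in> G (e + e) \<inter> P) \<and> \<sigma> * s * b - (\<Sum>j\<in>I. m j * j) \<in> D (e + e)"
      by metis
  qed
  then obtain e' s' where s': "s' \<in> G e'" "s' \<notin> P" "\<And>b. b \<in> I \<Longrightarrow> s' * b \<in> D e'" by blast
  have "\<sigma> * s' \<in> G (e + e')" by (rule G(3)[OF \<sigma>G s'(1)])
  moreover have "\<sigma> * s' \<notin> P" using prime_idealD(3)[OF P] \<sigma>P s'(2) by blast
  moreover have "\<sigma> * s' * b \<in> D (e + e')" if "b \<in> insert k I" for b
  proof (cases "b = k")
    case True
    have "(\<Sum>j\<in>I'. m j * (s' * j)) \<in> D (e + e')" if "I' \<subseteq> I" for I'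
      using finite_subset[OF that insert.hyps(1)] that
    proof (induction I')
      case (insert j I')
      then show ?case using m(1) s'(3) by (auto intro!: D(2) D(3))
    qed (simp add: D(1))
    then have "s' * d + (\<Sum>j\<in>I. m j * (s' * j)) \<in> D (e + e')"
      using D(2) D(3)[OF s'(1) dD] by (simp add: add.commute)
    moreover have "\<sigma> * s' * k = s' * d + (\<Sum>j\<in>I. m j * (s' * j))"
      by (simp add: d_def algebra_simps sum_distrib_left)
    ultimately show ?thesis using True by simp
  next
    case False
    then have "\<sigma> * (s' * b) \<in> D (e + e')" using that s'(3) \<sigma>G by (intro D(3)) auto
    then show ?thesis by (simp add: mult.assoc)
  qed
  ultimately show ?case by blast
qed

text \<open>The elimination with trivial grading. First, membership in the span is turned into one
  coefficient from \<open>P\<close> for each element of \<open>I\<close>.\<close>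

lemma local_nakayama:
  fixes I :: "'r::comm_ring_1 set"
  assumes P: "prime_ideal P" and J: "rideal.subspace J" and I: "finite I" and s: "s \<notin> P"
    and sI: "\<And>i. i \<in> I \<Longrightarrow> s * i \<in> rideal.span (J \<union> {p * i |p i. p \<in> P \<and> i \<in> I})"
  shows "\<exists>s'. s' \<notin> P \<and> (\<forall>i\<in>I. s' * i \<in> J)"
proof -
  have sP: "rideal.subspace P" using prime_idealD[OF P] by simp
  let ?Q = "{x. \<exists>m. (\<forall>j\<in>I. m j \<in> P) \<and> x - (\<Sum>j\<in>I. m j * j) \<in> J}"
  have "rideal.subspace ?Q"
    unfolding rideal.subspace_def
  proof (intro conjI ballI allI)
    show "0 \<in> ?Q"
      using J sP by (auto intro!: exI[of _ "\<lambda>_. 0"] simp: rideal.subspace_0)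
    fix x assume "x \<in> ?Q"
    then obtain m where m: "\<forall>j\<in>I. m j \<in> P" "x - (\<Sum>j\<in>I. m j * j) \<in> J" by blast
    show "c * x \<in> ?Q" for c
    proof -
      have "c * x - (\<Sum>j\<in>I. (c * m j) * j) = c * (x - (\<Sum>j\<in>I. m j * j))"
        by (simp add: right_diff_distrib sum_distrib_left mult.assoc)
      then show ?thesis
        using m rideal.subspace_scale[OF J m(2), of c] rideal.subspace_scale[OF sP]
        by (intro CollectI exI[of _ "\<lambda>j. c * m j"]) auto
    qed
    fix y assume "y \<in> ?Q"
    then obtain q where q: "\<forall>j\<in>I. q j \<in> P" "y - (\<Sum>j\<in>I. q j * j) \<in> J" by blast
    have "x + y - (\<Sum>j\<in>I. (m j + q j) * j) = (x - (\<Sum>j\<in>I. m j * j)) + (y - (\<Sum>j\<in>I. q j * j))"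
      by (simp add: distrib_right sum.distrib)
    then have "x + y - (\<Sum>j\<in>I. (m j + q j) * j) \<in> J"
      using rideal.subspace_add[OF J m(2) q(2)] by (simp only:)
    moreover have "\<forall>j\<in>I. m j + q j \<in> P" using m(1) q(1) rideal.subspace_add[OF sP] by blast
    ultimately show "x + y \<in> ?Q" by (intro CollectI exI[of _ "\<lambda>j. m j + q j"] conjI)
  qed
  moreover have "J \<subseteq> ?Q"
    using sP by (auto intro!: exI[of _ "\<lambda>_. 0"] simp: rideal.subspace_0)
  moreover have "{p * i |p i. p \<in> P \<and> i \<in> I} \<subseteq> ?Q"
  proof clarify
    fix p i assume p: "p \<in> P" and i: "i \<in> I"
    have "(\<Sum>j\<in>I. (if j = i then p else 0) * j) = (\<Sum>j\<in>I. if j = i then p * j else 0)"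
      by (rule sum.cong) auto
    also have "\<dots> = p * i" using I i by simp
    finally show "\<exists>m. (\<forall>j\<in>I. m j \<in> P) \<and> p * i - (\<Sum>j\<in>I. m j * j) \<in> J"
      using p J sP by (intro exI[of _ "\<lambda>j. if j = i then p else 0"]) (auto simp: rideal.subspace_0)
  qed
  ultimately have "rideal.span (J \<union> {p * i |p i. p \<in> P \<and> i \<in> I}) \<subseteq> ?Q"
    by (intro rideal.span_minimal) auto
  then have "\<And>i. i \<in> I \<Longrightarrow> \<exists>m. (\<forall>j\<in>I. m j \<in> UNIV \<inter> P) \<and> s * i - (\<Sum>j\<in>I. m j * j) \<in> J"
    using sI by fastforce
  then show ?thesis
    using graded_elimination[of "\<lambda>_. UNIV" "\<lambda>_. J" P I s 0] P I s J
    by (auto simp: rideal.subspace_0 rideal.subspace_add rideal.subspace_scale)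
qed

text \<open>
  Localising at a prime over \<open>J\<close> not containing \<open>T\<close>, Nakayama's lemma turns the containment of
  \<open>I\<close> in \<open>J + P I\<close> into \<open>I \<subseteq> J\<close>; if this is possible at all such primes, then
  \<open>r\<close> is killed by a power of \<open>T\<close> modulo \<open>J\<close>.
\<close>

lemma saturation:
  fixes J :: "'r::comm_ring_1 set"
  assumes J: "rideal.subspace J"
    and loc: "\<And>P. prime_ideal P \<Longrightarrow> J \<subseteq> P \<Longrightarrow> T \<notin> P \<Longrightarrow>
      \<exists>I s. finite I \<and> r \<in> rideal.span I \<and> s \<notin> P \<and>
        (\<forall>i\<in>I. s * i \<in> rideal.span (J \<union> {p * i |p i. p \<in> P \<and> i \<in> I}))"
  shows "\<exists>K. T ^ K * r \<in> J"
proof (rule ccontr)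
  assume no: "\<not> ?thesis"
  \<comment> \<open>If no power of \<open>T\<close> carries \<open>r\<close> into \<open>J\<close>,
    some prime \<open>P\<close> contains \<open>\<aa>\<close> and misses \<open>T\<close>.
    Nakayama's multiplier outside \<open>P\<close> carries \<open>r\<close> into \<open>J\<close>,
    so it belongs to \<open>\<aa>\<close>, a contradiction.\<close>
  define \<aa> where "\<aa> = {x. x * r \<in> J}"
  have sa: "rideal.subspace \<aa>" unfolding \<aa>_def by (rule rideal_colon[OF J])
  have "\<And>k. T ^ k \<notin> \<aa>" using no by (simp add: \<aa>_def)
  then obtain P where P: "prime_ideal P" "\<aa> \<subseteq> P" "T \<notin> P" using prime_avoidance[OF sa] by blast
  have "J \<subseteq> \<aa>" using rideal_mult_right[OF J] by (auto simp: \<aa>_def)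
  then have "J \<subseteq> P" using P(2) by blast
  then obtain I s where I: "finite I" "r \<in> rideal.span I" "s \<notin> P"
    "\<And>i. i \<in> I \<Longrightarrow> s * i \<in> rideal.span (J \<union> {p * i |p i. p \<in> P \<and> i \<in> I})"
    using loc[OF P(1)] P(3) by blast
  obtain s' where s': "s' \<notin> P" "\<And>i. i \<in> I \<Longrightarrow> s' * i \<in> J"
    using local_nakayama[OF P(1) J I(1,3,4)] by blast
  have "rideal.span I \<subseteq> {x. x * s' \<in> J}"
    using s'(2) by (intro rideal.span_minimal rideal_colon[OF J]) (auto simp: mult.commute)
  then have "s' \<in> \<aa>" using I(2) by (auto simp: \<aa>_def mult.commute)
  then show False using P(2) s'(1) by blast
qed

text \<open>The coefficient at \<open>\<gamma>\<close> of a product of two polynomials with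
  coefficient families \<open>g\<close> and \<open>h\<close>. The values lie in any commutative
  ring: they are indeterminates in the algebra \<open>A\<close>, and numbers at a point.\<close>

definition prod_coeff :: "'e::plus set \<Rightarrow> ('e \<Rightarrow> 'r::comm_ring_1) \<Rightarrow> ('e \<Rightarrow> 'r) \<Rightarrow> 'e \<Rightarrow> 'r" where
  "prod_coeff S g h \<gamma> = (\<Sum>(a, b)\<in>{(a, b) \<in> S \<times> S. a + b = \<gamma>}. g a * h b)"

lemma finite_sum_pairs: "finite S \<Longrightarrow> finite {(a, b) \<in> S \<times> S. a + b = \<gamma>}"
  by (rule finite_subset[of _ "S \<times> S"]) auto

lemma prod_coeff_commute:
  fixes S :: "'e::ab_semigroup_add set"
  shows "prod_coeff S g h \<gamma> = prod_coeff S h g \<gamma>"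
  unfolding prod_coeff_def
  by (rule sum.reindex_bij_witness[of _ "\<lambda>(a, b). (b, a)" "\<lambda>(a, b). (b, a)"])
    (auto simp: ac_simps)

lemma prod_coeff_in_ideal:
  assumes "rideal.subspace J" "\<And>a b. a \<in> S \<Longrightarrow> b \<in> S \<Longrightarrow> a + b = \<gamma> \<Longrightarrow> g a * h b \<in> J"
  shows "prod_coeff S g h \<gamma> \<in> J"
  unfolding prod_coeff_def using assms(2) by (intro rideal.subspace_sum[OF assms(1)]) auto

text \<open>The multiplier \<open>s\<close> allows for terms that enter the ideal only after
  multiplication, as in the triangular elimination.\<close>

lemma prod_coeff_extract:
  assumes J: "rideal.subspace J" and S: "finite S" "a \<in> S" "b \<in> S"
    and c: "s * prod_coeff S g h (a + b) \<in> J"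
    and others: "\<And>a' b'. a' \<in> S \<Longrightarrow> b' \<in> S \<Longrightarrow> a' + b' = a + b \<Longrightarrow> (a', b') \<noteq> (a, b) \<Longrightarrow>
      s * (g a' * h b') \<in> J"
  shows "s * (g a * h b) \<in> J"
proof -
  let ?A = "{(x, y) \<in> S \<times> S. x + y = a + b}"
  have eq: "s * prod_coeff S g h (a + b) = s * (g a * h b) + (\<Sum>(x, y)\<in>?A - {(a, b)}. s * (g x * h y))"
    unfolding prod_coeff_def using S
    by (subst sum.remove[OF finite_sum_pairs[OF S(1)], of "(a, b)"])
      (auto simp: distrib_left sum_distrib_left case_prod_unfold)
  have "(\<Sum>(x, y)\<in>?A - {(a, b)}. s * (g x * h y)) \<in> J"
    using others by (intro rideal.subspace_sum[OF J]) auto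
  from rideal.subspace_diff[OF J c this] show ?thesis unfolding eq by (simp only: add_diff_cancel_right')
qed

text \<open>
  Gauss's lemma modulo a prime \<open>P\<close>: the product of the lowest terms with respect to the order that
  compares \<open>wt\<close> first cannot cancel.
\<close>

lemma gauss_lowest_term:
  fixes S :: "'e::linordered_cancel_ab_semigroup_add set" and wt :: "'e \<Rightarrow> int"
  assumes P: "prime_ideal P" and S: "finite S" and wt: "\<And>a b. wt (a + b) = wt a + wt b"
    and g: "a0 \<in> S" "g a0 \<notin> P" and h: "b0 \<in> S" "h b0 \<notin> P"
  shows "\<exists>a\<in>S. \<exists>b\<in>S. (\<forall>a'\<in>S. g a' \<notin> P \<longrightarrow> wt a \<le> wt a') \<and> (\<forall>b'\<in>S. h b' \<notin> P \<longrightarrow> wt b \<le> wt b') \<and>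
    prod_coeff S g h (a + b) \<notin> P"
proof -
  have low: "\<exists>a\<in>S. f a \<notin> P \<and> (\<forall>a'\<in>S. f a' \<notin> P \<longrightarrow> wt a \<le> wt a' \<and> (wt a' = wt a \<longrightarrow> a \<le> a'))"
    if "c \<in> S" "f c \<notin> P" for f c
  proof -
    let ?A = "{a \<in> S. f a \<notin> P}"
    let ?B = "{a \<in> ?A. wt a = Min (wt ` ?A)}"
    have A: "finite ?A" "?A \<noteq> {}" using S that by auto
    have "Min (wt ` ?A) \<in> wt ` ?A" using A by (intro Min_in) auto
    then have "?B \<noteq> {}" by auto
    moreover have "finite ?B" using A(1) by (rule rev_finite_subset) auto
    ultimately have B: "finite ?B" "?B \<noteq> {}" by simp_all
    have "Min ?B \<in> ?B" by (rule Min_in[OF B])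
    moreover have "wt (Min ?B) \<le> wt a'" if "a' \<in> ?A" for a'
    proof -
      have "wt (Min ?B) = Min (wt ` ?A)" using \<open>Min ?B \<in> ?B\<close> by blast
      also have "\<dots> \<le> wt a'" using A(1) that by (intro Min_le) blast+
      finally show ?thesis .
    qed
    moreover have "Min ?B \<le> a'" if "a' \<in> ?A" "wt a' = wt (Min ?B)" for a'
    proof (rule Min_le[OF B(1)])
      have "wt (Min ?B) = Min (wt ` ?A)" using \<open>Min ?B \<in> ?B\<close> by blast
      then show "a' \<in> ?B" using that by simp
    qed
    ultimately show ?thesis by blast
  qed
  obtain a where a: "a \<in> S" "g a \<notin> P"
    "\<And>a'. a' \<in> S \<Longrightarrow> g a' \<notin> P \<Longrightarrow> wt a \<le> wt a' \<and> (wt a' = wt a \<longrightarrow> a \<le> a')"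
    using low[of a0 g] g by blast
  obtain b where b: "b \<in> S" "h b \<notin> P"
    "\<And>b'. b' \<in> S \<Longrightarrow> h b' \<notin> P \<Longrightarrow> wt b \<le> wt b' \<and> (wt b' = wt b \<longrightarrow> b \<le> b')"
    using low[of b0 h] h by blast
  have "prod_coeff S g h (a + b) \<notin> P"
  proof
    assume "prod_coeff S g h (a + b) \<in> P"
    have "1 * (g a * h b) \<in> P"
    proof (rule prod_coeff_extract[OF _ S a(1) b(1)])
      show sP: "rideal.subspace P" using prime_idealD[OF P] by simp
      show "1 * prod_coeff S g h (a + b) \<in> P" using \<open>prod_coeff S g h (a + b) \<in> P\<close> by simp
      fix a' b' assume ab: "a' \<in> S" "b' \<in> S" "a' + b' = a + b" "(a', b') \<noteq> (a, b)"
      have "g a' \<in> P \<or> h b' \<in> P"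
      proof (rule ccontr)
        assume "\<not> ?thesis"
        then have A: "wt a \<le> wt a'" "wt a' = wt a \<longrightarrow> a \<le> a'" and B: "wt b \<le> wt b'" "wt b' = wt b \<longrightarrow> b \<le> b'"
          using a(3)[OF ab(1)] b(3)[OF ab(2)] by auto
        \<comment> \<open>Equal sums of minimal weights force both weights to be minimal, so the
          comparisons of exponents apply.\<close>
        have "wt a' + wt b' = wt a + wt b" using ab(3) wt by metis
        then have le: "a \<le> a'" "b \<le> b'" using A B by auto
        show False
        proof (cases "a = a'")
          case True
          then show ?thesis using ab(3,4) by simp
        next
          case False
          then have "a + b < a' + b'" using le by (intro add_less_le_mono) auto
          then show ?thesis using ab(3) by simp
        qed
      qed
      then show "1 * (g a' * h b') \<in> P"
        using rideal_mult_right[OF sP] rideal.subspace_scale[OF sP] by auto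
    qed
    then show False using prime_idealD(3)[OF P] a(2) b(2) by auto
  qed
  then show ?thesis using a b by blast
qed

text \<open>Modulo \<open>P\<close>, the lowest weights of the factors add up to a weight that
  occurs in the product, and with \<open>- wt\<close> so do the highest. If the product has a single
  weight, so has each factor.\<close>

lemma gauss_weight_const:
  fixes S :: "'e::linordered_cancel_ab_semigroup_add set" and wt :: "'e \<Rightarrow> int"
  assumes P: "prime_ideal P" and S: "finite S" and wt: "\<And>a b. wt (a + b) = wt a + wt b"
    and c: "\<And>\<gamma>. prod_coeff S g h \<gamma> \<notin> P \<Longrightarrow> wt \<gamma> = w"
    and a: "a \<in> S" "g a \<notin> P" and b: "b \<in> S" "h b \<notin> P"
  shows "wt (a + b) = w"
proof -
  obtain x y where x: "wt x \<le> wt a" "wt y \<le> wt b" "prod_coeff S g h (x + y) \<notin> P"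
    using gauss_lowest_term[where wt = wt and g = g and h = h, OF P S wt a b] a b by blast
  obtain u v where u: "wt a \<le> wt u" "wt b \<le> wt v" "prod_coeff S g h (u + v) \<notin> P"
    using gauss_lowest_term[where wt = "\<lambda>a. - wt a" and g = g and h = h, OF P S _ a b] a b by (auto simp: wt)
  show ?thesis using c[OF x(3)] c[OF u(3)] x u by (simp add: wt)
qed

section \<open>Fibres of the squaring and multiplication maps\<close>

lemma monoms_lookup_le: "a \<in> monoms X d \<Longrightarrow> lookup a i \<le> d"
  by (cases "i \<in> keys a")
    (auto simp: monoms_def in_keys_iff intro: member_le_sum)

lemma monoms_eq_single:
  assumes "a \<in> monoms X d" "\<And>i. i \<noteq> j \<Longrightarrow> lookup a i = 0"
  shows "a = single j d"
proof -
  have "a = single j (lookup a j)"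
    by (rule poly_mapping_eqI) (use assms(2) in \<open>auto simp: lookup_single when_def\<close>)
  moreover have "lookup a j = d"
    using assms(1) by (subst (asm) calculation) (auto simp: monoms_def split: if_splits)
  ultimately show ?thesis by simp
qed

lemma monoms_lookup_eq_imp_single:
  assumes "a \<in> monoms X d" "lookup a j = d"
  shows "a = single j d"
proof (cases "d = 0")
  case True
  then show ?thesis using assms(1) by (simp add: monoms_0)
next
  case False
  have "lookup a i = 0" if "i \<noteq> j" for i
  proof (rule ccontr)
    assume "lookup a i \<noteq> 0"
    then have "{i, j} \<subseteq> keys a" using assms(2) False by (auto simp: in_keys_iff)
    then have "(\<Sum>k\<in>{i, j}. lookup a k) \<le> (\<Sum>k\<in>keys a. lookup a k)"
      by (intro sum_mono2) auto
    then show False using assms that \<open>lookup a i \<noteq> 0\<close> by (simp add: monoms_def)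
  qed
  then show ?thesis using monoms_eq_single[OF assms(1)] by blast
qed

lemma monoms_single: "i \<in> X \<Longrightarrow> single i d \<in> monoms X d"
  by (auto simp: monoms_def)

text \<open>Modulo a prime \<open>P\<close> over \<open>J\<close> that misses the coefficient at
  \<open>b0 + b0\<close>, the square is a monomial; hence \<open>f\<close> is one too, supported at
  \<open>b0\<close>. The coefficient at \<open>b0 + a\<close> is then \<open>2 * f b0 * f a\<close>
  plus products of two values \<open>f x\<close> with \<open>x \<noteq> b0\<close>. These lie in
  \<open>P I\<close>, and \<open>2 * f b0\<close> is a multiplier outside \<open>P\<close>.\<close>

lemma saturation_square:
  fixes f :: "(nat \<Rightarrow>\<^sub>0 nat) \<Rightarrow> 'r::comm_ring_1"
  assumes S: "finite S" "b0 \<in> S" and two: "(2::'r) * u = 1"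
    and J: "rideal.subspace J" "\<And>\<gamma>. \<gamma> \<noteq> b0 + b0 \<Longrightarrow> prod_coeff S f f \<gamma> \<in> J"
    and r: "r \<in> rideal.span (f ` (S - {b0}))"
  shows "\<exists>K. prod_coeff S f f (b0 + b0) ^ K * r \<in> J"
proof (rule saturation[OF J(1)])
  fix P :: "'r set" assume P: "prime_ideal P" "J \<subseteq> P" "prod_coeff S f f (b0 + b0) \<notin> P"
  have sP: "rideal.subspace P" using prime_idealD[OF P(1)] by simp
  have fP: "f a \<in> P" if a: "a \<in> S - {b0}" for a
  proof (rule ccontr)
    assume fa: "f a \<notin> P"
    have "lookup a i = lookup b0 i" for i
    proof -
      have "int (lookup (a + a) i) = int (lookup (b0 + b0) i)"
      proof (rule gauss_weight_const[where wt = "\<lambda>a. int (lookup a i)" and g = f and h = f, OF P(1) S(1)])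
        fix \<gamma> assume "prod_coeff S f f \<gamma> \<notin> P"
        then have "\<gamma> = b0 + b0" using J(2) P(2) by blast
        then show "int (lookup \<gamma> i) = int (lookup (b0 + b0) i)" by simp
      qed (use a fa in \<open>auto simp: lookup_add\<close>)
      then show ?thesis by (simp add: lookup_add)
    qed
    then show False using a by (auto intro: poly_mapping_eqI)
  qed
  have b0P: "f b0 \<notin> P"
  proof
    assume "f b0 \<in> P"
    then have "f a \<in> P" if "a \<in> S" for a using fP that by blast
    then have "prod_coeff S f f (b0 + b0) \<in> P"
      by (intro prod_coeff_in_ideal[OF sP] rideal_mult_right[OF sP])
    then show False using P(3) by simp
  qed
  let ?I = "f ` (S - {b0})"
  let ?Q = "rideal.span (J \<union> {p * i |p i. p \<in> P \<and> i \<in> ?I})"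
  have sQ: "rideal.subspace ?Q" by simp
  have "2 * f b0 \<notin> P"
  proof
    assume "2 * f b0 \<in> P"
    then have "2 * f b0 * u \<in> P" by (rule rideal_mult_right[OF sP])
    moreover have "2 * f b0 * u = f b0" using two by (metis mult.assoc mult.commute mult_1)
    ultimately show False using b0P by simp
  qed
  moreover have "2 * f b0 * f a \<in> ?Q" if a: "a \<in> S - {b0}" for a
  proof -
    let ?A = "{(x, y) \<in> S \<times> S. x + y = b0 + a}"
    have "prod_coeff S f f (b0 + a) = (\<Sum>(x, y)\<in>{(b0, a), (a, b0)}. f x * f y)
        + (\<Sum>(x, y)\<in>?A - {(b0, a), (a, b0)}. f x * f y)"
      unfolding prod_coeff_def using S a finite_sum_pairs[OF S(1)]
      by (subst add.commute, intro sum.subset_diff) (auto simp: add.commute)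
    also have "(\<Sum>(x, y)\<in>{(b0, a), (a, b0)}. f x * f y) = 2 * f b0 * f a"
      using a by (auto simp: mult.commute)
    finally have eq: "prod_coeff S f f (b0 + a) = 2 * f b0 * f a
        + (\<Sum>(x, y)\<in>?A - {(b0, a), (a, b0)}. f x * f y)" .
    have 1: "prod_coeff S f f (b0 + a) \<in> ?Q"
      using J(2)[of "b0 + a"] a by (intro rideal.span_base) auto
    have 2: "(\<Sum>(x, y)\<in>?A - {(b0, a), (a, b0)}. f x * f y) \<in> ?Q"
    proof (rule rideal.subspace_sum[OF sQ])
      fix p assume "p \<in> ?A - {(b0, a), (a, b0)}"
      then obtain x y where xy: "p = (x, y)" "x \<in> S" "y \<in> S" "x + y = b0 + a" "(x, y) \<notin> {(b0, a), (a, b0)}"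
        by blast
      have "x \<noteq> b0" using xy(4,5) by (metis add_left_cancel insertI1)
      moreover have "y \<noteq> b0" using xy(4,5) by (metis add.commute add_left_cancel insertCI)
      ultimately have "f x \<in> P" "f y \<in> ?I" using fP xy(2,3) by auto
      then have "f x * f y \<in> {p * i |p i. p \<in> P \<and> i \<in> ?I}" by blast
      then show "(case p of (x, y) \<Rightarrow> f x * f y) \<in> ?Q"
        using xy(1) by (auto intro: rideal.span_base)
    qed
    show ?thesis using rideal.subspace_diff[OF sQ 1 2] unfolding eq by (simp only: add_diff_cancel_right')
  qed
  ultimately show "\<exists>I s. finite I \<and> r \<in> rideal.span I \<and> s \<notin> P \<and>
      (\<forall>i\<in>I. s * i \<in> rideal.span (J \<union> {p * i |p i. p \<in> P \<and> i \<in> I}))"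
    using S r by (intro exI[of _ ?I] exI[of _ "2 * f b0"]) auto
qed

text \<open>
  The degeneration point of the second secant: \<open>g = x\<^sub>0\<^sup>d\<close> and \<open>h = x\<^sub>1\<^sup>d + x\<^sub>0\<^sup>d\<^sup>-\<^sup>1 x\<^sub>2\<close>. The Newton
  polytope of \<open>g h\<close> is a primitive segment, and the greatest common monomial divisor of its two
  ends has degree exactly \<open>d\<close>; hence \<open>{g, h}\<close> is determined by \<open>g h\<close>.
\<close>

definition exp_b :: "nat \<Rightarrow> (nat \<Rightarrow>\<^sub>0 nat)" where
  "exp_b d = single 0 d"

definition exp_a1 :: "nat \<Rightarrow> (nat \<Rightarrow>\<^sub>0 nat)" where
  "exp_a1 d = single 1 d"

definition exp_a2 :: "nat \<Rightarrow> (nat \<Rightarrow>\<^sub>0 nat)" where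
  "exp_a2 d = single 0 (d - 1) + single 2 1"

lemma lookup_exps:
  "lookup (exp_b d) i = (if i = 0 then d else 0)"
  "lookup (exp_a1 d) i = (if i = 1 then d else 0)"
  "lookup (exp_a2 d) i = (if i = 0 then d - 1 else if i = 2 then 1 else 0)"
  by (auto simp: exp_b_def exp_a1_def exp_a2_def lookup_add lookup_single when_def)

lemma exps_mem_monoms:
  assumes "n \<ge> 2" "d \<ge> 1"
  shows "exp_b d \<in> monoms {..n} d" "exp_a1 d \<in> monoms {..n} d" "exp_a2 d \<in> monoms {..n} d"
proof -
  show "exp_b d \<in> monoms {..n} d" "exp_a1 d \<in> monoms {..n} d"
    using assms by (auto simp: exp_b_def exp_a1_def intro!: monoms_single)
  show "exp_a2 d \<in> monoms {..n} d"
    using monoms_add[of "{..n}", OF _ monoms_single[of 0 _ "d - 1"] monoms_single[of 2 _ 1]] assms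
    by (simp add: exp_a2_def)
qed

lemma exps_distinct:
  assumes "d \<ge> 1"
  shows "exp_b d \<noteq> exp_a1 d" "exp_b d \<noteq> exp_a2 d" "exp_a1 d \<noteq> exp_a2 d"
proof -
  have "lookup (exp_b d) 2 \<noteq> lookup (exp_a2 d) 2"
    "lookup (exp_a1 d) 2 \<noteq> lookup (exp_a2 d) 2"
    "lookup (exp_b d) 0 \<noteq> lookup (exp_a1 d) 0"
    using assms by (auto simp: lookup_exps)
  then show "exp_b d \<noteq> exp_a1 d" "exp_b d \<noteq> exp_a2 d" "exp_a1 d \<noteq> exp_a2 d" by metis+
qed

text \<open>The monomial \<open>b\<close> divides \<open>x0^d x1^d\<close> and
  \<open>x0^(2d-1) x2\<close>, which share only the variable \<open>x0\<close>; its degree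
  \<open>d\<close> then fixes it.\<close>

lemma common_factor_unique:
  assumes d: "d \<ge> 1" and b: "b \<in> monoms {..n} d"
    and s: "a + b = exp_b d + exp_a1 d" "a' + b = exp_b d + exp_a2 d"
  shows "b = exp_b d \<and> a = exp_a1 d \<and> a' = exp_a2 d"
proof -
  have "lookup b i = 0" if "i \<noteq> 0" for i
    using that arg_cong[OF s(1), of "\<lambda>c. lookup c i"]
      arg_cong[OF s(2), of "\<lambda>c. lookup c i"]
    by (auto simp: lookup_add lookup_exps split: if_splits)
  then have "b = exp_b d" unfolding exp_b_def by (intro monoms_eq_single[OF b]) auto
  then show ?thesis using s by (simp add: add.commute)
qed

text \<open>Weights confine sums of surviving exponents to a lattice segment whose only lattice
  points are its ends. Both ends occur, and comparing their decompositions produces an exponent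
  dividing both, which must be \<open>x0^d\<close>.\<close>

lemma support_modulo_prime:
  fixes g h :: "(nat \<Rightarrow>\<^sub>0 nat) \<Rightarrow> 'r::comm_ring_1" and n d :: nat
  defines "S \<equiv> monoms {..n} d"
  assumes d: "d \<ge> 1" and P: "prime_ideal P"
    and c: "\<And>\<gamma>. \<gamma> \<notin> {exp_b d + exp_a1 d, exp_b d + exp_a2 d} \<Longrightarrow> prod_coeff S g h \<gamma> \<in> P"
    and T: "prod_coeff S g h (exp_b d + exp_a1 d) \<notin> P" "prod_coeff S g h (exp_b d + exp_a2 d) \<notin> P"
  shows "(\<forall>a\<in>S - {exp_b d}. g a \<in> P) \<and> (\<forall>b\<in>S - {exp_a1 d, exp_a2 d}. h b \<in> P) \<or>
    (\<forall>a\<in>S - {exp_b d}. h a \<in> P) \<and> (\<forall>b\<in>S - {exp_a1 d, exp_a2 d}. g b \<in> P)"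
proof -
  let ?b = "exp_b d" and ?a1 = "exp_a1 d" and ?a2 = "exp_a2 d"
  have S: "finite S" by (simp add: S_def finite_monoms)
  have sP: "rideal.subspace P" using prime_idealD[OF P] by simp
  have pair: "a + b \<in> {?b + ?a1, ?b + ?a2}" if a: "a \<in> S" "g a \<notin> P" and b: "b \<in> S" "h b \<notin> P" for a b
  proof -
    note const = gauss_weight_const[where g = g and h = h, OF P S _ _ a b]
    have supp: "\<gamma> = ?b + ?a1 \<or> \<gamma> = ?b + ?a2" if "prod_coeff S g h \<gamma> \<notin> P" for \<gamma>
      using c that by blast
    \<comment> \<open>The weights in \<open>0\<close>, \<open>1\<close> and \<open>2\<close> agree
      at \<open>x0^d x1^d\<close> and \<open>x0^(2d-1) x2\<close>; together they cut out the line
      through these two points.\<close>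
    have 0: "int (lookup (a + b) 0) - (int d - 1) * int (lookup (a + b) 2) = int d"
      using supp d by (intro const[where wt = "\<lambda>a. int (lookup a 0) - (int d - 1) * int (lookup a 2)"])
        (fastforce simp: lookup_add lookup_exps algebra_simps of_nat_diff)+
    have 1: "int (lookup (a + b) 1) + int d * int (lookup (a + b) 2) = int d"
      using supp by (intro const[where wt = "\<lambda>a. int (lookup a 1) + int d * int (lookup a 2)"])
        (fastforce simp: lookup_add lookup_exps algebra_simps)+
    have 2: "lookup (a + b) i = 0" if "i \<ge> 3" for i
    proof -
      have "int (lookup (a + b) i) = 0"
        using supp that by (intro const[where wt = "\<lambda>a. int (lookup a i)"])
          (fastforce simp: lookup_add lookup_exps)+
      then show ?thesis by simp
    qed
    define w where "w = lookup (a + b) 2"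
    \<comment> \<open>The exponent \<open>w\<close> of \<open>x2\<close> parametrises the line. The
      exponent of \<open>x1\<close> is \<open>d - d * w\<close>, so \<open>w\<close> can only be 0
      or 1.\<close>
    have "int d * int w \<le> int d" using 1 by (simp add: w_def)
    then have "w \<le> 1" using d by (simp flip: of_nat_mult)
    have i3: "i = 0 \<or> i = 1 \<or> i = 2 \<or> i \<ge> 3" for i :: nat by auto
    show ?thesis
    proof (cases "w = 0")
      case True
      have "a + b = ?b + ?a1"
      proof (rule poly_mapping_eqI)
        fix i
        show "lookup (a + b) i = lookup (?b + ?a1) i"
          using i3[of i] 0 1 2[of i] True unfolding w_def[symmetric]
          by (auto simp: lookup_add[of ?b] lookup_exps w_def[symmetric])
      qed
      then show ?thesis by simp
    next
      case False
      then have w: "w = 1" using \<open>w \<le> 1\<close> by simp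
      have "a + b = ?b + ?a2"
      proof (rule poly_mapping_eqI)
        fix i
        show "lookup (a + b) i = lookup (?b + ?a2) i"
          using i3[of i] 0 1 2[of i] w d unfolding w_def[symmetric]
          by (auto simp: lookup_add[of ?b] lookup_exps w_def[symmetric])
      qed
      then show ?thesis by simp
    qed
  qed
  have ex: "\<exists>a\<in>S. \<exists>b\<in>S. a + b = \<gamma> \<and> g a \<notin> P \<and> h b \<notin> P" if "prod_coeff S g h \<gamma> \<notin> P" for \<gamma>
    using that prod_coeff_in_ideal[OF sP, of S \<gamma> g h] rideal_mult_right[OF sP] rideal.subspace_scale[OF sP]
    by metis
  obtain a b where ab: "a \<in> S" "b \<in> S" "a + b = ?b + ?a1" "g a \<notin> P" "h b \<notin> P"
    using ex[OF T(1)] by blast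
  obtain a' b' where ab': "a' \<in> S" "b' \<in> S" "a' + b' = ?b + ?a2" "g a' \<notin> P" "h b' \<notin> P"
    using ex[OF T(2)] by blast
  have a1: "?a1 + x \<noteq> ?b + ?a2" for x
  proof
    assume "?a1 + x = ?b + ?a2"
    from arg_cong[OF this, of "\<lambda>c. lookup c 1"] show False
      using d by (simp add: lookup_add lookup_exps)
  qed
  \<comment> \<open>The mixed sum \<open>a + b'\<close> is again an end. At the first end it gives
    \<open>b' = b\<close>; at the second, the other mixed sum \<open>a' + b\<close> is the first
    end, because the totals agree, and \<open>a' = a\<close>.\<close>
  consider "a + b' = ?b + ?a1" | "a + b' = ?b + ?a2" using pair[OF ab(1,4) ab'(2,5)] by blast
  then show ?thesis
  proof cases
    case 1
    then have "b' = b" using ab(3) by (metis add_left_cancel)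
    then have bb: "b = ?b" "a = ?a1" "a' = ?a2"
      using common_factor_unique[OF d, of b n a a'] ab ab' by (auto simp: S_def)
    have "x \<in> {?a1, ?a2}" if "x \<in> S" "g x \<notin> P" for x
      using pair[OF that ab(2,5)] bb(1) by (auto simp: add.commute)
    moreover have "x = ?b" if "x \<in> S" "h x \<notin> P" for x
      using pair[OF ab(1,4) that] bb(2) a1[of x] by (auto simp: add.commute[of ?b])
    ultimately show ?thesis by blast
  next
    case 2
    have "a' + b \<noteq> ?b + ?a2"
    proof
      assume *: "a' + b = ?b + ?a2"
      have "(a + b) + (a' + b') = (a + b') + (a' + b)" by (simp add: ac_simps)
      then have "?a1 = ?a2" using * 2 ab(3) ab'(3) by simp
      then show False using exps_distinct(3)[OF d] by simp
    qed
    then have "a' + b = ?b + ?a1" using pair[OF ab'(1,4) ab(2,5)] by blast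
    then have "a' = a" using ab(3) by (metis add_right_cancel)
    then have aa: "a = ?b" "b = ?a1" "b' = ?a2"
      using common_factor_unique[OF d, of a n b b'] ab ab' by (auto simp: S_def add.commute)
    have "x \<in> {?a1, ?a2}" if "x \<in> S" "h x \<notin> P" for x
      using pair[OF ab(1,4) that] aa(1) by (auto simp: add.commute)
    moreover have "x = ?b" if "x \<in> S" "g x \<notin> P" for x
      using pair[OF that ab(2,5)] aa(2) a1[of x] by (auto simp: add.commute[of _ ?a1] add.commute[of ?b])
    ultimately show ?thesis by blast
  qed
qed

text \<open>
  The tangent space computation at the degeneration point: the linear part of \<open>prod_coeff\<close> at
  \<open>a + exp_a1 d\<close> is \<open>z\<^sub>1 g a + z\<^sub>2 g (a + exp_a1 d - exp_a2 d)\<close>, which is triangular in the exponent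
  of \<open>x\<^sub>2\<close>.
\<close>

lemma triangular_elimination_g:
  fixes g h :: "(nat \<Rightarrow>\<^sub>0 nat) \<Rightarrow> 'r::comm_ring_1" and n d :: nat
  defines "S \<equiv> monoms {..n} d"
  assumes n: "n \<ge> 2" and d: "d \<ge> 1" and Q: "rideal.subspace Q"
    and c: "\<And>\<gamma>. \<gamma> \<notin> {exp_b d + exp_a1 d, exp_b d + exp_a2 d} \<Longrightarrow> prod_coeff S g h \<gamma> \<in> Q"
    and quad: "\<And>a b. a \<in> S - {exp_b d} \<Longrightarrow> b \<in> S - {exp_a1 d, exp_a2 d} \<Longrightarrow> g a * h b \<in> Q"
    and "a \<in> S - {exp_b d}"
  shows "h (exp_a1 d) ^ Suc (lookup a 2) * g a \<in> Q"
  using assms(7)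
proof (induction "lookup a 2" arbitrary: a rule: less_induct)
  case less
  let ?b = "exp_b d" and ?a1 = "exp_a1 d" and ?a2 = "exp_a2 d"
  let ?z = "h ?a1 ^ lookup a 2"
  have S: "finite S" by (simp add: S_def finite_monoms)
  have a: "a \<in> S" "a \<noteq> ?b" using less.prems by auto
  have a1S: "?a1 \<in> S" using exps_mem_monoms[OF n d] by (simp add: S_def)
  have "?z * (g a * h ?a1) \<in> Q"
  proof (rule prod_coeff_extract[OF Q S a(1) a1S])
    have "a + ?a1 \<noteq> ?b + ?a2"
    proof
      assume "a + ?a1 = ?b + ?a2"
      from arg_cong[OF this, of "\<lambda>c. lookup c 1"] show False
        using d by (simp add: lookup_add lookup_exps)
    qed
    then show "?z * prod_coeff S g h (a + ?a1) \<in> Q"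
      using a(2) by (intro rideal.subspace_scale[OF Q] c) auto
    fix a' b' assume ab: "a' \<in> S" "b' \<in> S" "a' + b' = a + ?a1" "(a', b') \<noteq> (a, ?a1)"
    have "a' \<noteq> ?b"
    proof
      assume "a' = ?b"
      moreover have "lookup (a' + b') 0 = lookup (a + ?a1) 0" using ab(3) by simp
      ultimately have "lookup a 0 \<ge> d" by (simp add: lookup_add lookup_exps)
      then have "lookup a 0 = d" using monoms_lookup_le[of a "{..n}" d 0] a(1) by (simp add: S_def)
      then have "a = ?b" using monoms_lookup_eq_imp_single[of a "{..n}" d 0] a(1) by (simp add: S_def exp_b_def)
      then show False using a(2) by simp
    qed
    then have a': "a' \<in> S - {?b}" using ab(1) by simp
    show "?z * (g a' * h b') \<in> Q"
    proof (cases "b' \<in> {?a1, ?a2}")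
      case False
      then have "g a' * h b' \<in> Q" using quad[OF a'] ab(2) by blast
          then show ?thesis by (rule rideal.subspace_scale[OF Q])
    next
      case True
      have "b' \<noteq> ?a1" using ab(3,4) by auto
      then have b': "b' = ?a2" using True by simp
      \<comment> \<open>The other possible partner leads to
        \<open>a' = a + exp_a1 d - exp_a2 d\<close>, with one \<open>x2\<close> less than
        \<open>a\<close>, so the induction hypothesis covers it.\<close>
      have l: "lookup a 2 = Suc (lookup a' 2)"
        using arg_cong[OF ab(3), of "\<lambda>c. lookup c 2"] b' by (simp add: lookup_add lookup_exps)
      then have "?z * g a' \<in> Q" using less.hyps[OF _ a'] by simp
      then show ?thesis using rideal_mult_right[OF Q] by (metis mult.assoc)
    qed
  qed
  then show ?case by (simp add: mult_ac)
qed

text \<open>Exponents of \<open>x2\<close> are at most \<open>d\<close>, so one power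
  \<open>Suc d\<close> clears all \<open>g a\<close>. In the coefficient at
  \<open>exp_b d + b\<close> only \<open>g (exp_b d) * h b\<close> is then left; this accounts for
  the second factor of \<open>s\<close>.\<close>

lemma triangular_elimination:
  fixes g h :: "(nat \<Rightarrow>\<^sub>0 nat) \<Rightarrow> 'r::comm_ring_1" and n d :: nat
  defines "S \<equiv> monoms {..n} d"
  defines "s \<equiv> h (exp_a1 d) ^ Suc d * g (exp_b d)"
  assumes n: "n \<ge> 2" and d: "d \<ge> 1" and Q: "rideal.subspace Q"
    and c: "\<And>\<gamma>. \<gamma> \<notin> {exp_b d + exp_a1 d, exp_b d + exp_a2 d} \<Longrightarrow> prod_coeff S g h \<gamma> \<in> Q"
    and quad: "\<And>a b. a \<in> S - {exp_b d} \<Longrightarrow> b \<in> S - {exp_a1 d, exp_a2 d} \<Longrightarrow> g a * h b \<in> Q"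
    and i: "i \<in> g ` (S - {exp_b d}) \<union> h ` (S - {exp_a1 d, exp_a2 d})"
  shows "s * i \<in> Q"
proof -
  let ?b = "exp_b d" and ?a1 = "exp_a1 d" and ?a2 = "exp_a2 d"
  have S: "finite S" by (simp add: S_def finite_monoms)
  have bS: "?b \<in> S" using exps_mem_monoms[OF n d] by (simp add: S_def)
  have gQ: "h ?a1 ^ Suc d * g a \<in> Q" if a: "a \<in> S - {?b}" for a
  proof -
    have "lookup a 2 \<le> d" using a monoms_lookup_le by (auto simp: S_def)
    then have "h ?a1 ^ Suc d = h ?a1 ^ (d - lookup a 2) * h ?a1 ^ Suc (lookup a 2)"
      by (simp flip: power_add del: power_Suc)
    moreover have "h ?a1 ^ Suc (lookup a 2) * g a \<in> Q"
      using triangular_elimination_g[where n = n and g = g and h = h and Q = Q, OF n d Q] c quad a unfolding S_def by blast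
    ultimately show ?thesis using rideal.subspace_scale[OF Q] by (metis mult.assoc)
  qed
  from i consider a where "a \<in> S - {?b}" "i = g a" | b where "b \<in> S - {?a1, ?a2}" "i = h b" by blast
  then show ?thesis
  proof cases
    case 1
    then show ?thesis using rideal.subspace_scale[OF Q gQ[of a], of "g ?b"] by (simp add: s_def mult_ac)
  next
    case 2
    have "h ?a1 ^ Suc d * (g ?b * h b) \<in> Q"
    proof (rule prod_coeff_extract[OF Q S bS])
      show "b \<in> S" using 2 by simp
      show "h ?a1 ^ Suc d * prod_coeff S g h (?b + b) \<in> Q"
        using 2 by (intro rideal.subspace_scale[OF Q] c) auto
      fix a' b' assume ab: "a' \<in> S" "b' \<in> S" "a' + b' = ?b + b" "(a', b') \<noteq> (?b, b)"
      then have a': "a' \<in> S - {?b}" by auto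
      show "h ?a1 ^ Suc d * (g a' * h b') \<in> Q"
      proof (cases "b' \<in> {?a1, ?a2}")
        case False
        then have "g a' * h b' \<in> Q" using quad[OF a'] ab(2) by blast
          then show ?thesis by (rule rideal.subspace_scale[OF Q])
      next
        case True
        show ?thesis using rideal_mult_right[OF Q gQ[OF a'], of "h b'"] by (simp add: mult.assoc)
      qed
    qed
    then show ?thesis using 2 by (simp add: s_def mult_ac)
  qed
qed

text \<open>A prime over \<open>J\<close> that misses both coefficients lies over one of the two
  orderings of the factors, and \<open>support_modulo_prime\<close> says only that one of them
  occurs. Hence \<open>r\<close> is required in both ideals of vanishing variables. At either
  ordering the triangular elimination supplies the containment in \<open>J + P I\<close>.\<close>

lemma saturation_product:
  fixes g h :: "(nat \<Rightarrow>\<^sub>0 nat) \<Rightarrow> 'r::comm_ring_1" and n d :: nat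
  defines "S \<equiv> monoms {..n} d"
  assumes n: "n \<ge> 2" and d: "d \<ge> 1" and J: "rideal.subspace J"
    and c: "\<And>\<gamma>. \<gamma> \<notin> {exp_b d + exp_a1 d, exp_b d + exp_a2 d} \<Longrightarrow> prod_coeff S g h \<gamma> \<in> J"
    and r: "r \<in> rideal.span (g ` (S - {exp_b d}) \<union> h ` (S - {exp_a1 d, exp_a2 d}))"
      "r \<in> rideal.span (h ` (S - {exp_b d}) \<union> g ` (S - {exp_a1 d, exp_a2 d}))"
  shows "\<exists>K. (prod_coeff S g h (exp_b d + exp_a1 d) * prod_coeff S g h (exp_b d + exp_a2 d)) ^ K * r \<in> J"
proof (rule saturation[OF J])
  let ?b = "exp_b d" and ?a1 = "exp_a1 d" and ?a2 = "exp_a2 d"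
  fix P :: "'r set" assume P: "prime_ideal P" "J \<subseteq> P"
    "prod_coeff S g h (?b + ?a1) * prod_coeff S g h (?b + ?a2) \<notin> P"
  have S: "finite S" by (simp add: S_def finite_monoms)
  have sP: "rideal.subspace P" using prime_idealD[OF P(1)] by simp
  have T: "prod_coeff S g h (?b + ?a1) \<notin> P" "prod_coeff S g h (?b + ?a2) \<notin> P"
    using P(3) rideal_mult_right[OF sP] rideal.subspace_scale[OF sP] by auto
  \<comment> \<open>Stated for arbitrary \<open>g\<close> and \<open>h\<close>, so as to be applied
    to both orderings.\<close>
  have main: "\<exists>I s. finite I \<and> r \<in> rideal.span I \<and> s \<notin> P \<and>
      (\<forall>i\<in>I. s * i \<in> rideal.span (J \<union> {p * i |p i. p \<in> P \<and> i \<in> I}))"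
    if supp: "\<forall>a\<in>S - {?b}. g a \<in> P" "\<forall>b\<in>S - {?a1, ?a2}. h b \<in> P"
      and r: "r \<in> rideal.span (g ` (S - {?b}) \<union> h ` (S - {?a1, ?a2}))"
      and c: "\<And>\<gamma>. \<gamma> \<notin> {?b + ?a1, ?b + ?a2} \<Longrightarrow> prod_coeff S g h \<gamma> \<in> J"
      and T: "prod_coeff S g h (?b + ?a1) \<notin> P" for g h
  proof -
    let ?I = "g ` (S - {?b}) \<union> h ` (S - {?a1, ?a2})"
    let ?Q = "rideal.span (J \<union> {p * i |p i. p \<in> P \<and> i \<in> ?I})"
    obtain x y where xy: "x + y = ?b + ?a1" "x \<in> S" "y \<in> S" "g x * h y \<notin> P"
      using prod_coeff_in_ideal[OF sP] T by metis
    then have nP: "g x \<notin> P" "h y \<notin> P"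
      using rideal_mult_right[OF sP] rideal.subspace_scale[OF sP] by auto
    then have x: "x = ?b" using supp(1) xy(2) by blast
    then have "y = ?a1" using xy(1) by simp
    then have "h ?a1 ^ Suc d * g ?b \<notin> P"
      using nP x prime_ideal_power[OF P(1)] prime_idealD(3)[OF P(1)] by blast
    moreover have "h ?a1 ^ Suc d * g ?b * i \<in> ?Q" if "i \<in> ?I" for i
    proof (rule triangular_elimination[where n = n and Q = ?Q, OF n d])
      show "rideal.subspace ?Q" by simp
      show "prod_coeff (monoms {..n} d) g h \<gamma> \<in> ?Q" if "\<gamma> \<notin> {?b + ?a1, ?b + ?a2}" for \<gamma>
        using c[OF that] by (intro rideal.span_base) (auto simp: S_def)
      show "g a * h b \<in> ?Q" if "a \<in> monoms {..n} d - {?b}" "b \<in> monoms {..n} d - {?a1, ?a2}" for a b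
      proof -
        have "g a \<in> P" "h b \<in> ?I" using that supp(1) by (auto simp: S_def)
        then have "g a * h b \<in> {p * i |p i. p \<in> P \<and> i \<in> ?I}" by blast
        then show ?thesis by (intro rideal.span_base) blast
      qed
      show "i \<in> g ` (monoms {..n} d - {?b}) \<union> h ` (monoms {..n} d - {?a1, ?a2})"
        using that by (simp add: S_def)
    qed
    ultimately show ?thesis
      using S r by (intro exI[of _ ?I] exI[of _ "h ?a1 ^ Suc d * g ?b"]) auto
  qed
  have "(\<forall>a\<in>S - {?b}. g a \<in> P) \<and> (\<forall>b\<in>S - {?a1, ?a2}. h b \<in> P) \<or>
    (\<forall>a\<in>S - {?b}. h a \<in> P) \<and> (\<forall>b\<in>S - {?a1, ?a2}. g b \<in> P)"
    unfolding S_def using c P(2) T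
    by (intro support_modulo_prime[OF d P(1)]) (auto simp: S_def)
  then show "\<exists>I s. finite I \<and> r \<in> rideal.span I \<and> s \<notin> P \<and>
      (\<forall>i\<in>I. s * i \<in> rideal.span (J \<union> {p * i |p i. p \<in> P \<and> i \<in> I}))"
  proof
    assume "(\<forall>a\<in>S - {?b}. g a \<in> P) \<and> (\<forall>b\<in>S - {?a1, ?a2}. h b \<in> P)"
    then show ?thesis using main[of g h] r(1) c T(1) by blast
  next
    assume "(\<forall>a\<in>S - {?b}. h a \<in> P) \<and> (\<forall>b\<in>S - {?a1, ?a2}. g b \<in> P)"
    then show ?thesis
      using main[of h g] r(2) c T(1) unfolding prod_coeff_commute[of S g h] by blast
  qed
qed

section \<open>Graded subalgebras generated by a parametrisation\<close>

lemma cvs_span_mult: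
  fixes x y :: "'v mpol"
  assumes "x \<in> cvs.span S" "y \<in> cvs.span T"
  shows "x * y \<in> cvs.span {s * t |s t. s \<in> S \<and> t \<in> T}"
proof -
  have "(\<lambda>s. s * y) ` S \<subseteq> cvs.span {s * t |s t. s \<in> S \<and> t \<in> T}"
  proof (rule image_subsetI)
    fix s assume s: "s \<in> S"
    have "y * s \<in> cvs.span ((\<lambda>t. t * s) ` T)" by (rule cvs_span_mult_right[OF assms(2)])
    also have "\<dots> \<subseteq> cvs.span {s * t |s t. s \<in> S \<and> t \<in> T}"
      using s by (intro cvs.span_mono) (auto intro: mult.commute)
    finally show "s * y \<in> cvs.span {s * t |s t. s \<in> S \<and> t \<in> T}" by (simp add: mult.commute)
  qed
  then have "cvs.span ((\<lambda>s. s * y) ` S) \<subseteq> cvs.span {s * t |s t. s \<in> S \<and> t \<in> T}"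
    by (rule cvs.span_minimal) simp
  then show ?thesis using cvs_span_mult_right[OF assms(1)] by blast
qed

lemma rideal_cscale:
  fixes x :: "'v mpol"
  assumes "rideal.subspace J" "x \<in> J"
  shows "cscale u x \<in> J"
  unfolding cscale_eq_mult using rideal.subspace_scale[OF assms] .

lemma rideal_imp_cvs_subspace:
  fixes J :: "'v mpol set"
  assumes "rideal.subspace J"
  shows "cvs.subspace J"
  using assms rideal_cscale[OF assms] unfolding cvs.subspace_def
  by (auto simp: rideal.subspace_0 rideal.subspace_add)

lemma prime_ideal_eval: "prime_ideal {x. mpol_eval x v = 0}"
  by (auto simp: prime_ideal_def rideal.subspace_def mpol_eval_add mpol_eval_mult)

lemma single_add_eq_mult:
  "single (a + b) (1::complex) = single a 1 * single b 1"
  by (simp add: mult_single)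

lemma cmon_graded:
  fixes W :: "nat \<Rightarrow> 'r::comm_ring_1 set"
  assumes "1 \<in> W 0" "\<And>k m x y. x \<in> W k \<Longrightarrow> y \<in> W m \<Longrightarrow> x * y \<in> W (k + m)"
    and "a \<in> monoms X m" "\<And>i. i \<in> X \<Longrightarrow> c i \<in> W 1"
  shows "cmon c a \<in> W m"
proof -
  have pow: "c i ^ k \<in> W k" if "i \<in> X" for i k
    using assms(1) assms(2)[OF assms(4)[OF that]] by (induction k) auto
  have "(\<Prod>i\<in>I. c i ^ lookup a i) \<in> W (\<Sum>i\<in>I. lookup a i)"
    if "finite I" "I \<subseteq> X" for I
    using that by (induction I) (auto simp: assms(1) intro: assms(2) pow)
  from this[of "keys a"] show ?thesis
    using assms(3) by (simp add: cmon_def monoms_def)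
qed

text \<open>\<open>Mon m\<close> is the monomial basis in degree \<open>m\<close> of the ring
  \<open>C\<close> that contains the generated algebra \<open>A\<close>: even monomials for squares,
  those of bidegree \<open>(m, m)\<close> for products. \<open>Mon_add_iff\<close> lets homogeneous
  components be cut out of relations in the full polynomial ring. \<open>nilpotent\<close> says that
  the common zeros of the \<open>c i\<close> annihilate all of \<open>Mon 1\<close>; this makes
  \<open>C\<close> finite over \<open>A\<close>.\<close>

locale graded_param =
  fixes X :: "'x set" and c :: "'x \<Rightarrow> ('v::linorder) mpol" and Mon :: "nat \<Rightarrow> ('v \<Rightarrow>\<^sub>0 nat) set"
  assumes finite_X: "finite X" and finite_Mon: "finite (Mon m)"
    and Mon_0: "Mon 0 = {0}"
    and Mon_Suc: "a \<in> Mon (Suc m) \<Longrightarrow> \<exists>e\<in>Mon 1. \<exists>b\<in>Mon m. a = e + b"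
    and Mon_add_iff: "e \<in> Mon k \<Longrightarrow> e + b \<in> Mon (k + m) \<longleftrightarrow> b \<in> Mon m"
    and param: "i \<in> X \<Longrightarrow> c i \<in> coord_space (Mon 1)"
    and nilpotent: "e \<in> Mon 1 \<Longrightarrow> \<exists>K. single e 1 ^ K \<in> rideal.span (c ` X)"
begin

definition A :: "nat \<Rightarrow> 'v mpol set" where
  "A m = cvs.span (cmon c ` monoms X m)"

definition C :: "nat \<Rightarrow> 'v mpol set" where
  "C m = coord_space (Mon m)"

lemma C_subspace: "cvs.subspace (C m)"
  by (simp add: C_def coord_space_subspace)

lemma C_mult:
  assumes "x \<in> C k" "y \<in> C m"
  shows "x * y \<in> C (k + m)"
proof -
  have "a + b \<in> Mon (k + m)" if "a \<in> keys x" "b \<in> keys y" for a b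
    using Mon_add_iff[of a k b m] that assms by (auto simp: C_def coord_space_def)
  then show ?thesis using keys_mult[of x y] by (fastforce simp: C_def coord_space_def)
qed

lemma C_one: "1 \<in> C 0"
  by (simp add: C_def coord_space_def Mon_0)

lemma cmon_in_C:
  assumes "a \<in> monoms X m"
  shows "cmon c a \<in> C m"
  by (rule cmon_graded[where W = C, OF C_one C_mult assms])
    (auto simp only: C_def param)

lemma A_subset_C: "A m \<subseteq> C m"
  unfolding A_def by (rule cvs.span_minimal[OF _ C_subspace]) (auto intro: cmon_in_C)

lemma A_subspace: "cvs.subspace (A m)"
  by (simp add: A_def)

lemma A_mult: "x \<in> A k \<Longrightarrow> y \<in> A m \<Longrightarrow> x * y \<in> A (k + m)"
proof -
  assume "x \<in> A k" "y \<in> A m"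
  then have "x * y \<in> cvs.span {s * t |s t. s \<in> cmon c ` monoms X k \<and> t \<in> cmon c ` monoms X m}"
    unfolding A_def by (rule cvs_span_mult)
  also have "\<dots> \<subseteq> A (k + m)"
    unfolding A_def using monoms_add[OF finite_X] by (intro cvs.span_mono) (auto simp flip: cmon_add)
  finally show ?thesis .
qed

lemma A_one: "1 \<in> A 0"
  unfolding A_def by (intro cvs.span_base image_eqI[of _ _ 0]) (auto simp: monoms_0)

lemma A_power: "x \<in> A k \<Longrightarrow> x ^ j \<in> A (k * j)"
  by (induction j) (auto simp: A_one A_mult)

lemma param_in_A: "i \<in> X \<Longrightarrow> c i \<in> A 1"
  unfolding A_def
  by (intro cvs.span_base image_eqI[of _ _ "single i 1"]) (auto simp: monoms_single)

lemma A_sum: "(\<And>i. i \<in> I \<Longrightarrow> f i \<in> A m) \<Longrightarrow> (\<Sum>i\<in>I. f i) \<in> A m"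
  by (rule cvs.subspace_sum[OF A_subspace])

lemma split_degree:
  obtains r1 r2 where "r = r1 + r2" "r1 \<in> C m" "keys r2 \<inter> Mon m = {}"
proof
  let ?s = "\<lambda>a. single a (lookup r a)"
  show "r = (\<Sum>a\<in>keys r \<inter> Mon m. ?s a) + (\<Sum>a\<in>keys r - Mon m. ?s a)"
    using poly_mapping_sum_single[of r] sum.Int_Diff[of "keys r" ?s "Mon m"] by simp
  show "(\<Sum>a\<in>keys r \<inter> Mon m. ?s a) \<in> C m"
    by (rule cvs.subspace_sum[OF C_subspace]) (auto simp: C_def coord_space_def)
  show "keys (\<Sum>a\<in>keys r - Mon m. ?s a) \<inter> Mon m = {}"
    using keys_sum[of ?s "keys r - Mon m"] by (auto split: if_splits)
qed

lemma ideal_component: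
  assumes Y: "finite Y" "Y \<subseteq> C 1" and x: "x \<in> rideal.span Y" "x \<in> C (Suc m)"
  shows "\<exists>r. (\<forall>v\<in>Y. r v \<in> C m) \<and> x = (\<Sum>v\<in>Y. r v * v)"
proof -
  obtain u where u: "x = (\<Sum>v\<in>Y. u v * v)" using x(1) unfolding rideal.span_finite[OF Y(1)] by blast
  have "\<exists>r1 r2. u v = r1 + r2 \<and> r1 \<in> C m \<and> keys r2 \<inter> Mon m = {}" for v
    using split_degree[of "u v" m] by metis
  then obtain r q where rq: "\<And>v. u v = r v + q v" "\<And>v. r v \<in> C m"
    "\<And>v. keys (q v) \<inter> Mon m = {}" by metis
  have eq: "x = (\<Sum>v\<in>Y. r v * v) + (\<Sum>v\<in>Y. q v * v)"
    by (simp add: u rq(1) distrib_right sum.distrib)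
  have "r v * v \<in> C (Suc m)" if "v \<in> Y" for v
    using C_mult[OF rq(2)[of v], of v 1] Y(2) that by auto
  then have "(\<Sum>v\<in>Y. r v * v) \<in> C (Suc m)" by (rule cvs.subspace_sum[OF C_subspace])
  then have "x - (\<Sum>v\<in>Y. r v * v) \<in> C (Suc m)" by (rule cvs.subspace_diff[OF C_subspace x(2)])
  then have in_C: "(\<Sum>v\<in>Y. q v * v) \<in> C (Suc m)" by (simp add: eq)
  have "keys (\<Sum>v\<in>Y. q v * v) \<inter> Mon (Suc m) = {}"
  proof -
    have "keys (q v * v) \<inter> Mon (Suc m) = {}" if v: "v \<in> Y" for v
    proof -
      have "a + b \<notin> Mon (Suc m)" if "a \<in> keys (q v)" "b \<in> keys v" for a b
      proof -
        have "b \<in> Mon 1" using that(2) v Y(2) by (auto simp: C_def coord_space_def)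
        then show ?thesis using Mon_add_iff[of b 1 a m] rq(3)[of v] that(1) by (auto simp: add.commute)
      qed
      then show ?thesis using keys_mult[of "q v" v] by blast
    qed
    then show ?thesis using keys_sum[of "\<lambda>v. q v * v" Y] by blast
  qed
  then have "(\<Sum>v\<in>Y. q v * v) = 0"
    using in_C keys_eq_empty by (fastforce simp: C_def coord_space_def)
  then have "x = (\<Sum>v\<in>Y. r v * v)" using eq by simp
  then show ?thesis using rq(2) by (intro exI[of _ r] conjI ballI)
qed

lemma Mon_decompose:
  assumes "a \<in> Mon m"
  shows "\<exists>k. (\<Sum>e\<in>Mon 1. k e) = m \<and>
    single a (1::complex) = (\<Prod>e\<in>Mon 1. single e 1 ^ k e)"
  using assms
proof (induction m arbitrary: a)
  case 0
  then show ?case by (intro exI[of _ "\<lambda>_. 0"]) (simp add: Mon_0)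
next
  case (Suc m)
  obtain e b where e: "e \<in> Mon 1" "b \<in> Mon m" "a = e + b" using Mon_Suc[OF Suc.prems] by blast
  obtain k where k: "(\<Sum>e\<in>Mon 1. k e) = m"
    "single b (1::complex) = (\<Prod>e\<in>Mon 1. single e 1 ^ k e)"
    using Suc.IH[OF e(2)] by blast
  let ?k = "k(e := Suc (k e))"
  have "(\<Sum>x\<in>Mon 1. ?k x) = Suc (\<Sum>x\<in>Mon 1. k x)"
    using e(1) finite_Mon[of 1] by (simp add: sum.remove[of _ e])
  moreover have "(\<Prod>x\<in>Mon 1. single x (1::complex) ^ ?k x)
      = single e 1 * (\<Prod>x\<in>Mon 1. single x 1 ^ k x)"
    using e(1) finite_Mon[of 1] by (simp add: prod.remove[of _ e] mult.assoc)
  ultimately show ?case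
    using k e(3) by (intro exI[of _ ?k]) (simp add: single_add_eq_mult)
qed

text \<open>Pigeonhole: a monomial of degree above the sum of all \<open>K e\<close> contains some
  \<open>e\<close> at least \<open>K e\<close> times.\<close>

lemma eventually_in_ideal:
  "\<exists>M. \<forall>m\<ge>M. C m \<subseteq> rideal.span (c ` X)"
proof -
  let ?J = "rideal.span (c ` X)"
  have sJ: "rideal.subspace ?J" by simp
  obtain K where K: "\<And>e. e \<in> Mon 1 \<Longrightarrow> single e 1 ^ K e \<in> ?J"
    using nilpotent by metis
  have "C m \<subseteq> ?J" if m: "m \<ge> Suc (\<Sum>e\<in>Mon 1. K e)" for m
  proof -
    have "single a 1 \<in> ?J" if a: "a \<in> Mon m" for a
    proof -
      obtain k where k: "(\<Sum>e\<in>Mon 1. k e) = m"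
        "single a (1::complex) = (\<Prod>e\<in>Mon 1. single e 1 ^ k e)"
        using Mon_decompose[OF a] by blast
      have "\<exists>e\<in>Mon 1. K e \<le> k e"
      proof (rule ccontr)
        assume "\<not> ?thesis"
        then have "(\<Sum>e\<in>Mon 1. k e) \<le> (\<Sum>e\<in>Mon 1. K e)"
          by (intro sum_mono) (auto simp: not_le less_imp_le)
        then show False using k(1) m by simp
      qed
      then obtain e where e: "e \<in> Mon 1" "K e \<le> k e" by blast
      have "single e (1::complex) ^ k e
          = single e 1 ^ K e * single e 1 ^ (k e - K e)"
        using e(2) by (simp flip: power_add)
      then have "single e 1 ^ k e \<in> ?J"
        using rideal_mult_right[OF sJ K[OF e(1)]] by metis
      then show ?thesis
        unfolding k(2) using e(1) finite_Mon[of 1]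
        by (subst prod.remove[of _ e]) (auto intro: rideal_mult_right[OF sJ])
    qed
    then show ?thesis
      unfolding C_def coord_space_eq_span
      by (intro cvs.span_minimal rideal_imp_cvs_subspace[OF sJ]) auto
  qed
  then show ?thesis by blast
qed

text \<open>In degrees above \<open>M\<close> an element of \<open>C\<close> is a combination of the
  \<open>c i\<close> with cofactors one degree lower. Descending to degree \<open>M\<close> leaves
  coefficients in \<open>A\<close>, so the monomials in \<open>Mon M\<close> are generators.\<close>

lemma finite_generation:
  "\<exists>M\<ge>1. \<forall>j. \<forall>x\<in>C (M + j). \<exists>q. (\<forall>b. q b \<in> A j) \<and>
     x = (\<Sum>b\<in>(\<lambda>a. single a 1) ` Mon M. q b * b)"
proof -
  obtain M0 where M0: "\<And>m. m \<ge> M0 \<Longrightarrow> C m \<subseteq> rideal.span (c ` X)" using eventually_in_ideal by blast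
  \<comment> \<open>A positive \<open>M\<close> keeps the truncated differences \<open>M - 1\<close>
    in later degree counts exact.\<close>
  define M where "M = max 1 M0"
  let ?I = "(\<lambda>a. single a (1::complex)) ` Mon M"
  have I: "finite ?I" using finite_Mon by simp
  have "\<exists>q. (\<forall>b. q b \<in> A j) \<and> x = (\<Sum>b\<in>?I. q b * b)" if "x \<in> C (M + j)" for j x
    using that
  proof (induction j arbitrary: x)
    case 0
    then have "x \<in> cvs.span ?I" by (simp add: C_def coord_space_eq_span)
    then obtain u where u: "x = (\<Sum>b\<in>?I. cscale (u b) b)" unfolding cvs.span_finite[OF I] by blast
    have "cscale (u b) b = cscale (u b) 1 * b" for b
      by (simp add: cscale_eq_mult)
    then show ?case
      using u cvs.subspace_scale[OF A_subspace A_one]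
      by (intro exI[of _ "\<lambda>b. cscale (u b) 1"]) simp
  next
    case (Suc j)
    have "c ` X \<subseteq> C 1" using param by (auto simp: C_def)
    moreover have "M + Suc j \<ge> M0" by (simp add: M_def)
    then have "x \<in> rideal.span (c ` X)" using M0 Suc.prems by blast
    ultimately obtain r where r: "\<And>v. v \<in> c ` X \<Longrightarrow> r v \<in> C (M + j)" "x = (\<Sum>v\<in>c ` X. r v * v)"
      using ideal_component[of "c ` X" x "M + j"] Suc.prems finite_X by auto
    have "\<forall>v. \<exists>q. v \<in> c ` X \<longrightarrow> (\<forall>b. q b \<in> A j) \<and> r v = (\<Sum>b\<in>?I. q b * b)"
      using Suc.IH[OF r(1)] by blast
    from choice[OF this] obtain q where q: "\<And>v b. v \<in> c ` X \<Longrightarrow> q v b \<in> A j"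
      "\<And>v. v \<in> c ` X \<Longrightarrow> r v = (\<Sum>b\<in>?I. q v b * b)"
      by blast
    have "x = (\<Sum>v\<in>c ` X. \<Sum>b\<in>?I. q v b * v * b)"
      unfolding r(2) by (rule sum.cong) (simp_all add: q(2) sum_distrib_left sum_distrib_right mult_ac)
    also have "\<dots> = (\<Sum>b\<in>?I. (\<Sum>v\<in>c ` X. q v b * v) * b)"
      by (subst sum.swap) (simp add: sum_distrib_right)
    finally have "x = (\<Sum>b\<in>?I. (\<Sum>v\<in>c ` X. q v b * v) * b)" .
    moreover have "(\<Sum>v\<in>c ` X. q v b * v) \<in> A (Suc j)" for b
      using A_mult[OF q(1), of _ _ 1] param_in_A by (intro A_sum) auto
    ultimately show ?case by (intro exI[of _ "\<lambda>b. \<Sum>v\<in>c ` X. q v b * v"]) blast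
  qed
  moreover have "M \<ge> 1" by (simp add: M_def)
  ultimately show ?thesis by blast
qed

text \<open>The submodule generated by \<open>\<Delta>\<close>. The generators have degree 1, so
  \<open>D \<Delta> m\<close> lies in degree \<open>Suc m\<close>, whence the \<open>- 1\<close> in
  the degrees below.\<close>

definition D :: "'v mpol set \<Rightarrow> nat \<Rightarrow> 'v mpol set" where
  "D \<Delta> m = {(\<Sum>\<delta>\<in>\<Delta>. \<delta> * q \<delta>) |q. \<forall>\<delta>\<in>\<Delta>. q \<delta> \<in> A m}"

lemma D_0: "0 \<in> D \<Delta> m"
  unfolding D_def using cvs.subspace_0[OF A_subspace] by (auto intro!: exI[of _ "\<lambda>_. 0"])

lemma D_add: "x \<in> D \<Delta> m \<Longrightarrow> y \<in> D \<Delta> m \<Longrightarrow> x + y \<in> D \<Delta> m"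
proof -
  assume "x \<in> D \<Delta> m" "y \<in> D \<Delta> m"
  then obtain q r where "x = (\<Sum>\<delta>\<in>\<Delta>. \<delta> * q \<delta>)" "\<forall>\<delta>\<in>\<Delta>. q \<delta> \<in> A m"
    "y = (\<Sum>\<delta>\<in>\<Delta>. \<delta> * r \<delta>)" "\<forall>\<delta>\<in>\<Delta>. r \<delta> \<in> A m" by (auto simp: D_def)
  then have "x + y = (\<Sum>\<delta>\<in>\<Delta>. \<delta> * (q \<delta> + r \<delta>))" "\<forall>\<delta>\<in>\<Delta>. q \<delta> + r \<delta> \<in> A m"
    using cvs.subspace_add[OF A_subspace] by (auto simp: distrib_left sum.distrib)
  then show ?thesis by (auto simp: D_def intro!: exI[of _ "\<lambda>\<delta>. q \<delta> + r \<delta>"])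
qed

lemma D_mult: "x \<in> A k \<Longrightarrow> y \<in> D \<Delta> m \<Longrightarrow> x * y \<in> D \<Delta> (k + m)"
proof -
  assume x: "x \<in> A k" and "y \<in> D \<Delta> m"
  then obtain q where q: "y = (\<Sum>\<delta>\<in>\<Delta>. \<delta> * q \<delta>)" "\<forall>\<delta>\<in>\<Delta>. q \<delta> \<in> A m" by (auto simp: D_def)
  have "x * y = (\<Sum>\<delta>\<in>\<Delta>. \<delta> * (x * q \<delta>))" by (simp add: q(1) sum_distrib_left mult_ac)
  then show ?thesis using q(2) A_mult[OF x] by (auto simp: D_def intro!: exI[of _ "\<lambda>\<delta>. x * q \<delta>"])
qed

lemma D_sum: "finite I \<Longrightarrow> (\<And>i. i \<in> I \<Longrightarrow> f i \<in> D \<Delta> m) \<Longrightarrow> (\<Sum>i\<in>I. f i) \<in> D \<Delta> m"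
  by (induction I rule: finite_induct) (auto simp: D_0 D_add)

lemma D_subset_C:
  assumes "\<Delta> \<subseteq> C 1"
  shows "D \<Delta> m \<subseteq> C (Suc m)"
proof
  fix x assume "x \<in> D \<Delta> m"
  then obtain q where q: "x = (\<Sum>\<delta>\<in>\<Delta>. \<delta> * q \<delta>)" "\<forall>\<delta>\<in>\<Delta>. q \<delta> \<in> A m" by (auto simp: D_def)
  have "\<delta> * q \<delta> \<in> C (Suc m)" if "\<delta> \<in> \<Delta>" for \<delta>
    using C_mult[of \<delta> 1 "q \<delta>" m] assms q(2) A_subset_C that by auto
  then show "x \<in> C (Suc m)" unfolding q(1) by (rule cvs.subspace_sum[OF C_subspace])
qed

text \<open>
  \<open>C\<close> is a finite module over the graded algebra \<open>A\<close>; near the point \<open>v\<close>, where the parameters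
  in \<open>Y\<close> vanish and \<open>T\<close> does not, it is generated by \<open>\<Delta>\<close>, so a nonzero multiple of \<open>C\<close> lies in
  the submodule \<open>D \<Delta>\<close>.
\<close>

theorem denominator:
  assumes Y: "Y \<subseteq> X" "\<And>i. i \<in> Y \<Longrightarrow> mpol_eval (c i) v = 0"
    and T: "T \<in> A k" "k \<ge> 1" "mpol_eval T v \<noteq> 0"
    and \<Delta>: "\<Delta> \<subseteq> C 1"
    and gen: "\<And>m a. m \<ge> 1 \<Longrightarrow> a \<in> Mon m \<Longrightarrow>
      \<exists>K. \<exists>y\<in>D \<Delta> (k * K + m - 1). T ^ K * single a 1 - y \<in> rideal.span (c ` Y)"
  shows "\<exists>e s M. s \<noteq> 0 \<and> M \<ge> 1 \<and> (\<forall>j. \<forall>x\<in>C (M + j). s * x \<in> D \<Delta> (e + j + M - 1))"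
proof -
  obtain M where M: "M \<ge> 1" "\<And>j x. x \<in> C (M + j) \<Longrightarrow> \<exists>q. (\<forall>b. q b \<in> A j) \<and>
     x = (\<Sum>b\<in>(\<lambda>a. single a 1) ` Mon M. q b * b)" using finite_generation by blast
  let ?s = "\<lambda>a. single a (1::complex)"
  let ?I = "?s ` Mon M" and ?J = "rideal.span (c ` Y)" and ?P = "{x. mpol_eval x v = 0}"
  have sJ: "rideal.subspace ?J" by simp
  have I: "finite ?I" using finite_Mon by simp
  obtain K where K: "\<And>a. a \<in> Mon M \<Longrightarrow> \<exists>y\<in>D \<Delta> (k * K a + M - 1). T ^ K a * ?s a - y \<in> ?J"
    using gen[OF M(1)] by metis
  \<comment> \<open>One exponent for all generators, and a positive one, so that
    \<open>k * L\<close> has the form \<open>Suc l\<close>.\<close>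
  define L where "L = Suc (\<Sum>a\<in>Mon M. K a)"
  have L: "\<exists>y\<in>D \<Delta> (k * L + M - 1). T ^ L * b - y \<in> ?J" if b: "b \<in> ?I" for b
  proof -
    obtain a where a: "a \<in> Mon M" "b = ?s a" using b by blast
    obtain y where y: "y \<in> D \<Delta> (k * K a + M - 1)" "T ^ K a * b - y \<in> ?J" using K a by blast
    have KL: "K a \<le> L" using a(1) member_le_sum[of a "Mon M" K] finite_Mon by (simp add: L_def)
    have "k * (L - K a) + (k * K a + M - 1) = k * L + M - 1"
      using KL M(1) by (simp add: diff_mult_distrib2)
    then have "T ^ (L - K a) * y \<in> D \<Delta> (k * L + M - 1)"
      using D_mult[OF A_power[OF T(1)] y(1), of "L - K a"] by simp
    moreover have "T ^ (L - K a) * (T ^ K a * b - y) \<in> ?J"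
      by (rule rideal.subspace_scale[OF sJ y(2)])
    then have "T ^ L * b - T ^ (L - K a) * y \<in> ?J"
      using KL by (simp add: right_diff_distrib flip: mult.assoc power_add)
    ultimately show ?thesis by blast
  qed
  have "\<exists>e s. s \<in> A e \<and> s \<notin> ?P \<and> (\<forall>b\<in>?I. s * b \<in> D \<Delta> (e + M - 1))"
  proof (rule graded_elimination[where s = "T ^ L" and e = "k * L"])
    show "T ^ L \<in> A (k * L)" by (rule A_power[OF T(1)])
    show "T ^ L \<notin> ?P" using T(3) by (simp add: mpol_eval_power)
    fix b assume b: "b \<in> ?I"
    obtain y where y: "y \<in> D \<Delta> (k * L + M - 1)" "T ^ L * b - y \<in> ?J" using L[OF b] by blast
    have "k * L \<ge> 1" using T(2) by (simp add: L_def)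
    then obtain l where l: "k * L = Suc l" by (metis Suc_le_D One_nat_def)
    have bC: "b \<in> C M" using b by (auto simp: C_def coord_space_def)
    have "T ^ L * b \<in> C (k * L + M)"
      using C_mult[OF _ bC] A_power[OF T(1)] A_subset_C by blast
    moreover have "y \<in> C (k * L + M)"
      using D_subset_C[OF \<Delta>] y(1) M(1) by fastforce
    ultimately have yC: "T ^ L * b - y \<in> C (Suc (M + l))"
      using cvs.subspace_diff[OF C_subspace] l by (simp add: add.commute)
    have YC: "c ` Y \<subseteq> C 1" using param Y(1) by (auto simp: C_def)
    have "finite (c ` Y)" using Y(1) finite_X finite_subset by blast
    from ideal_component[OF this YC y(2) yC] obtain r where r: "\<And>u. u \<in> c ` Y \<Longrightarrow> r u \<in> C (M + l)"
      "T ^ L * b - y = (\<Sum>u\<in>c ` Y. r u * u)"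
      by blast
    have "\<forall>u. \<exists>q. u \<in> c ` Y \<longrightarrow> (\<forall>b. q b \<in> A l) \<and> r u = (\<Sum>b\<in>?I. q b * b)"
      using M(2)[OF r(1)] by blast
    from choice[OF this] obtain q where q: "\<And>u b. u \<in> c ` Y \<Longrightarrow> q u b \<in> A l"
      "\<And>u. u \<in> c ` Y \<Longrightarrow> r u = (\<Sum>b\<in>?I. q u b * b)"
      by blast
    \<comment> \<open>Each coefficient is a combination of the \<open>c i\<close> with
      \<open>i\<close> in \<open>Y\<close>, so it vanishes at \<open>v\<close>: it lies in the prime
      of that point.\<close>
    define m where "m b = (\<Sum>u\<in>c ` Y. q u b * u)" for b
    have "(\<Sum>u\<in>c ` Y. r u * u) = (\<Sum>u\<in>c ` Y. \<Sum>b\<in>?I. q u b * u * b)"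
      by (rule sum.cong) (simp_all add: q(2) sum_distrib_left sum_distrib_right mult_ac)
    also have "\<dots> = (\<Sum>b\<in>?I. m b * b)"
      by (subst sum.swap) (simp add: sum_distrib_right m_def)
    finally have "T ^ L * b - (\<Sum>b\<in>?I. m b * b) = y" using r(2) by (simp add: algebra_simps)
    moreover have "m b \<in> A (k * L)" for b
      unfolding m_def l using A_mult[OF q(1), of _ _ 1] param_in_A Y(1) by (intro A_sum) auto
    moreover have "m b \<in> ?P" for b
      using Y(2) by (auto simp: m_def mpol_eval_sum mpol_eval_mult intro!: sum.neutral)
    ultimately show "\<exists>m. (\<forall>j\<in>?I. m j \<in> A (k * L) \<inter> ?P) \<and>
        T ^ L * b - (\<Sum>j\<in>?I. m j * j) \<in> D \<Delta> (k * L + M - 1)"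
      using y(1) by (intro exI[of _ m]) auto
  next
    fix e f x y assume "x \<in> A e" "y \<in> D \<Delta> (f + M - 1)"
    then show "x * y \<in> D \<Delta> (e + f + M - 1)"
      using D_mult[of x e y \<Delta> "f + M - 1"] M(1) by (simp add: add.assoc)
  qed (use I in \<open>auto simp: prime_ideal_eval D_0 D_add A_mult
      intro: cvs.subspace_add[OF A_subspace] cvs.subspace_diff[OF A_subspace]\<close>)
  then obtain e s where s: "s \<in> A e" "s \<notin> ?P" "\<And>b. b \<in> ?I \<Longrightarrow> s * b \<in> D \<Delta> (e + M - 1)" by blast
  have "s * x \<in> D \<Delta> (e + j + M - 1)" if x: "x \<in> C (M + j)" for j x
  proof -
    obtain q where q: "\<And>b. q b \<in> A j" "x = (\<Sum>b\<in>?I. q b * b)" using M(2)[OF x] by blast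
    have "q b * (s * b) \<in> D \<Delta> (e + j + M - 1)" if "b \<in> ?I" for b
      using D_mult[OF q(1) s(3)[OF that], of b] M(1) by (simp add: add_ac)
    then have "(\<Sum>b\<in>?I. q b * (s * b)) \<in> D \<Delta> (e + j + M - 1)" using I by (intro D_sum)
    moreover have "s * x = (\<Sum>b\<in>?I. q b * (s * b))" by (simp add: q(2) sum_distrib_left mult_ac)
    ultimately show ?thesis by simp
  qed
  moreover have "s \<noteq> 0" using s(2) by auto
  ultimately show ?thesis using M(1) by blast
qed

text \<open>Multiplication by \<open>s\<close> is injective and sends \<open>C (Suc m)\<close> into
  a space spanned by the products of \<open>\<Delta>\<close> with a basis of
  \<open>A (m + e)\<close>. Thus \<open>card \<Delta>\<close> bounds the rank of \<open>C\<close>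
  over \<open>A\<close>.\<close>

theorem card_Mon_le:
  assumes Y: "Y \<subseteq> X" "\<And>i. i \<in> Y \<Longrightarrow> mpol_eval (c i) v = 0"
    and T: "T \<in> A k" "k \<ge> 1" "mpol_eval T v \<noteq> 0"
    and \<Delta>: "finite \<Delta>" "\<Delta> \<subseteq> C 1"
    and gen: "\<And>m a. m \<ge> 1 \<Longrightarrow> a \<in> Mon m \<Longrightarrow>
      \<exists>K. \<exists>y\<in>D \<Delta> (k * K + m - 1). T ^ K * single a 1 - y \<in> rideal.span (c ` Y)"
  shows "\<exists>e M. \<forall>m\<ge>M. card (Mon (Suc m)) \<le> card \<Delta> * cvs.dim (cmon c ` monoms X (m + e))"
proof -
  obtain e s M where s: "s \<noteq> 0" "M \<ge> 1"
    "\<And>j x. x \<in> C (M + j) \<Longrightarrow> s * x \<in> D \<Delta> (e + j + M - 1)"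
    using denominator[OF Y T \<Delta>(2) gen] by blast
  have "card (Mon (Suc m)) \<le> card \<Delta> * cvs.dim (cmon c ` monoms X (m + e))" if m: "m \<ge> M" for m
  proof -
    obtain j where j: "Suc m = M + j" using m le_Suc_ex[of M "Suc m"] by auto
    have em: "e + j + M - 1 = m + e" using j by simp
    let ?L = "\<lambda>x. x * s"
    let ?S = "(\<lambda>a. single a (1::complex)) ` Mon (Suc m)"
    have "cvs.dim (C (Suc m)) = cvs.dim {x \<in> C (Suc m). ?L x = 0} + cvs.dim (?L ` C (Suc m))"
      using finite_Mon by (intro cvs_rank_nullity[OF mult_linear C_subspace, of ?S])
        (auto simp: C_def coord_space_eq_span)
    moreover have "{x \<in> C (Suc m). ?L x = 0} = {0}"
      using s(1) cvs.subspace_0[OF C_subspace] by auto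
    moreover have "cvs.dim {0 :: 'v mpol} = 0"
      using cvs_dim_insert[of "{}" "0 :: 'v mpol"] cvs.dim_eq_card_independent[OF cvs.independent_empty]
      by simp
    ultimately have "card (Mon (Suc m)) = cvs.dim (?L ` C (Suc m))"
      using dim_coord_space[OF finite_Mon] by (simp add: C_def)
    also obtain B where B: "cvs.independent B" "A (m + e) \<subseteq> cvs.span B"
      "card B = cvs.dim (A (m + e))" "finite B"
      using cvs_finite_basis[of "cmon c ` monoms X (m + e)" "A (m + e)"] finite_monoms[OF finite_X]
      by (metis A_def finite_imageI order_refl)
    let ?E = "(\<lambda>(\<delta>, b). \<delta> * b) ` (\<Delta> \<times> B)"
    have "?L ` C (Suc m) \<subseteq> cvs.span ?E"
    proof (rule image_subsetI)
      fix x assume "x \<in> C (Suc m)"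
      then have "x * s \<in> D \<Delta> (m + e)" using s(3)[of x j] j em by (simp add: mult.commute)
      then obtain q where q: "x * s = (\<Sum>\<delta>\<in>\<Delta>. \<delta> * q \<delta>)" "\<And>\<delta>. \<delta> \<in> \<Delta> \<Longrightarrow> q \<delta> \<in> A (m + e)"
        by (auto simp: D_def)
      have "q \<delta> * \<delta> \<in> cvs.span ?E" if "\<delta> \<in> \<Delta>" for \<delta>
      proof -
        have "q \<delta> * \<delta> \<in> cvs.span ((\<lambda>b. b * \<delta>) ` B)"
          using q(2)[OF that] B(2) by (intro cvs_span_mult_right) auto
        also have "\<dots> \<subseteq> cvs.span ?E"
          using that by (intro cvs.span_mono) (force simp: mult.commute[of _ \<delta>])
        finally show ?thesis .
      qed
      then show "x * s \<in> cvs.span ?E"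
        unfolding q(1) by (intro cvs.span_sum) (simp add: mult.commute)
    qed
    then have "cvs.dim (?L ` C (Suc m)) \<le> card ?E"
      using \<Delta>(1) B(4) by (intro cvs.dim_le_card) auto
    also have "\<dots> \<le> card \<Delta> * card B"
      using card_image_le[of "\<Delta> \<times> B" "\<lambda>(\<delta>, b). \<delta> * b"] \<Delta>(1) B(4) by (simp add: card_cartesian_product)
    finally show ?thesis using B(3) by (simp add: A_def)
  qed
  then show ?thesis by blast
qed

end

section \<open>Squares\<close>

lemma monoms_Suc_split:
  assumes "a \<in> monoms X (Suc m)"
  shows "\<exists>i\<in>X. \<exists>b\<in>monoms X m. a = single i 1 + b"
proof -
  have "keys a \<noteq> {}" using assms by (auto simp: monoms_def)
  then obtain i where i: "i \<in> keys a" by blast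
  define b where "b = a - single i 1"
  have ab: "a = single i 1 + b"
    using i by (intro poly_mapping_eqI) (auto simp: b_def lookup_add lookup_minus lookup_single when_def in_keys_iff)
  have keys: "keys b \<subseteq> keys a"
    by (auto simp: b_def in_keys_iff lookup_minus)
  have "(\<Sum>j\<in>keys a. lookup a j)
      = (\<Sum>j\<in>keys a. lookup (single i 1) j)
        + (\<Sum>j\<in>keys a. lookup b j)"
    unfolding sum.distrib[symmetric] lookup_add[symmetric] ab[symmetric] ..
  also have "(\<Sum>j\<in>keys a. lookup (single i 1) j) = (1::nat)"
    using i by (simp add: lookup_single when_def)
  also have "(\<Sum>j\<in>keys a. lookup b j) = (\<Sum>j\<in>keys b. lookup b j)"
    using keys by (intro sum.mono_neutral_right) (auto simp: in_keys_iff)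
  finally have "b \<in> monoms X m" using assms keys by (auto simp: monoms_def)
  then show ?thesis using i assms ab by (auto simp: monoms_def)
qed

lemma monoms_add_iff:
  assumes X: "finite X" and e: "e \<in> monoms X k"
  shows "e + b \<in> monoms X (k + m) \<longleftrightarrow> b \<in> monoms X m"
proof -
  have "keys (e + b) = keys e \<union> keys b"
    by (auto simp: in_keys_iff lookup_add)
  then show ?thesis using e by (auto simp: mem_monoms_iff[OF X] lookup_add sum.distrib)
qed

lemma monoms_2_split:
  assumes "e \<in> monoms X 2"
  shows "\<exists>a\<in>X. \<exists>b\<in>X. e = single a 1 + single b 1"
proof -
  obtain a b where ab: "a \<in> X" "b \<in> monoms X 1" "e = single a 1 + b"
    using monoms_Suc_split[of e X 1] assms by (auto simp: numeral_2_eq_2)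
  obtain b' c where "b' \<in> X" "c \<in> monoms X 0" "b = single b' 1 + c"
    using monoms_Suc_split[of b X 0] ab(2) by auto
  then show ?thesis using ab by (auto simp: monoms_0)
qed

text \<open>Membership in a radical is tested on primes: a prime that contains every coefficient of
  the product but not \<open>g a * h b\<close> contradicts Gauss's lemma.\<close>

lemma prod_coeff_nilpotent:
  fixes S :: "'e::linordered_cancel_ab_semigroup_add set" and g h :: "'e \<Rightarrow> 'r::comm_ring_1"
  assumes S: "finite S" and X: "\<And>a b. a \<in> S \<Longrightarrow> b \<in> S \<Longrightarrow> a + b \<in> X" and ab: "a \<in> S" "b \<in> S"
  shows "\<exists>K. (g a * h b) ^ K \<in> rideal.span (prod_coeff S g h ` X)"
proof (rule ccontr)
  assume "\<not> ?thesis"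
  then obtain P where P: "prime_ideal P" "rideal.span (prod_coeff S g h ` X) \<subseteq> P" "g a * h b \<notin> P"
    using prime_avoidance[of "rideal.span (prod_coeff S g h ` X)" "g a * h b"] by auto
  have sP: "rideal.subspace P" using prime_idealD[OF P(1)] by simp
  have "g a \<notin> P" "h b \<notin> P"
    using P(3) rideal_mult_right[OF sP] rideal.subspace_scale[OF sP] by auto
  then obtain x y where "x \<in> S" "y \<in> S" "prod_coeff S g h (x + y) \<notin> P"
    using gauss_lowest_term[where wt = "\<lambda>_. 0" and g = g and h = h, OF P(1) S _ ab(1) _ ab(2)] by auto
  then show False using X P(2) rideal.span_base[of _ "prod_coeff S g h ` X"] by blast
qed

lemma prod_coeff_empty:
  assumes "\<And>a b. a \<in> S \<Longrightarrow> b \<in> S \<Longrightarrow> a + b \<noteq> \<gamma>"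
  shows "prod_coeff S g h \<gamma> = 0"
  unfolding prod_coeff_def using assms by (intro sum.neutral) auto

lemma prod_coeff_leading:
  fixes S :: "'e::cancel_ab_semigroup_add set"
  assumes J: "rideal.subspace J" and S: "finite S" "b \<in> S" "x \<in> S"
    and g: "\<And>a. a \<in> S - {b} \<Longrightarrow> g a \<in> J"
  shows "prod_coeff S g h (b + x) - g b * h x \<in> J"
proof -
  let ?A = "{(u, v) \<in> S \<times> S. u + v = b + x}"
  have "prod_coeff S g h (b + x) = g b * h x + (\<Sum>(u, v)\<in>?A - {(b, x)}. g u * h v)"
    unfolding prod_coeff_def using S
    by (subst sum.remove[OF finite_sum_pairs[OF S(1)], of "(b, x)"]) auto
  moreover have "(\<Sum>(u, v)\<in>?A - {(b, x)}. g u * h v) \<in> J"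
  proof (rule rideal.subspace_sum[OF J])
    fix p assume "p \<in> ?A - {(b, x)}"
    then obtain u v where uv: "p = (u, v)" "u \<in> S" "u + v = b + x" "(u, v) \<noteq> (b, x)" by blast
    then have "u \<noteq> b" by auto
    then show "(case p of (u, v) \<Rightarrow> g u * h v) \<in> J"
      using uv g rideal_mult_right[OF J] by simp
  qed
  ultimately show ?thesis by simp
qed

lemma rideal_cong_mult:
  assumes J: "rideal.subspace J" and "x - x' \<in> J" "y - y' \<in> J"
  shows "x * y - x' * y' \<in> J"
proof -
  have "x * y - x' * y' = (x - x') * y + x' * (y - y')" by (simp add: algebra_simps)
  also have "\<dots> \<in> J"
    by (rule rideal.subspace_add[OF J rideal_mult_right[OF J assms(2)] rideal.subspace_scale[OF J assms(3)]])
  finally show ?thesis .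
qed

lemma rideal_cong_power:
  assumes J: "rideal.subspace J" and "x - x' \<in> J"
  shows "x ^ k - x' ^ k \<in> J"
  by (induction k) (auto simp: rideal.subspace_0[OF J] intro: rideal_cong_mult[OF J assms(2)])

lemma rideal_power_mult:
  assumes J: "rideal.subspace J" and "x \<in> J" "y \<in> J" "i + j \<ge> 1"
  shows "x ^ i * y ^ j \<in> J"
proof (cases i)
  case 0
  then obtain k where "j = Suc k" using assms(4) by (cases j) auto
  then show ?thesis using 0 rideal_mult_right[OF J assms(3)] by simp
next
  case (Suc k)
  then show ?thesis using rideal_mult_right[OF J assms(2), of "x ^ k * y ^ j"] by (simp add: mult.assoc)
qed

lemma mpol_eval_prod_coeff:
  "mpol_eval (prod_coeff S g h \<gamma>) v = prod_coeff S (\<lambda>a. mpol_eval (g a) v) (\<lambda>b. mpol_eval (h b) v) \<gamma>"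
  unfolding prod_coeff_def mpol_eval_sum by (rule sum.cong) (auto simp: mpol_eval_mult)

lemma prod_coeff_unique_pair:
  assumes "finite S" "a \<in> S" "b \<in> S"
    and "\<And>x y. x \<in> S \<Longrightarrow> y \<in> S \<Longrightarrow> x + y = a + b \<Longrightarrow> (x, y) \<noteq> (a, b) \<Longrightarrow> g x * h y = 0"
  shows "prod_coeff S g h (a + b) = g a * h b"
  unfolding prod_coeff_def
  by (subst sum.remove[OF finite_sum_pairs[OF assms(1)], of "(a, b)"])
    (use assms in \<open>auto intro!: sum.neutral\<close>)

lemma lookup_mult_forms:
  assumes S: "finite S" and p: "p \<in> coord_space S" and q: "q \<in> coord_space S"
  shows "lookup (p * q) \<gamma> = prod_coeff S (lookup p) (lookup q) \<gamma>"
proof -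
  have rep: "r = (\<Sum>a\<in>S. single a (lookup r a))" if "r \<in> coord_space S" for r :: "'a \<Rightarrow>\<^sub>0 complex"
  proof -
    have "(\<Sum>a\<in>keys r. single a (lookup r a))
        = (\<Sum>a\<in>S. single a (lookup r a))"
      using that S by (intro sum.mono_neutral_left) (auto simp: coord_space_def in_keys_iff)
    then show ?thesis using poly_mapping_sum_single[of r] by metis
  qed
  have "p * q = (\<Sum>a\<in>S. single a (lookup p a)) *
      (\<Sum>b\<in>S. single b (lookup q b))"
    by (rule arg_cong2[of _ _ _ _ "(*)"]) (rule rep, fact)+
  also have "\<dots> = (\<Sum>(a, b)\<in>S \<times> S. single (a + b) (lookup p a * lookup q b))"
    by (simp add: sum_product sum.cartesian_product mult_single)
  finally have "lookup (p * q) \<gamma> = (\<Sum>(a, b)\<in>S \<times> S.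
      if a + b = \<gamma> then lookup p a * lookup q b else 0)"
    by (simp add: lookup_sum lookup_single when_def case_prod_unfold)
  also have "\<dots> = prod_coeff S (lookup p) (lookup q) \<gamma>"
    unfolding prod_coeff_def using S
    by (intro sum.mono_neutral_cong_right) (auto split: if_splits)
  finally show ?thesis .
qed

abbreviation var :: "'v \<Rightarrow> 'v mpol" where
  "var i \<equiv> single (single i 1) 1"

lemma mpol_eval_var [simp]: "mpol_eval (var i) v = lookup v i"
  by simp

lemma single_eq_cmon: "single a 1 = cmon var a"
proof -
  have "var i ^ k = single (single i k) 1" for i :: 'a and k
    by (induction k) (auto simp: mult_single simp flip: single_add)
  moreover have "(\<Prod>i\<in>I. single (b i) (1::complex)) = single (\<Sum>i\<in>I. b i) 1"
    for I :: "'a set" and b :: "'a \<Rightarrow> ('a \<Rightarrow>\<^sub>0 nat)"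
    by (induction I rule: infinite_finite_induct) (auto simp: mult_single)
  ultimately show ?thesis using poly_mapping_sum_single[of a] by (simp add: cmon_def)
qed

lemma single_in_rideal:
  assumes "rideal.subspace J" "k \<in> keys a" "var k \<in> J"
  shows "single a 1 \<in> J"
proof -
  let ?b = "a - single k 1"
  have "a = single k 1 + ?b"
    using assms(2) by (intro poly_mapping_eqI) (auto simp: lookup_add lookup_minus lookup_single when_def in_keys_iff)
  then have "single a 1 = var k * single ?b 1"
    by (metis single_add_eq_mult)
  then show ?thesis using rideal_mult_right[OF assms(1,3)] by simp
qed

lemma forms_add_mem: "a \<in> monoms {..n} d \<Longrightarrow> b \<in> monoms {..n} d \<Longrightarrow> a + b \<in> monoms {..(n::nat)} (2 * d)"
  using monoms_add[of "{..n}" a d b d] by (simp add: mult_2)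

lemma var_mult_in_coord_space:
  assumes "single i 1 + single j 1 \<in> E"
  shows "var i * var j \<in> coord_space E"
  using assms by (simp add: coord_space_def mult_single)

lemma prod_coeff_in_subspace:
  assumes "cvs.subspace W" "\<And>a b. a \<in> S \<Longrightarrow> b \<in> S \<Longrightarrow> g a * h b \<in> W"
  shows "prod_coeff S g h \<gamma> \<in> W"
  unfolding prod_coeff_def using assms(2) by (intro cvs.subspace_sum[OF assms(1)]) auto

locale square_forms =
  fixes n d :: nat
begin

definition S :: "(nat \<Rightarrow>\<^sub>0 nat) set" where "S = monoms {..n} d"
definition X :: "(nat \<Rightarrow>\<^sub>0 nat) set" where "X = monoms {..n} (2 * d)"
definition c :: "(nat \<Rightarrow>\<^sub>0 nat) \<Rightarrow> (nat \<Rightarrow>\<^sub>0 nat) mpol" where "c = prod_coeff S var var"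

lemma finite_S: "finite S" and finite_X: "finite X"
  by (simp_all add: S_def X_def finite_monoms)

lemma add_mem_X: "a \<in> S \<Longrightarrow> b \<in> S \<Longrightarrow> a + b \<in> X"
  by (simp add: S_def X_def forms_add_mem)

sublocale graded_param X c "\<lambda>m. monoms S (2 * m)"
proof
  show "finite X" by (rule finite_X)
  show "finite (monoms S (2 * m))" for m by (rule finite_monoms[OF finite_S])
  show "monoms S (2 * 0) = {0}" by (simp add: monoms_0)
  show "\<exists>e\<in>monoms S (2 * 1). \<exists>b\<in>monoms S (2 * m). a = e + b" if a: "a \<in> monoms S (2 * Suc m)" for a m
  proof -
    obtain i b where i: "i \<in> S" "b \<in> monoms S (Suc (2 * m))" "a = single i 1 + b"
      using monoms_Suc_split[of a S "Suc (2 * m)"] a by auto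
    obtain j b' where j: "j \<in> S" "b' \<in> monoms S (2 * m)" "b = single j 1 + b'"
      using monoms_Suc_split[OF i(2)] by auto
    have "single i 1 + single j 1 \<in> monoms S (1 + 1)"
      using i(1) j(1) by (intro monoms_add[OF finite_S] monoms_single)
    then show ?thesis
      using j(2,3) i(3)
      by (intro bexI[of _ "single i 1 + single j 1"] bexI[of _ b'])
        (simp_all add: add.assoc numeral_2_eq_2)
  qed
  show "e + b \<in> monoms S (2 * (k + m)) \<longleftrightarrow> b \<in> monoms S (2 * m)" if "e \<in> monoms S (2 * k)" for e b k m
    using monoms_add_iff[OF finite_S that, of b "2 * m"] by (simp add: distrib_left)
  show "c i \<in> coord_space (monoms S (2 * 1))" if "i \<in> X" for i
    unfolding c_def
  proof (rule prod_coeff_in_subspace[OF coord_space_subspace], rule var_mult_in_coord_space)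
    fix a b assume "a \<in> S" "b \<in> S"
    then have "single a 1 + single b 1 \<in> monoms S (1 + 1)"
      by (intro monoms_add[OF finite_S] monoms_single)
    then show "single a 1 + single b 1 \<in> monoms S (2 * 1)"
      by (simp add: numeral_2_eq_2)
  qed
  show "\<exists>K. single e 1 ^ K \<in> rideal.span (c ` X)" if e: "e \<in> monoms S (2 * 1)" for e
  proof -
    obtain a b where ab: "a \<in> S" "b \<in> S" "e = single a 1 + single b 1"
      using monoms_2_split[of e S] e by auto
    then show ?thesis
      using prod_coeff_nilpotent[OF finite_S add_mem_X ab(1,2), where g = var and h = var]
      by (simp add: c_def single_add_eq_mult)
  qed
qed

lemma hilbert_function_eq:
  "hilbert_function X (SOS n d 1) m = cvs.dim (cmon c ` monoms X m)"
  unfolding SOS_def X_def[symmetric]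
proof (rule hilbert_function_parametrized[OF finite_X finite_S])
  \<comment> \<open>A form is its own coefficient vector: on the right, \<open>f\<close> is the
    point at which a polynomial in the coefficients is evaluated.\<close>
  have sq: "lookup (f ^ 2) \<gamma> = mpol_eval (c \<gamma>) f" if "f \<in> forms {..n} d" for f \<gamma>
    using that lookup_mult_forms[OF finite_S, of f f \<gamma>]
    by (simp add: forms_def S_def c_def mpol_eval_prod_coeff power2_eq_square)
  show "c i \<in> polys S" for i
    unfolding c_def prod_coeff_def
    by (rule polys_sum) (auto intro!: polys_mult polys_single)
  let ?Z = "{\<Sum>i<1. f i ^ 2 |f. \<forall>i<(1::nat). f i \<in> forms {..n} d}"
  show "?Z \<subseteq> coord_space X"
  proof clarify
    fix f :: "nat \<Rightarrow> nat mpol" assume "\<forall>i<1. f i \<in> forms {..n} d"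
    then have "keys (f 0 * f 0) \<subseteq> X"
      using keys_mult[of "f 0" "f 0"] add_mem_X by (fastforce simp: forms_def coord_space_def S_def)
    then show "(\<Sum>i<1. f i ^ 2) \<in> coord_space X" by (simp add: coord_space_def power2_eq_square)
  qed
  show "\<exists>s\<in>?Z. \<forall>i\<in>X. lookup s i = mpol_eval (c i) v" if "keys v \<subseteq> S" for v
  proof (rule bexI[of _ "v ^ 2"])
    have v: "v \<in> forms {..n} d" using that by (simp add: forms_def coord_space_def S_def)
    then show "\<forall>i\<in>X. lookup (v ^ 2) i = mpol_eval (c i) v" using sq by simp
    show "v ^ 2 \<in> ?Z" using v by (auto intro!: exI[of _ "\<lambda>_. v"])
  qed
  show "\<exists>v. keys v \<subseteq> S \<and> (\<forall>i\<in>X. lookup s i = mpol_eval (c i) v)" if "s \<in> ?Z" for s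
    using that sq by (auto simp: forms_def coord_space_def S_def)
qed

lemma hilbert_function_le: "cvs.dim (cmon c ` monoms X m) \<le> card (monoms S (2 * m))"
proof -
  have "cmon c ` monoms X m \<subseteq> cvs.span ((\<lambda>a. single a 1) ` monoms S (2 * m))"
    using cmon_in_C by (auto simp: C_def coord_space_eq_span)
  then have "cvs.dim (cmon c ` monoms X m) \<le> card ((\<lambda>a. single a (1::complex)) ` monoms S (2 * m))"
    by (rule cvs.dim_le_card) (simp add: finite_monoms[OF finite_S])
  also have "\<dots> \<le> card (monoms S (2 * m))" by (rule card_image_le[OF finite_monoms[OF finite_S]])
  finally show ?thesis .
qed

text \<open>The point is \<open>f = x0^d\<close>, the only square root of \<open>x0^(2d)\<close> up
  to a sign that even polynomials do not see. As a vertex of the Newton polytope,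
  \<open>x0^(2d)\<close> has the coefficient \<open>T = (var b)^2\<close>, which is also the single
  generator, since generators are taken in degree 1.\<close>

lemma hilbert_function_ge:
  "\<exists>e M. \<forall>m\<ge>M. card (monoms S (2 * Suc m)) \<le> cvs.dim (cmon c ` monoms X (m + e))"
proof -
  let ?b = "exp_b d"
  let ?T = "c (?b + ?b)" and ?Y = "X - {?b + ?b}"
  define v where "v = single ?b (1::complex)"
  have bS: "?b \<in> S" by (simp add: S_def exp_b_def monoms_single)
  have vertex: "x = ?b \<and> y = ?b" if xy: "x \<in> S" "y \<in> S" "x + y = ?b + ?b" for x y
  proof -
    have "lookup x 0 + lookup y 0 = d + d"
      using arg_cong[OF xy(3), of "\<lambda>c. lookup c 0"] by (simp add: lookup_add lookup_exps)
    moreover have "lookup x 0 \<le> d" "lookup y 0 \<le> d"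
      using xy(1,2) monoms_lookup_le by (auto simp: S_def)
    ultimately have "lookup x 0 = d" "lookup y 0 = d" by simp_all
    then have "x = single 0 d" "y = single 0 d"
      using xy(1,2) unfolding S_def by (blast intro: monoms_lookup_eq_imp_single)+
    then show ?thesis by (simp add: exp_b_def)
  qed
  have T: "?T = var ?b * var ?b"
    unfolding c_def using vertex by (intro prod_coeff_unique_pair[OF finite_S bS bS]) blast
  have "\<exists>e M. \<forall>m\<ge>M. card (monoms S (2 * Suc m)) \<le> card {?T} * cvs.dim (cmon c ` monoms X (m + e))"
  proof (rule card_Mon_le[of ?Y v ?T 1])
    show "mpol_eval (c i) v = 0" if i: "i \<in> ?Y" for i
    proof -
      have "mpol_eval (c i) v = prod_coeff S (lookup v) (lookup v) i"
        by (simp add: c_def mpol_eval_prod_coeff)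
      also have "\<dots> = 0"
        unfolding prod_coeff_def using i
        by (intro sum.neutral) (auto simp: v_def lookup_single when_def)
      finally show ?thesis .
    qed
    show "?T \<in> A 1" using add_mem_X[OF bS bS] by (rule param_in_A)
    show "mpol_eval ?T v \<noteq> 0" by (simp only: T mpol_eval_mult mpol_eval_var) (simp add: v_def)
    show "{?T} \<subseteq> C 1" using add_mem_X[OF bS bS] param by (auto simp: C_def)
    fix m a assume m: "m \<ge> 1" and a: "a \<in> monoms S (2 * m)"
    let ?J = "rideal.span (c ` ?Y)"
    show "\<exists>K. \<exists>y\<in>D {?T} (1 * K + m - 1). ?T ^ K * single a 1 - y \<in> ?J"
    \<comment> \<open>A power of \<open>var ?b\<close> has even exponent and is a power of
      \<open>?T\<close>. Any other monomial contains a variable that vanishes at \<open>v\<close>,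
      and a power of \<open>?T\<close> carries it into \<open>?J\<close>.\<close>
    proof (cases "keys a \<subseteq> {?b}")
      case True
      then have a_eq: "a = single ?b (2 * m)"
        by (intro monoms_eq_single[OF a]) (auto simp: subset_iff in_keys_iff)
      have "single a 1 = cmon var a" by (rule single_eq_cmon)
      also have "\<dots> = var ?b ^ (2 * m)" unfolding a_eq by (rule cmon_single)
      also have "\<dots> = ?T ^ m" by (simp add: T power_mult power2_eq_square)
      also have "\<dots> = ?T * ?T ^ (m - 1)" using m by (cases m) auto
      finally have eq: "single a 1 = ?T * ?T ^ (m - 1)" .
      have "?T ^ (m - 1) \<in> A (m - 1)" using A_power[OF \<open>?T \<in> A 1\<close>, of "m - 1"] by simp
      then have "?T * ?T ^ (m - 1) \<in> D {?T} (m - 1)"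
        by (auto simp: D_def intro!: exI[of _ "\<lambda>_. ?T ^ (m - 1)"])
      then show ?thesis
        by (intro exI[of _ 0] bexI[of _ "?T * ?T ^ (m - 1)"]) (auto simp: eq rideal.span_zero)
    next
      case False
      then obtain k where k: "k \<in> keys a" "k \<noteq> ?b" by blast
      then have "var k \<in> rideal.span (var ` (S - {?b}))"
        using a by (intro rideal.span_base) (auto simp: monoms_def)
      then have "single a 1 \<in> rideal.span (var ` (S - {?b}))"
        by (rule single_in_rideal[OF rideal.subspace_span k(1)])
      moreover have "2 * single 0 (1/2) = (1 :: (nat \<Rightarrow>\<^sub>0 nat) mpol)"
        by (simp add: mult_single flip: single_numeral single_one)
      moreover have "prod_coeff S var var \<gamma> \<in> ?J" if "\<gamma> \<noteq> ?b + ?b" for \<gamma>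
      proof (cases "\<gamma> \<in> X")
        case True
        then show ?thesis using that by (intro rideal.span_base) (auto simp: c_def)
      next
        case False
        then have "prod_coeff S (var :: (nat \<Rightarrow>\<^sub>0 nat) \<Rightarrow> _) var \<gamma> = 0"
          using add_mem_X by (intro prod_coeff_empty) auto
        then show ?thesis by (simp add: rideal.span_zero)
      qed
      ultimately obtain K where "?T ^ K * single a 1 \<in> ?J"
        using saturation_square[OF finite_S bS _ rideal.subspace_span, where f = var] unfolding c_def by blast
      then show ?thesis using D_0 by (intro exI[of _ K] bexI[of _ 0]) auto
    qed
  qed auto
  then show ?thesis by simp
qed

end

section \<open>Products\<close>

lemma card_ordered_pairs:
  fixes E :: "'a::linorder set"
  assumes "finite E"
  shows "2 * card {(a, b) \<in> E \<times> E. a \<le> b} = card E * (card E + 1)"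
proof -
  let ?L = "{(a, b) \<in> E \<times> E. a \<le> b}" and ?G = "{(a, b) \<in> E \<times> E. b \<le> a}"
  have fin: "finite ?L" "finite ?G" by (rule finite_subset[of _ "E \<times> E"]; use assms in auto)+
  have "bij_betw (\<lambda>(a, b). (b, a)) ?L ?G"
    by (rule bij_betw_byWitness[where f' = "\<lambda>(a, b). (b, a)"]) auto
  then have "card ?L = card ?G" by (rule bij_betw_same_card)
  moreover have "card ?L + card ?G = card (?L \<union> ?G) + card (?L \<inter> ?G)"
    by (rule card_Un_Int[OF fin])
  moreover have "?L \<union> ?G = E \<times> E" by auto
  moreover have "bij_betw (\<lambda>a. (a, a)) E (?L \<inter> ?G)"
    by (rule bij_betw_byWitness[where f' = fst]) auto
  then have "card E = card (?L \<inter> ?G)" by (rule bij_betw_same_card)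
  ultimately show ?thesis by (simp add: card_cartesian_product)
qed

lemma product_eq_sum_of_two_squares:
  fixes p q :: "'x mpol"
  assumes W: "cvs.subspace W" and "p \<in> W" "q \<in> W"
  shows "\<exists>f. p * q = (\<Sum>i<2. f i ^ 2) \<and> (\<forall>i<(2::nat). f i \<in> W)"
proof -
  define f where "f i = (if i = (0::nat) then cscale (1/2) (p + q) else cscale (\<i>/2) (p - q))" for i
  have "f i \<in> W" for i
    unfolding f_def using assms
    by (auto intro: cvs.subspace_scale[OF W] cvs.subspace_add[OF W] cvs.subspace_diff[OF W])
  moreover have "(\<Sum>i<2. f i ^ 2) = p * q"
  proof -
    have sq: "cscale u r ^ 2 = single 0 (u ^ 2) * r ^ 2" for u and r :: "'x mpol"
    proof -
      have "single 0 (u ^ 2) = (single 0 u * single 0 u :: 'x mpol)"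
        by (simp add: mult_single power2_eq_square)
      then show ?thesis by (simp only: cscale_eq_mult power2_eq_square mult_ac)
    qed
    have i: "single 0 ((\<i>/2) ^ 2) = - (single 0 (1/4) :: 'x mpol)"
      by (simp add: single_uminus[symmetric] power_divide)
    have "(\<Sum>i<2. f i ^ 2) = f 0 ^ 2 + f 1 ^ 2" by (simp add: lessThan_Suc numeral_2_eq_2)
    also have "\<dots> = single 0 (1/4) * ((p + q) ^ 2 - (p - q) ^ 2)"
    proof -
      have "f 0 = cscale (1/2) (p + q)" "f 1 = cscale (\<i>/2) (p - q)" by (simp_all add: f_def)
      then show ?thesis by (simp only: sq i) (simp add: power_divide right_diff_distrib)
    qed
    also have "(p + q) ^ 2 - (p - q) ^ 2 = 4 * (p * q)"
      by (simp add: power2_eq_square algebra_simps)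
    also have "single 0 (1/4) * (4 * (p * q)) = p * q"
    proof -
      have "single 0 (1/4) * 4 = (1 :: 'x mpol)"
        by (simp add: mult_single flip: single_numeral single_one)
      then show ?thesis by (simp only: mult.assoc[symmetric] mult_1_left)
    qed
    finally show ?thesis .
  qed
  ultimately show ?thesis by metis
qed

locale product_forms =
  fixes n d :: nat
begin

definition S :: "(nat \<Rightarrow>\<^sub>0 nat) set" where "S = monoms {..n} d"
definition X :: "(nat \<Rightarrow>\<^sub>0 nat) set" where "X = monoms {..n} (2 * d)"
definition g :: "(nat \<Rightarrow>\<^sub>0 nat) \<Rightarrow> (bool \<times> (nat \<Rightarrow>\<^sub>0 nat)) mpol" where "g a = var (False, a)"
definition h :: "(nat \<Rightarrow>\<^sub>0 nat) \<Rightarrow> (bool \<times> (nat \<Rightarrow>\<^sub>0 nat)) mpol" where "h a = var (True, a)"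
definition c :: "(nat \<Rightarrow>\<^sub>0 nat) \<Rightarrow> (bool \<times> (nat \<Rightarrow>\<^sub>0 nat)) mpol" where "c = prod_coeff S g h"

text \<open>Bidegree \<open>(m, m)\<close>, one equation for each factor. These monomials are the
  invariants of scaling \<open>g\<close> by a number and \<open>h\<close> by its inverse, which does
  not change \<open>g h\<close>.\<close>

definition Mon :: "nat \<Rightarrow> ((bool \<times> (nat \<Rightarrow>\<^sub>0 nat)) \<Rightarrow>\<^sub>0 nat) set" where
  "Mon m = {a. keys a \<subseteq> UNIV \<times> S \<and>
     (\<forall>s. (\<Sum>i\<in>S. lookup a (s, i)) = m)}"

lemma finite_S: "finite S" and finite_X: "finite X"
  by (simp_all add: S_def X_def finite_monoms)

lemma add_mem_X: "a \<in> S \<Longrightarrow> b \<in> S \<Longrightarrow> a + b \<in> X"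
  by (simp add: S_def X_def forms_add_mem)

lemma Mon_add_iff': "e \<in> Mon k \<Longrightarrow> e + b \<in> Mon (k + m) \<longleftrightarrow> b \<in> Mon m"
proof -
  assume e: "e \<in> Mon k"
  have "keys (e + b) = keys e \<union> keys b"
    by (auto simp: in_keys_iff lookup_add)
  then show ?thesis using e by (auto simp: Mon_def lookup_add sum.distrib)
qed

lemma Mon_subset: "Mon m \<subseteq> monoms (UNIV \<times> S) (2 * m)"
proof
  fix a assume a: "a \<in> Mon m"
  have "(\<Sum>p\<in>UNIV \<times> S. lookup a p) = (\<Sum>s\<in>UNIV. \<Sum>i\<in>S. lookup a (s, i))"
    by (simp add: sum.cartesian_product)
  then show "a \<in> monoms (UNIV \<times> S) (2 * m)"
    using a finite_S by (auto simp: Mon_def mem_monoms_iff)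
qed

lemma pair_in_Mon:
  assumes "a \<in> S" "b \<in> S"
  shows "single (False, a) 1 + single (True, b) 1 \<in> Mon 1"
proof -
  have "(\<Sum>i\<in>S. lookup (single (False, a) 1 + single (True, b) 1) (s, i)) = (1::nat)" for s
    using assms finite_S by (cases s) (simp_all add: lookup_add lookup_single when_def)
  then show ?thesis
    using assms keys_add[of "single (False, a) (1::nat)" "single (True, b) 1"]
    by (auto simp: Mon_def)
qed

lemma Mon_Suc_split:
  assumes "a \<in> Mon (Suc m)"
  shows "\<exists>i\<in>S. \<exists>j\<in>S. \<exists>b\<in>Mon m.
    a = single (False, i) 1 + single (True, j) 1 + b"
proof -
  have ex: "\<exists>i\<in>S. lookup a (s, i) > 0" for s
  proof (rule ccontr)
    assume "\<not> ?thesis"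
    then have "(\<Sum>i\<in>S. lookup a (s, i)) = 0" by auto
    then show False using assms by (simp add: Mon_def)
  qed
  obtain i j where ij: "i \<in> S" "lookup a (False, i) > 0" "j \<in> S" "lookup a (True, j) > 0"
    using ex by metis
  let ?e = "single (False, i) 1 + single (True, j) 1"
  have eq: "a = ?e + (a - ?e)"
    using ij by (intro poly_mapping_eqI) (auto simp: lookup_add lookup_minus lookup_single when_def)
  have "?e + (a - ?e) \<in> Mon (1 + m)" using assms eq by simp
  then have "a - ?e \<in> Mon m" using Mon_add_iff'[OF pair_in_Mon] ij by blast
  then show ?thesis using ij eq by blast
qed

lemma g_mult_h: "g a * h b = single (single (False, a) 1 + single (True, b) 1) 1"
  by (simp add: g_def h_def mult_single)

sublocale graded_param X c Mon
proof
  show "finite X" by (rule finite_X)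
  show "finite (Mon m)" for m
    using finite_subset[OF Mon_subset] finite_S by (simp add: finite_monoms)
  show "Mon 0 = {0}"
    using Mon_subset[of 0] by (auto simp: monoms_0 Mon_def)
  show "\<exists>e\<in>Mon 1. \<exists>b\<in>Mon m. a = e + b" if "a \<in> Mon (Suc m)" for a m
    using Mon_Suc_split[OF that] pair_in_Mon by blast
  show "e + b \<in> Mon (k + m) \<longleftrightarrow> b \<in> Mon m" if "e \<in> Mon k" for e b k m
    by (rule Mon_add_iff'[OF that])
  show "c i \<in> coord_space (Mon 1)" if "i \<in> X" for i
    unfolding c_def using pair_in_Mon
    by (intro prod_coeff_in_subspace[OF coord_space_subspace]) (auto simp: g_mult_h coord_space_def)
  show "\<exists>K. single e 1 ^ K \<in> rideal.span (c ` X)" if e: "e \<in> Mon 1" for e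
  proof -
    obtain i j b where ij: "i \<in> S" "j \<in> S" "b \<in> Mon 0"
      "e = single (False, i) 1 + single (True, j) 1 + b"
      using Mon_Suc_split[of e 0] e by auto
    then have "single e 1 = g i * h j"
      using Mon_subset[of 0] by (auto simp: monoms_0 g_mult_h)
    then show ?thesis
      using prod_coeff_nilpotent[OF finite_S add_mem_X ij(1,2), where g = g and h = h]
      by (simp add: c_def)
  qed
qed

lemma hilbert_function_eq:
  "hilbert_function X (SOS n d 2) m = cvs.dim (cmon c ` monoms X m)"
  unfolding SOS_def X_def[symmetric]
proof (rule hilbert_function_parametrized[OF finite_X, of "UNIV \<times> S"])
  let ?Z = "{\<Sum>i<2. f i ^ 2 |f. \<forall>i<(2::nat). f i \<in> forms {..n} d}"
  have forms: "forms {..n} d = coord_space S" by (simp add: forms_def S_def)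
  have prod: "lookup (p * q) \<gamma> = mpol_eval (c \<gamma>) v"
    if "p \<in> coord_space S" "q \<in> coord_space S"
      "\<And>a. a \<in> S \<Longrightarrow> lookup v (False, a) = lookup p a"
      "\<And>a. a \<in> S \<Longrightarrow> lookup v (True, a) = lookup q a" for p q v \<gamma>
  proof -
    have "mpol_eval (c \<gamma>) v = prod_coeff S (\<lambda>a. mpol_eval (g a) v) (\<lambda>a. mpol_eval (h a) v) \<gamma>"
      by (simp only: c_def mpol_eval_prod_coeff)
    also have "\<dots> = prod_coeff S (lookup p) (lookup q) \<gamma>"
      unfolding prod_coeff_def using that(3,4) by (intro sum.cong) (auto simp: g_def h_def)
    finally show ?thesis by (simp only: lookup_mult_forms[OF finite_S that(1,2)])
  qed
  show "finite ((UNIV :: bool set) \<times> S)" using finite_S by simp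
  show "c i \<in> polys (UNIV \<times> S)" for i
    unfolding c_def prod_coeff_def
    by (rule polys_sum) (auto simp: g_def h_def intro!: polys_mult polys_single)
  have prod_coord: "p * q \<in> coord_space X" if "p \<in> coord_space S" "q \<in> coord_space S" for p q
    using keys_mult[of p q] add_mem_X that by (fastforce simp: coord_space_def)
  show "?Z \<subseteq> coord_space X"
  proof clarify
    fix f :: "nat \<Rightarrow> nat mpol" assume "\<forall>i<2. f i \<in> forms {..n} d"
    then show "(\<Sum>i<2. f i ^ 2) \<in> coord_space X"
      using prod_coord by (intro cvs.subspace_sum[OF coord_space_subspace]) (auto simp: forms power2_eq_square)
  qed
  show "\<exists>s\<in>?Z. \<forall>i\<in>X. lookup s i = mpol_eval (c i) v" for v
  proof -
    define q where "q s = (\<Sum>a\<in>S. single a (lookup v (s, a)))" for s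
    have q: "q s \<in> coord_space S" for s
      unfolding q_def by (rule cvs.subspace_sum[OF coord_space_subspace]) (simp add: coord_space_def)
    have lq: "lookup (q s) a = lookup v (s, a)" if "a \<in> S" for s a
      using that finite_S by (simp add: q_def lookup_sum lookup_single when_def)
    have "q False * q True \<in> ?Z"
      unfolding forms using product_eq_sum_of_two_squares[OF coord_space_subspace q q] by blast
    moreover have "\<forall>i\<in>X. lookup (q False * q True) i = mpol_eval (c i) v"
      using prod[OF q q] lq by simp
    ultimately show ?thesis by (rule bexI[rotated])
  qed
  show "\<exists>v. keys v \<subseteq> UNIV \<times> S \<and> (\<forall>i\<in>X. lookup s i = mpol_eval (c i) v)"
    if sZ: "s \<in> ?Z" for s
  proof -
    obtain f :: "nat \<Rightarrow> nat mpol" where f': "s = (\<Sum>i<2. f i ^ 2)" "\<forall>i<2. f i \<in> forms {..n} d"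
      using sZ by blast
    then have f: "s = (\<Sum>i<2. f i ^ 2)" "f 0 \<in> coord_space S" "f 1 \<in> coord_space S"
      by (auto simp: forms)
    define q where "q b = (if b then f 0 - cscale \<i> (f 1) else f 0 + cscale \<i> (f 1))" for b
    have q: "q b \<in> coord_space S" for b
      unfolding q_def using f(2,3)
        cvs.subspace_add[OF coord_space_subspace f(2) cvs.subspace_scale[OF coord_space_subspace f(3)]]
        cvs.subspace_diff[OF coord_space_subspace f(2) cvs.subspace_scale[OF coord_space_subspace f(3)]]
      by simp
    have "single 0 \<i> * single 0 \<i> = (- 1 :: nat mpol)"
      by (simp add: mult_single single_uminus flip: single_one)
    then have "q False * q True = f 0 ^ 2 + f 1 ^ 2"
      by (simp add: q_def cscale_eq_mult power2_eq_square algebra_simps) (simp flip: mult.assoc)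
    then have s: "s = q False * q True" using f(1) by (simp add: numeral_2_eq_2)
    define v where "v = (\<Sum>p\<in>UNIV \<times> S. single p (lookup (q (fst p)) (snd p)))"
    have lv: "lookup v (b, a) = lookup (q b) a" if "a \<in> S" for b a
      using that finite_S by (simp add: v_def lookup_sum lookup_single when_def)
    have "v \<in> coord_space (UNIV \<times> S)"
      unfolding v_def by (rule cvs.subspace_sum[OF coord_space_subspace]) (auto simp: coord_space_def)
    then show ?thesis
      using prod[OF q q, of v] lv s by (auto simp: coord_space_def)
  qed
qed

text \<open>Spans the part of bidegree \<open>(m, m)\<close> fixed by exchanging \<open>g\<close>
  and \<open>h\<close>. For \<open>\<alpha> = \<beta>\<close> the element is twice a monomial, hence
  the halving below.\<close>

definition Sym :: "nat \<Rightarrow> (bool \<times> (nat \<Rightarrow>\<^sub>0 nat)) mpol set" where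
  "Sym m = (\<lambda>(\<alpha>, \<beta>). cmon g \<alpha> * cmon h \<beta> + cmon g \<beta> * cmon h \<alpha>) ` (monoms S m \<times> monoms S m)"

lemma Sym_mult:
  assumes "x \<in> cvs.span (Sym k)" "y \<in> cvs.span (Sym m)"
  shows "x * y \<in> cvs.span (Sym (k + m))"
proof -
  have "{s * t |s t. s \<in> Sym k \<and> t \<in> Sym m} \<subseteq> cvs.span (Sym (k + m))"
  proof clarify
    fix s t assume "s \<in> Sym k" "t \<in> Sym m"
    then obtain \<alpha> \<beta> \<alpha>' \<beta>' where
      m: "\<alpha> \<in> monoms S k" "\<beta> \<in> monoms S k" "\<alpha>' \<in> monoms S m" "\<beta>' \<in> monoms S m" and
      s: "s = cmon g \<alpha> * cmon h \<beta> + cmon g \<beta> * cmon h \<alpha>" and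
      t: "t = cmon g \<alpha>' * cmon h \<beta>' + cmon g \<beta>' * cmon h \<alpha>'"
      unfolding Sym_def by auto
    have mem: "cmon g \<mu> * cmon h \<nu> + cmon g \<nu> * cmon h \<mu> \<in> cvs.span (Sym (k + m))"
      if "\<mu> \<in> monoms S (k + m)" "\<nu> \<in> monoms S (k + m)" for \<mu> \<nu>
      using that by (intro cvs.span_base) (auto simp: Sym_def)
    have "s * t = (cmon g (\<alpha> + \<alpha>') * cmon h (\<beta> + \<beta>') + cmon g (\<beta> + \<beta>') * cmon h (\<alpha> + \<alpha>'))
        + (cmon g (\<alpha> + \<beta>') * cmon h (\<beta> + \<alpha>') + cmon g (\<beta> + \<alpha>') * cmon h (\<alpha> + \<beta>'))"
      by (simp add: s t cmon_add algebra_simps)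
    also have "\<dots> \<in> cvs.span (Sym (k + m))"
      using m monoms_add[OF finite_S] by (intro cvs.span_add mem) auto
    finally show "s * t \<in> cvs.span (Sym (k + m))" .
  qed
  then have "cvs.span {s * t |s t. s \<in> Sym k \<and> t \<in> Sym m} \<subseteq> cvs.span (Sym (k + m))"
    by (rule cvs.span_minimal) simp
  then show ?thesis using cvs_span_mult[OF assms] by blast
qed

lemma half_sum: "x = cscale (1/2) (x + x)"
  by (rule poly_mapping_eqI) (simp add: lookup_add)

lemma c_in_Sym: "c \<gamma> \<in> cvs.span (Sym 1)"
proof -
  have "c \<gamma> + c \<gamma> = (\<Sum>(a, b)\<in>{(a, b) \<in> S \<times> S. a + b = \<gamma>}. g a * h b + g b * h a)"
    unfolding c_def by (subst (2) prod_coeff_commute)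
      (simp add: prod_coeff_def case_prod_unfold mult.commute flip: sum.distrib)
  also have "\<dots> \<in> cvs.span (Sym 1)"
  proof (rule cvs.span_sum, clarify)
    fix a b assume "a \<in> S" "b \<in> S"
    then have "cmon g (single a 1) * cmon h (single b 1)
        + cmon g (single b 1) * cmon h (single a 1) \<in> Sym 1"
      unfolding Sym_def by (intro image_eqI[of _ _ "(single a 1, single b 1)"])
        (auto simp: monoms_single)
    then show "g a * h b + g b * h a \<in> cvs.span (Sym 1)" by (intro cvs.span_base) simp
  qed
  finally show ?thesis by (subst half_sum) (rule cvs.span_scale)
qed

text \<open>Exchanging \<open>\<alpha>\<close> and \<open>\<beta>\<close> gives the same element of
  \<open>Sym m\<close>, so the pairs with \<open>\<alpha> \<le> \<beta>\<close> already index a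
  spanning set.\<close>

lemma hilbert_function_le:
  "2 * cvs.dim (cmon c ` monoms X m) \<le> card (monoms S m) * (card (monoms S m) + 1)"
proof -
  have "1 \<in> cvs.span (Sym 0)"
    by (subst half_sum, intro cvs.span_scale cvs.span_base) (simp add: Sym_def monoms_0)
  then have "cmon c a \<in> cvs.span (Sym m)" if "a \<in> monoms X m" for a
    using cmon_graded[where W = "\<lambda>m. cvs.span (Sym m)", OF _ Sym_mult that] c_in_Sym by blast
  moreover define E where "E = {(\<alpha>, \<beta>) \<in> monoms S m \<times> monoms S m. \<alpha> \<le> \<beta>}"
  define \<sigma> where "\<sigma> = (\<lambda>(\<alpha>, \<beta>). cmon g \<alpha> * cmon h \<beta> + cmon g \<beta> * cmon h \<alpha>)"
  have "Sym m \<subseteq> \<sigma> ` E"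
  proof
    fix x assume "x \<in> Sym m"
    then obtain \<alpha> \<beta> where x: "\<alpha> \<in> monoms S m" "\<beta> \<in> monoms S m" "x = \<sigma> (\<alpha>, \<beta>)"
      by (auto simp: Sym_def \<sigma>_def)
    moreover have "\<sigma> (\<alpha>, \<beta>) = \<sigma> (\<beta>, \<alpha>)" by (simp add: \<sigma>_def add.commute)
    ultimately show "x \<in> \<sigma> ` E" using linear[of \<alpha> \<beta>] by (fastforce simp: E_def)
  qed
  moreover have fin: "finite E"
    by (rule finite_subset[of _ "monoms S m \<times> monoms S m"]) (auto simp: E_def finite_monoms[OF finite_S])
  ultimately have "cvs.dim (cmon c ` monoms X m) \<le> card (\<sigma> ` E)"
    using cvs.span_mono[of "Sym m" "\<sigma> ` E"] by (intro cvs.dim_le_card) auto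
  also have "\<dots> \<le> card E" by (rule card_image_le[OF fin])
  finally show ?thesis
    using card_ordered_pairs[OF finite_monoms[OF finite_S, of m]] by (simp add: E_def)
qed

lemma card_Mon_ge: "card (monoms S m) * card (monoms S m) \<le> card (Mon m)"
proof -
  define tag where "tag s \<alpha> = (\<Sum>i\<in>S. single (s, i) (lookup \<alpha> i))"
    for s :: bool and \<alpha> :: "(nat \<Rightarrow>\<^sub>0 nat) \<Rightarrow>\<^sub>0 nat"
  have tag: "lookup (tag s \<alpha>) (s', i) = (if s = s' \<and> i \<in> S then lookup \<alpha> i else 0)" for s \<alpha> s' i
    using finite_S by (auto simp: tag_def lookup_sum lookup_single when_def)
  let ?f = "\<lambda>(\<alpha>, \<beta>). tag False \<alpha> + tag True \<beta>"
  have "inj_on ?f (monoms S m \<times> monoms S m)"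
  proof (rule inj_onI, clarify)
    fix \<alpha> \<beta> \<alpha>' \<beta>'
    assume m: "\<alpha> \<in> monoms S m" "\<beta> \<in> monoms S m" "\<alpha>' \<in> monoms S m" "\<beta>' \<in> monoms S m"
      and eq: "tag False \<alpha> + tag True \<beta> = tag False \<alpha>' + tag True \<beta>'"
    have l: "lookup \<alpha> i = lookup \<alpha>' i \<and> lookup \<beta> i = lookup \<beta>' i" if "i \<in> S" for i
      using arg_cong[OF eq, of "\<lambda>p. lookup p (False, i)"]
        arg_cong[OF eq, of "\<lambda>p. lookup p (True, i)"] that by (simp add: lookup_add tag)
    have ext: "\<mu> = \<nu>" if "\<mu> \<in> monoms S m" "\<nu> \<in> monoms S m"
      "\<And>i. i \<in> S \<Longrightarrow> lookup \<mu> i = lookup \<nu> i" for \<mu> \<nu>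
    proof (rule poly_mapping_eqI)
      fix i
      show "lookup \<mu> i = lookup \<nu> i"
      proof (cases "i \<in> S")
        case False
        then have "i \<notin> keys \<mu>" "i \<notin> keys \<nu>" using that(1,2) by (auto simp: monoms_def)
        then show ?thesis by (simp add: in_keys_iff)
      qed (rule that(3))
    qed
    show "\<alpha> = \<alpha>' \<and> \<beta> = \<beta>'" using ext[OF m(1,3)] ext[OF m(2,4)] l by blast
  qed
  moreover have "?f ` (monoms S m \<times> monoms S m) \<subseteq> Mon m"
  proof clarify
    fix \<alpha> \<beta> assume m: "\<alpha> \<in> monoms S m" "\<beta> \<in> monoms S m"
    have "(\<Sum>i\<in>S. lookup (tag False \<alpha> + tag True \<beta>) (s, i)) = m" for s
      using m by (cases s) (auto simp: lookup_add tag mem_monoms_iff[OF finite_S])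
    moreover have "keys (tag False \<alpha> + tag True \<beta>) \<subseteq> UNIV \<times> S"
      by (auto simp: in_keys_iff lookup_add tag split: if_splits)
    ultimately show "tag False \<alpha> + tag True \<beta> \<in> Mon m" by (simp add: Mon_def)
  qed
  ultimately show ?thesis
    using card_inj_on_le[of ?f "monoms S m \<times> monoms S m" "Mon m"] finite_Mon
    by (simp add: card_cartesian_product)
qed

text \<open>Equal degrees in the two factors pair each occurrence of \<open>var (s, b)\<close> with
  a variable of the other factor.\<close>

lemma Mon_supported:
  assumes a: "a \<in> Mon m" and keys: "keys a \<subseteq> {(s, b), (\<not> s, x), (\<not> s, y)}"
    and S: "b \<in> S" "x \<in> S" "y \<in> S" "x \<noteq> y"
  shows "\<exists>i j. i + j = m \<and> single a 1 = (var (s, b) * var (\<not> s, x)) ^ i * (var (s, b) * var (\<not> s, y)) ^ j"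
proof -
  have zero: "lookup a p = 0" if "p \<notin> {(s, b), (\<not> s, x), (\<not> s, y)}" for p
  proof -
    have "p \<notin> keys a" using keys that by blast
    then show ?thesis by (simp add: in_keys_iff)
  qed
  let ?i = "lookup a (\<not> s, x)" and ?j = "lookup a (\<not> s, y)"
  have "m = (\<Sum>k\<in>S. lookup a (s, k))" using a by (simp add: Mon_def)
  also have "\<dots> = (\<Sum>k\<in>{b}. lookup a (s, k))"
    using S finite_S zero by (intro sum.mono_neutral_right) auto
  finally have b: "lookup a (s, b) = m" by simp
  have "m = (\<Sum>k\<in>S. lookup a (\<not> s, k))" using a by (simp add: Mon_def)
  also have "\<dots> = (\<Sum>k\<in>{x, y}. lookup a (\<not> s, k))"
    using S finite_S zero by (intro sum.mono_neutral_right) auto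
  finally have xy: "?i + ?j = m" using S by simp
  have "single a 1 = cmon var a" by (rule single_eq_cmon)
  also have "\<dots> = (\<Prod>p\<in>{(s, b), (\<not> s, x), (\<not> s, y)}. var p ^ lookup a p)"
    using keys by (intro cmon_superset) auto
  also have "\<dots> = var (s, b) ^ (?i + ?j) * (var (\<not> s, x) ^ ?i * var (\<not> s, y) ^ ?j)"
    using S b xy by simp
  also have "\<dots> = (var (s, b) * var (\<not> s, x)) ^ ?i * (var (s, b) * var (\<not> s, y)) ^ ?j"
    by (simp only: power_add power_mult_distrib mult_ac)
  finally show ?thesis using xy by blast
qed

text \<open>Chinese remaindering over the two orderings of the factors. Modulo \<open>N1\<close>,
  and likewise modulo \<open>N2\<close>, a monomial in \<open>Mon m\<close> becomes zero or a
  product of \<open>c (b + x1)\<close> and \<open>c (b + x2)\<close>, hence an element of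
  \<open>A\<close>. The generator \<open>g b * h x1\<close> separates the two: it is congruent to
  \<open>c (b + x1)\<close> modulo \<open>N1\<close> and to zero modulo \<open>N2\<close>.\<close>

lemma local_generators:
  assumes n: "n \<ge> 2" and d: "d \<ge> 1" and m: "m \<ge> 1" and a: "a \<in> Mon m"
  defines "b \<equiv> exp_b d" and "x1 \<equiv> exp_a1 d" and "x2 \<equiv> exp_a2 d"
  defines "N1 \<equiv> rideal.span (g ` (S - {b}) \<union> h ` (S - {x1, x2}))"
    and "N2 \<equiv> rideal.span (h ` (S - {b}) \<union> g ` (S - {x1, x2}))"
  shows "\<exists>\<alpha>\<in>A m. \<exists>\<beta>\<in>A m. \<exists>\<rho>\<in>N1 \<inter> N2.
    c (b + x1) * single a 1 = c (b + x1) * \<alpha> + g b * h x1 * \<beta> + \<rho>"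
proof -
  have mem: "b \<in> S" "x1 \<in> S" "x2 \<in> S"
    using exps_mem_monoms[OF n d] by (simp_all add: b_def x1_def x2_def S_def)
  have neq: "b \<noteq> x1" "b \<noteq> x2" "x1 \<noteq> x2"
    using exps_distinct[OF d] by (simp_all add: b_def x1_def x2_def)
  let ?\<mu> = "single a (1::complex)"
  have sN: "rideal.subspace N1" "rideal.subspace N2" by (simp_all add: N1_def N2_def)
  have gN1: "g u \<in> N1" "h u \<in> N2" if "u \<in> S - {b}" for u
    using that by (auto simp: N1_def N2_def intro!: rideal.span_base)
  have hN1: "h u \<in> N1" "g u \<in> N2" if "u \<in> S - {x1, x2}" for u
    using that by (auto simp: N1_def N2_def intro!: rideal.span_base)
  have cN1: "c (b + x) - g b * h x \<in> N1" if "x \<in> S" for x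
    unfolding c_def using gN1 that by (intro prod_coeff_leading[OF sN(1) finite_S mem(1)])
  have cN2: "c (b + x) - h b * g x \<in> N2" if "x \<in> S" for x
    unfolding c_def prod_coeff_commute[of S g h] using gN1 that
    by (intro prod_coeff_leading[OF sN(2) finite_S mem(1)])
  have w1N2: "g b * h x \<in> N2" if "x \<in> {x1, x2}" for x
    using that gN1(2)[of x] mem neq rideal.subspace_scale[OF sN(2)] by auto
  have w2N1: "h b * g x \<in> N1" if "x \<in> {x1, x2}" for x
    using that gN1(1)[of x] mem neq rideal.subspace_scale[OF sN(1)] by auto
  have tA: "c (b + x) \<in> A 1" if "x \<in> S" for x
    using add_mem_X[OF mem(1) that] by (rule param_in_A)
  have ttA: "c (b + x1) ^ i * c (b + x2) ^ j \<in> A m" if "i + j = m" for i j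
    using A_mult[OF A_power[OF tA[OF mem(2)], of i] A_power[OF tA[OF mem(3)], of j]] that by simp
  consider (1) "keys a \<subseteq> {(False, b), (True, x1), (True, x2)}"
    | (2) "keys a \<subseteq> {(True, b), (False, x1), (False, x2)}"
    | (3) "\<not> keys a \<subseteq> {(False, b), (True, x1), (True, x2)}"
      "\<not> keys a \<subseteq> {(True, b), (False, x1), (False, x2)}" by blast
  then show ?thesis
  proof cases
    case 1
    obtain i j where ij: "i + j = m" "?\<mu> = (g b * h x1) ^ i * (g b * h x2) ^ j"
      using Mon_supported[OF a, of False b x1 x2] 1 mem neq by (auto simp: g_def h_def)
    let ?\<beta> = "c (b + x1) ^ i * c (b + x2) ^ j"
    have "c (b + x1) * ?\<mu> - g b * h x1 * ?\<beta> \<in> N1"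
    proof -
      have "c (b + x1) * ?\<mu> - c (b + x1) * ?\<beta> \<in> N1"
        unfolding right_diff_distrib[symmetric] ij(2)
        using rideal.subspace_neg[OF sN(1) rideal_cong_mult[OF sN(1)
            rideal_cong_power[OF sN(1) cN1[OF mem(2)], of i] rideal_cong_power[OF sN(1) cN1[OF mem(3)], of j]]]
        by (intro rideal.subspace_scale[OF sN(1)]) simp
      moreover have "c (b + x1) * ?\<beta> - g b * h x1 * ?\<beta> \<in> N1"
        unfolding left_diff_distrib[symmetric] by (rule rideal_mult_right[OF sN(1) cN1[OF mem(2)]])
      ultimately show ?thesis using rideal.subspace_add[OF sN(1)] by fastforce
    qed
    moreover have "c (b + x1) * ?\<mu> - g b * h x1 * ?\<beta> \<in> N2"
    proof -
      have "?\<mu> \<in> N2" unfolding ij(2) using ij(1) m w1N2 by (intro rideal_power_mult[OF sN(2)]) auto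
      then show ?thesis
        by (intro rideal.subspace_diff[OF sN(2) rideal.subspace_scale[OF sN(2)]]
          rideal_mult_right[OF sN(2) w1N2]) auto
    qed
    ultimately show ?thesis
      using ttA[OF ij(1)] cvs.subspace_0[OF A_subspace]
      by (intro bexI[of _ 0] bexI[of _ ?\<beta>] bexI[of _ "c (b + x1) * ?\<mu> - g b * h x1 * ?\<beta>"]) auto
  next
    \<comment> \<open>Now \<open>?\<mu>\<close> is congruent to \<open>?\<beta>\<close> modulo
      \<open>N2\<close> and zero modulo \<open>N1\<close>. The two generators agree modulo
      \<open>N1\<close>, so they are taken with opposite coefficients.\<close>
    case 2
    obtain i j where ij: "i + j = m" "?\<mu> = (h b * g x1) ^ i * (h b * g x2) ^ j"
      using Mon_supported[OF a, of True b x1 x2] 2 mem neq by (auto simp: g_def h_def)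
    let ?\<beta> = "c (b + x1) ^ i * c (b + x2) ^ j"
    let ?\<rho> = "c (b + x1) * (?\<mu> - ?\<beta>) + g b * h x1 * ?\<beta>"
    have "?\<rho> \<in> N2"
    proof (rule rideal.subspace_add[OF sN(2)])
      show "c (b + x1) * (?\<mu> - ?\<beta>) \<in> N2"
        unfolding ij(2)
        using rideal.subspace_neg[OF sN(2) rideal_cong_mult[OF sN(2)
            rideal_cong_power[OF sN(2) cN2[OF mem(2)], of i] rideal_cong_power[OF sN(2) cN2[OF mem(3)], of j]]]
        by (intro rideal.subspace_scale[OF sN(2)]) simp
      show "g b * h x1 * ?\<beta> \<in> N2" by (rule rideal_mult_right[OF sN(2) w1N2]) simp
    qed
    moreover have "?\<rho> \<in> N1"
    proof -
      have "?\<mu> \<in> N1" unfolding ij(2) using ij(1) m w2N1 by (intro rideal_power_mult[OF sN(1)]) auto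
      then have "c (b + x1) * ?\<mu> \<in> N1" by (rule rideal.subspace_scale[OF sN(1)])
      moreover have "(c (b + x1) - g b * h x1) * ?\<beta> \<in> N1"
        by (rule rideal_mult_right[OF sN(1) cN1[OF mem(2)]])
      ultimately have "c (b + x1) * ?\<mu> - (c (b + x1) - g b * h x1) * ?\<beta> \<in> N1"
        by (rule rideal.subspace_diff[OF sN(1)])
      then show ?thesis by (simp only: left_diff_distrib right_diff_distrib diff_diff_eq2 diff_add_eq)
    qed
    moreover have "c (b + x1) * ?\<mu> = c (b + x1) * ?\<beta> + g b * h x1 * (- ?\<beta>) + ?\<rho>"
      by (simp add: right_diff_distrib)
    ultimately show ?thesis
      using ttA[OF ij(1)] cvs.subspace_neg[OF A_subspace ttA[OF ij(1)]] by blast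
  next
    case 3
    have keys: "keys a \<subseteq> UNIV \<times> S" using a by (simp add: Mon_def)
    have "?\<mu> \<in> N1"
    proof -
      obtain p where p: "p \<in> keys a" "p \<notin> {(False, b), (True, x1), (True, x2)}" using 3 by blast
      obtain s u where su: "p = (s, u)" by (cases p)
      have "u \<in> S" using p(1) su keys by blast
      then have "var p \<in> N1"
        using p(2) su gN1(1)[of u] hN1(1)[of u] by (cases s) (auto simp: g_def h_def)
      then show ?thesis by (rule single_in_rideal[OF sN(1) p(1)])
    qed
    moreover have "?\<mu> \<in> N2"
    proof -
      obtain p where p: "p \<in> keys a" "p \<notin> {(True, b), (False, x1), (False, x2)}" using 3 by blast
      obtain s u where su: "p = (s, u)" by (cases p)
      have "u \<in> S" using p(1) su keys by blast
      then have "var p \<in> N2"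
        using p(2) su gN1(2)[of u] hN1(2)[of u] by (cases s) (auto simp: g_def h_def)
      then show ?thesis by (rule single_in_rideal[OF sN(2) p(1)])
    qed
    ultimately show ?thesis
      using cvs.subspace_0[OF A_subspace] rideal.subspace_scale[OF sN(1)] rideal.subspace_scale[OF sN(2)]
      by (intro bexI[of _ 0] bexI[of _ "c (b + x1) * ?\<mu>"]) auto
  qed
qed

text \<open>The point \<open>v\<close> is the pair \<open>x0^d\<close>,
  \<open>x1^d + x0^(d-1) x2\<close>. \<open>T\<close> is the product of the two coefficients of
  \<open>g h\<close> that are nonzero there, as the saturation inverts both. Two generators match
  the two points \<open>(g, h)\<close> and \<open>(h, g)\<close> of the fibre.\<close>

lemma hilbert_function_ge:
  assumes n: "n \<ge> 2" and d: "d \<ge> 1"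
  shows "\<exists>e M. \<forall>m\<ge>M. card (monoms S (Suc m)) * card (monoms S (Suc m))
    \<le> 2 * cvs.dim (cmon c ` monoms X (m + e))"
proof -
  define b where "b = exp_b d"
  define x1 where "x1 = exp_a1 d"
  define x2 where "x2 = exp_a2 d"
  have mem: "b \<in> S" "x1 \<in> S" "x2 \<in> S"
    using exps_mem_monoms[OF n d] by (simp_all add: b_def x1_def x2_def S_def)
  have neq: "b \<noteq> x1" "b \<noteq> x2" "x1 \<noteq> x2"
    using exps_distinct[OF d] by (simp_all add: b_def x1_def x2_def)
  let ?t1 = "c (b + x1)" and ?t2 = "c (b + x2)"
  let ?T = "?t1 * ?t2" and ?Y = "X - {b + x1, b + x2}" and ?\<Delta> = "{?t1, g b * h x1}"
  define v where "v = single (False, b) (1::complex) + single (True, x1) 1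
    + single (True, x2) 1"
  have vF: "lookup v (False, u) = (if u = b then 1 else 0)"
    and vT: "lookup v (True, u) = (if u = x1 \<or> u = x2 then 1 else 0)" for u
    using neq by (auto simp: v_def lookup_add lookup_single when_def)
  have ev: "mpol_eval (c \<gamma>) v = prod_coeff S (\<lambda>u. if u = b then 1 else 0) (\<lambda>u. if u = x1 \<or> u = x2 then 1 else 0) \<gamma>" for \<gamma>
    by (simp add: c_def mpol_eval_prod_coeff g_def h_def vF vT)
  have ev1: "mpol_eval (c (b + x)) v = 1" if x: "x \<in> {x1, x2}" for x
  proof -
    have "x \<in> S" using x mem by auto
    then show ?thesis
      unfolding ev using x mem finite_S by (subst prod_coeff_unique_pair) auto
  qed
  have t: "?t1 \<in> A 1" "?t2 \<in> A 1"
    using param_in_A[OF add_mem_X] mem by blast+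
  have cX: "c i \<in> C 1" if "i \<in> X" for i using param[OF that] by (simp add: C_def)
  have w: "g b * h x1 \<in> C 1"
    using pair_in_Mon[OF mem(1,2)] by (simp add: C_def coord_space_def g_mult_h)
  have "\<exists>e M. \<forall>m\<ge>M. card (Mon (Suc m)) \<le> card ?\<Delta> * cvs.dim (cmon c ` monoms X (m + e))"
  proof (rule card_Mon_le[of ?Y v ?T 2])
    show "mpol_eval (c i) v = 0" if "i \<in> ?Y" for i
      unfolding ev prod_coeff_def using that by (intro sum.neutral) auto
    show "?T \<in> A 2" using A_mult[OF t] by (simp add: numeral_2_eq_2)
    show "mpol_eval ?T v \<noteq> 0" using ev1 by (simp add: mpol_eval_mult)
    show "?\<Delta> \<subseteq> C 1" using w cX add_mem_X mem by auto
    fix m a assume m: "m \<ge> 1" and a: "a \<in> Mon m"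
    let ?J = "rideal.span (c ` ?Y)" and ?\<mu> = "single a (1::complex)"
    have sJ: "rideal.subspace ?J" by simp
    obtain \<alpha> \<beta> \<rho> where \<rho>: "\<alpha> \<in> A m" "\<beta> \<in> A m"
      "\<rho> \<in> rideal.span (g ` (S - {b}) \<union> h ` (S - {x1, x2}))"
      "\<rho> \<in> rideal.span (h ` (S - {b}) \<union> g ` (S - {x1, x2}))"
      "?t1 * ?\<mu> = ?t1 * \<alpha> + g b * h x1 * \<beta> + \<rho>"
      using local_generators[OF n d m a] unfolding b_def x1_def x2_def by blast
    have J: "prod_coeff S g h \<gamma> \<in> ?J" if "\<gamma> \<notin> {b + x1, b + x2}" for \<gamma>
    proof (cases "\<gamma> \<in> X")
      case True
      then show ?thesis using that by (intro rideal.span_base) (auto simp: c_def)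
    next
      case False
      then have "prod_coeff S g h \<gamma> = 0" using add_mem_X by (intro prod_coeff_empty) auto
      then show ?thesis by (simp add: rideal.span_zero)
    qed
    obtain K where K: "?T ^ K * \<rho> \<in> ?J"
      using saturation_product[where n = n and g = g and h = h, OF n d sJ] J \<rho>(3,4)
      unfolding c_def b_def x1_def x2_def S_def by blast
    \<comment> \<open>Multiplying the relation for \<open>?t1 * ?\<mu>\<close> by
      \<open>?t2 * ?T ^ K\<close> completes \<open>?t1\<close> to \<open>?T ^ Suc K\<close>; the
      degree is \<open>1 + 2 * K + m\<close>.\<close>
    let ?q = "\<lambda>\<alpha>. ?t2 * ?T ^ K * \<alpha>"
    have TA: "?T \<in> A 2" using A_mult[OF t] by (simp add: numeral_2_eq_2)
    have q: "?q \<alpha> \<in> A (2 * Suc K + m - 1)" if "\<alpha> \<in> A m" for \<alpha>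
      using A_mult[OF A_mult[OF t(2) A_power[OF TA, of K]] that] by simp
    have D: "\<delta> * ?q \<alpha> \<in> D ?\<Delta> (2 * Suc K + m - 1)" if "\<delta> \<in> ?\<Delta>" "\<alpha> \<in> A m" for \<delta> \<alpha>
    proof -
      have "(\<Sum>\<delta>'\<in>?\<Delta>. \<delta>' * (if \<delta>' = \<delta> then ?q \<alpha> else 0)) = (\<Sum>\<delta>'\<in>?\<Delta>. if \<delta>' = \<delta> then \<delta>' * ?q \<alpha> else 0)"
        by (rule sum.cong) auto
      also have "\<dots> = \<delta> * ?q \<alpha>" using that(1) by (subst sum.delta) auto
      finally have "\<delta> * ?q \<alpha> = (\<Sum>\<delta>'\<in>?\<Delta>. \<delta>' * (if \<delta>' = \<delta> then ?q \<alpha> else 0))" ..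
      then show ?thesis
        unfolding D_def using q[OF that(2)] cvs.subspace_0[OF A_subspace]
        by (intro CollectI exI[of _ "\<lambda>\<delta>'. if \<delta>' = \<delta> then ?q \<alpha> else 0"]) auto
    qed
    have "?T ^ Suc K * ?\<mu> = ?t2 * ?T ^ K * (?t1 * ?\<mu>)" by (simp add: mult_ac)
    also have "\<dots> = (?t1 * ?q \<alpha> + g b * h x1 * ?q \<beta>) + ?t2 * (?T ^ K * \<rho>)"
      unfolding \<rho>(5) by (simp add: algebra_simps)
    finally have "?T ^ Suc K * ?\<mu> - (?t1 * ?q \<alpha> + g b * h x1 * ?q \<beta>) = ?t2 * (?T ^ K * \<rho>)" by simp
    also have "\<dots> \<in> ?J" by (rule rideal.subspace_scale[OF sJ K])
    finally have "?T ^ Suc K * ?\<mu> - (?t1 * ?q \<alpha> + g b * h x1 * ?q \<beta>) \<in> ?J" .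
    moreover have "?t1 * ?q \<alpha> + g b * h x1 * ?q \<beta> \<in> D ?\<Delta> (2 * Suc K + m - 1)"
      using \<rho>(1,2) by (intro D_add D) auto
    ultimately show "\<exists>K. \<exists>y\<in>D ?\<Delta> (2 * K + m - 1). ?T ^ K * ?\<mu> - y \<in> ?J" by blast
  qed auto
  then obtain e M where e: "\<And>m. m \<ge> M \<Longrightarrow>
    card (Mon (Suc m)) \<le> card ?\<Delta> * cvs.dim (cmon c ` monoms X (m + e))" by blast
  have "card ?\<Delta> \<le> 2" by (simp add: card_insert_if)
  then have "card (monoms S (Suc m)) * card (monoms S (Suc m)) \<le> 2 * cvs.dim (cmon c ` monoms X (m + e))"
    if "m \<ge> M" for m
    using card_Mon_ge[of "Suc m"] e[OF that] mult_le_mono1[of "card ?\<Delta>" 2 "cvs.dim (cmon c ` monoms X (m + e))"]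
    by linarith
  then show ?thesis by blast
qed

end

section \<open>Degrees\<close>

lemma poly_ge_lead_coeff:
  fixes p :: "'a::linordered_field poly"
  assumes "lead_coeff p > 0"
  shows "\<exists>b. \<forall>x\<ge>b. lead_coeff p \<le> poly p x"
  using assms
proof (induction p)
  case (pCons a p)
  show ?case
  proof (cases "p = 0")
    case True
    then show ?thesis by auto
  next
    case False
    then have l: "lead_coeff p > 0" using pCons.prems by simp
    then obtain b where b: "\<And>x. x \<ge> b \<Longrightarrow> lead_coeff p \<le> poly p x" using pCons.IH by blast
    define L where "L = lead_coeff p"
    have L: "L > 0" using l by (simp add: L_def)
    have "L \<le> a + x * poly p x" if x: "x \<ge> max b (1 + \<bar>a\<bar> / L)" for x
    proof -
      have "1 + \<bar>a\<bar> / L \<le> x" using x by simp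
      then have "(1 + \<bar>a\<bar> / L) * L \<le> x * L"
        using L by (intro mult_right_mono) auto
      moreover have "(1 + \<bar>a\<bar> / L) * L = L + \<bar>a\<bar>"
        using L by (simp add: distrib_right)
      moreover have "0 \<le> \<bar>a\<bar> / L" using L by simp
      then have "0 \<le> x" using x by simp
      then have "x * L \<le> x * poly p x" using b x by (intro mult_left_mono) (auto simp: L_def)
      ultimately show ?thesis by linarith
    qed
    then show ?thesis using False by (intro exI[of _ "max b (1 + \<bar>a\<bar> / L)"]) (auto simp: L_def)
  qed
qed simp

text \<open>The coefficient at \<open>r\<close> is the leading one or zero. Allowing any bound
  \<open>r\<close> on the degree permits comparisons before the degrees are known.\<close>

lemma coeff_nonneg_of_eventually_nonneg:
  fixes p :: "rat poly"
  assumes ev: "\<forall>\<^sub>F m in sequentially. 0 \<le> poly p (of_nat m)" and "degree p \<le> r"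
  shows "0 \<le> coeff p r"
proof (rule ccontr)
  assume neg: "\<not> 0 \<le> coeff p r"
  then have "degree p = r" using assms(2) le_degree[of p r] by auto
  then have l: "lead_coeff (- p) > 0" using neg by simp
  then obtain b where b: "\<And>x. x \<ge> b \<Longrightarrow> lead_coeff (- p) \<le> poly (- p) x"
    using poly_ge_lead_coeff by blast
  obtain k where k: "b \<le> of_nat k" using real_arch_simple by blast
  have "\<forall>\<^sub>F m in sequentially. poly p (of_nat m) < 0"
    using eventually_ge_at_top[of k]
  proof eventually_elim
    case (elim m)
    then have "b \<le> of_nat m" using k by (meson of_nat_le_iff order_trans)
    then show ?case using b[of "of_nat m"] l by simp
  qed
  then have "\<forall>\<^sub>F m :: nat in sequentially. False" using ev by eventually_elim simp
  then show False by simp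
qed

lemma poly_eq_of_eventually_eq:
  fixes p q :: "rat poly"
  assumes "\<forall>\<^sub>F m in sequentially. poly p (of_nat m) = poly q (of_nat m)"
  shows "p = q"
proof -
  have "\<forall>\<^sub>F m in sequentially. 0 \<le> poly (p - q) (of_nat m)"
    "\<forall>\<^sub>F m in sequentially. 0 \<le> poly (q - p) (of_nat m)"
    using assms by (auto elim: eventually_mono)
  then have "0 \<le> coeff (p - q) (degree (p - q))" "0 \<le> coeff (q - p) (degree (q - p))"
    using coeff_nonneg_of_eventually_nonneg[OF _ order_refl] by blast+
  moreover have "q - p = - (p - q)" by simp
  then have "coeff (q - p) (degree (q - p)) = - coeff (p - q) (degree (p - q))"
    by (metis coeff_minus degree_minus)
  ultimately have "lead_coeff (p - q) = 0" by simp
  then show ?thesis by (simp only: leading_coeff_0_iff right_minus_eq)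
qed

lemma degree_lead_coeff_shift:
  fixes p :: "rat poly"
  shows "degree (pcompose p [:a, 1:]) = degree p" "coeff (pcompose p [:a, 1:]) (degree p) = lead_coeff p"
proof -
  show "degree (pcompose p [:a, 1:]) = degree p" by (simp add: degree_pcompose)
  then show "coeff (pcompose p [:a, 1:]) (degree p) = lead_coeff p"
    using lead_coeff_comp[of "[:a, 1:]" p] by simp
qed

text \<open>Both inequalities are compared at the larger of the degrees of \<open>P\<close> and
  \<open>Q1\<close>; the shift by \<open>e\<close> changes neither degree nor leading
  coefficient.\<close>

lemma degree_lead_coeff_sandwich:
  fixes P Q1 Q2 :: "rat poly"
  assumes le: "\<forall>\<^sub>F m in sequentially. poly P (of_nat m) \<le> poly Q1 (of_nat m)"
    and ge: "\<forall>\<^sub>F m in sequentially. poly Q2 (of_nat m) \<le> poly P (of_nat (m + e))"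
    and Q: "degree Q1 = degree Q2" "lead_coeff Q1 = lead_coeff Q2" "Q1 \<noteq> 0"
  shows "degree P = degree Q1 \<and> lead_coeff P = lead_coeff Q1"
proof -
  let ?P = "pcompose P [:of_nat e, 1:]"
  define r where "r = max (degree P) (degree Q1)"
  have "0 \<le> coeff (Q1 - P) r"
    using le by (intro coeff_nonneg_of_eventually_nonneg degree_diff_le) (auto simp: r_def)
  moreover have "0 \<le> coeff (?P - Q2) r"
    using ge by (intro coeff_nonneg_of_eventually_nonneg degree_diff_le)
      (auto simp: r_def degree_lead_coeff_shift Q(1) poly_pcompose add.commute)
  moreover have "coeff ?P r = coeff P r"
    using degree_lead_coeff_shift[of P "of_nat e"]
    by (cases "r = degree P") (auto simp: coeff_eq_0 r_def)
  moreover have "coeff Q1 r = coeff Q2 r"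
    using Q by (cases "r = degree Q1") (auto simp: coeff_eq_0 r_def)
  ultimately have eq: "coeff P r = coeff Q1 r" by simp
  have "degree P \<le> degree Q1"
  proof (rule ccontr)
    assume "\<not> ?thesis"
    then have "r = degree P" "coeff Q1 r = 0" "P \<noteq> 0" by (auto simp: r_def coeff_eq_0)
    then show False using eq by simp
  qed
  then have r: "r = degree Q1" by (simp add: r_def)
  then have "coeff P r \<noteq> 0" using eq Q(3) by simp
  then have "degree P = degree Q1" using le_degree r \<open>degree P \<le> degree Q1\<close> by fastforce
  then show ?thesis using eq r by simp
qed

lemma hilbert_polynomial_eqI:
  assumes "\<forall>\<^sub>F m in sequentially. poly P (of_nat m) = of_nat (hilbert_function X Z m)"
  shows "hilbert_polynomial X Z = P"
  unfolding hilbert_polynomial_def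
proof (rule the_equality)
  show "\<forall>\<^sub>F m in sequentially. poly P (of_nat m) = of_nat (hilbert_function X Z m)" by (rule assms)
  fix Q :: "rat poly" assume "\<forall>\<^sub>F m in sequentially. poly Q (of_nat m) = of_nat (hilbert_function X Z m)"
  then have "\<forall>\<^sub>F m in sequentially. poly Q (of_nat m) = poly P (of_nat m)"
    using assms by eventually_elim simp
  then show "Q = P" by (rule poly_eq_of_eventually_eq)
qed

theorem proj_degree_sandwich:
  assumes ep: "eventually_poly (\<lambda>m. of_nat (hilbert_function X Z m))"
    and le: "\<forall>\<^sub>F m in sequentially. of_nat (hilbert_function X Z m) \<le> poly Q1 (of_nat m)"
    and ge: "\<forall>\<^sub>F m in sequentially. poly Q2 (of_nat m) \<le> of_nat (hilbert_function X Z (m + e))"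
    and Q: "degree Q1 = degree Q2" "lead_coeff Q1 = lead_coeff Q2" "Q1 \<noteq> 0"
  shows "proj_degree X Z = fact (degree Q1) * lead_coeff Q1"
proof -
  obtain P :: "rat poly" where P: "\<forall>\<^sub>F m in sequentially. poly P (of_nat m) = of_nat (hilbert_function X Z m)"
    using ep unfolding eventually_poly_def by blast
  have "\<forall>\<^sub>F m in sequentially. poly P (of_nat m) \<le> poly Q1 (of_nat m)"
    using P le by eventually_elim simp
  moreover have "\<forall>\<^sub>F m in sequentially. poly P (of_nat (m + e)) = of_nat (hilbert_function X Z (m + e))"
    using P by (rule eventually_compose_filterlim) (rule filterlim_add_const_nat_at_top)
  then have "\<forall>\<^sub>F m in sequentially. poly Q2 (of_nat m) \<le> poly P (of_nat (m + e))"
    using ge by eventually_elim simp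
  ultimately have dl: "degree P = degree Q1 \<and> lead_coeff P = lead_coeff Q1"
    by (rule degree_lead_coeff_sandwich[OF _ _ Q])
  then have "lead_coeff P = lead_coeff Q1" ..
  then show ?thesis
    unfolding proj_degree_def hilbert_polynomial_eqI[OF P] using dl by (simp only:)
qed

text \<open>The polynomial \<open>(x + 1) ... (x + k) / k!\<close>, which is the Hilbert polynomial
  of projective \<open>k\<close>-space.\<close>

primrec binomial_poly :: "nat \<Rightarrow> rat poly" where
  "binomial_poly 0 = 1"
| "binomial_poly (Suc k) = smult (1 / of_nat (Suc k)) (binomial_poly k * [:of_nat (Suc k), 1:])"

lemma poly_binomial_poly: "poly (binomial_poly k) (of_nat m) = of_nat ((m + k) choose k)"
proof (induction k)
  case (Suc k)
  have "of_nat (Suc k) * of_nat ((m + Suc k) choose Suc k) = (of_nat (Suc (m + k)) * of_nat ((m + k) choose k) :: rat)"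
    using Suc_times_binomial[of k "m + k"] by (simp only: add_Suc_right flip: of_nat_mult)
  then have "of_nat ((m + Suc k) choose Suc k) = (of_nat (Suc (m + k)) * of_nat ((m + k) choose k) / of_nat (Suc k) :: rat)"
    by (simp add: field_simps del: of_nat_Suc binomial_Suc_Suc)
  then show ?case by (simp add: Suc.IH field_simps)
qed simp

lemma binomial_poly_nz: "binomial_poly k \<noteq> 0"
proof (induction k)
  case (Suc k)
  have "[:of_nat (Suc k), 1:] \<noteq> (0 :: rat poly)" "1 / of_nat (Suc k) \<noteq> (0 :: rat)" by (simp_all del: of_nat_Suc)
  then show ?case using Suc.IH by (simp only: binomial_poly.simps smult_eq_0_iff mult_eq_0_iff simp_thms)
qed simp

lemma degree_binomial_poly: "degree (binomial_poly k) = k"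
proof (induction k)
  case (Suc k)
  have "degree (binomial_poly (Suc k)) = degree (binomial_poly k * [:of_nat (Suc k), 1:])"
    unfolding binomial_poly.simps by (subst degree_smult_eq) (simp del: of_nat_Suc)
  also have "\<dots> = degree (binomial_poly k) + degree [:of_nat (Suc k), 1 :: rat:]"
    by (rule degree_mult_eq[OF binomial_poly_nz]) simp
  finally show ?case using Suc.IH by simp
qed simp

lemma lead_coeff_binomial_poly: "lead_coeff (binomial_poly k) = 1 / fact k"
proof (induction k)
  case (Suc k)
  have "lead_coeff (binomial_poly (Suc k))
      = 1 / of_nat (Suc k) * (lead_coeff (binomial_poly k) * lead_coeff [:of_nat (Suc k), 1:])"
    unfolding binomial_poly.simps lead_coeff_smult lead_coeff_mult ..
  then show ?case by (simp only: Suc.IH fact_Suc) simp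
qed simp

lemma card_monoms_binomial_poly:
  assumes "finite S" "S \<noteq> {}"
  shows "of_nat (card (monoms S m)) = poly (binomial_poly (card S - 1)) (of_nat m)"
proof -
  have "card S \<noteq> 0" using assms by simp
  then obtain k where k: "card S = Suc k" by (cases "card S") auto
  have "card (monoms S m) = (m + k) choose k"
    using card_monoms[OF assms, of m] binomial_symmetric[of m "m + k"] k by simp
  then show ?thesis by (simp add: poly_binomial_poly k)
qed

section \<open>Cases in which the sums of two squares fill the space\<close>

lemma hilbert_function_whole_space:
  assumes "finite X"
  shows "hilbert_function X (coord_space X) m = card (monoms X m)"
proof -
  have "F = 0" if F: "F \<in> ideal_part X (coord_space X) m" for F
    using F forms_subset_polys[of X m]
    by (intro polys_subset_vanishing_imp_0[OF assms]) (auto simp: ideal_part_def coord_space_def)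
  then have "ideal_part X (coord_space X) m \<subseteq> cvs.span {}" unfolding cvs.span_empty by blast
  from cvs.dim_le_card[OF this] have "cvs.dim (ideal_part X (coord_space X) m) = 0" by simp
  then show ?thesis
    unfolding hilbert_function_def forms_def by (simp add: dim_coord_space finite_monoms[OF assms])
qed

lemma proj_degree_whole_space:
  assumes "finite X" "X \<noteq> {}"
  shows "proj_degree X (coord_space X) = 1"
proof -
  let ?Q = "binomial_poly (card X - 1)"
  have H: "of_nat (hilbert_function X (coord_space X) m) = poly ?Q (of_nat m)" for m
    by (simp add: hilbert_function_whole_space[OF assms(1)] card_monoms_binomial_poly[OF assms])
  have "proj_degree X (coord_space X) = fact (degree ?Q) * lead_coeff ?Q"
    by (rule proj_degree_sandwich[where e = 0]) (simp_all add: H eventually_poly_poly binomial_poly_nz)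
  then show ?thesis
    using lead_coeff_binomial_poly[of "card X - 1"] by (simp add: degree_binomial_poly)
qed

lemma zariski_closure_whole:
  assumes "coord_space X \<subseteq> S"
  shows "zariski_closure X S = coord_space X"
  using assms by (auto simp: zariski_closure_def)

lemma SOS_2_whole_space:
  assumes "\<And>p. p \<in> coord_space (monoms {..n} (2 * d)) \<Longrightarrow>
    \<exists>q r. q \<in> forms {..n} d \<and> r \<in> forms {..n} d \<and> p = q * r"
  shows "proj_degree (monoms {..n} (2 * d)) (SOS n d 2) = 1"
proof -
  have "coord_space (monoms {..n} (2 * d)) \<subseteq> {\<Sum>i<2. f i ^ 2 |f. \<forall>i<(2::nat). f i \<in> forms {..n} d}"
  proof
    fix p assume "p \<in> coord_space (monoms {..n} (2 * d))"
    then obtain q r where qr: "q \<in> forms {..n} d" "r \<in> forms {..n} d" "p = q * r" using assms by blast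
    have "cvs.subspace (forms {..n} d)" by (simp add: forms_def coord_space_subspace)
    then show "p \<in> {\<Sum>i<2. f i ^ 2 |f. \<forall>i<(2::nat). f i \<in> forms {..n} d}"
      using product_eq_sum_of_two_squares qr by blast
  qed
  then have "SOS n d 2 = coord_space (monoms {..n} (2 * d))"
    unfolding SOS_def by (rule zariski_closure_whole)
  moreover have "single 0 (2 * d) \<in> monoms {..n} (2 * d)" by (rule monoms_single) simp
  ultimately show ?thesis
    using proj_degree_whole_space[of "monoms {..n} (2 * d)"] by (auto simp: finite_monoms)
qed

lemma monoms_eq_singleton:
  assumes "n = 0 \<or> m = 0"
  shows "monoms {..(n::nat)} m = {single 0 m}"
proof -
  have "a = single 0 m" if a: "a \<in> monoms {..n} m" for a
  proof (cases "m = 0")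
    case True
    then show ?thesis using a by (simp add: monoms_0)
  next
    case False
    then show ?thesis using a assms
      by (intro monoms_eq_single[OF a]) (auto simp: monoms_def subset_iff in_keys_iff)
  qed
  then show ?thesis using monoms_single[of 0 "{..n}" m] by blast
qed

lemma SOS_2_degree_point:
  assumes "n = 0 \<or> d = 0"
  shows "proj_degree (monoms {..n} (2 * d)) (SOS n d 2) = 1"
proof (rule SOS_2_whole_space)
  fix p :: "nat mpol" assume p: "p \<in> coord_space (monoms {..n} (2 * d))"
  have "monoms {..n} (2 * d) = {single 0 (2 * d)}"
    using assms by (intro monoms_eq_singleton) auto
  then have "p = single (single 0 (2 * d)) (lookup p (single 0 (2 * d)))"
    using p by (intro poly_mapping_eqI) (auto simp: coord_space_def subset_iff in_keys_iff lookup_single when_def)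
  also have "\<dots> = single (single 0 d) (lookup p (single 0 (2 * d)))
      * single (single 0 d) 1"
    by (simp add: mult_single mult_2 flip: single_add)
  finally show "\<exists>q r. q \<in> forms {..n} d \<and> r \<in> forms {..n} d \<and> p = q * r"
    using monoms_single[of 0 "{..n}" d] by (intro exI conjI) (auto simp: forms_def coord_space_def)
qed

text \<open>A complex binary quadratic form factors by the quadratic formula, or has the factor
  \<open>x1\<close> if the coefficient \<open>a\<close> of \<open>x0^2\<close> vanishes.\<close>

lemma SOS_2_degree_binary_quadratic:
  "proj_degree (monoms {..1} (2 * 1)) (SOS 1 1 2) = 1"
proof (rule SOS_2_whole_space)
  fix p :: "nat mpol" assume p: "p \<in> coord_space (monoms {..1} (2 * 1))"
  let ?x = "single (0::nat) (1::nat)" and ?y = "single (1::nat) (1::nat)"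
  define a where "a = lookup p (?x + ?x)"
  define b where "b = lookup p (?x + ?y)"
  define e where "e = lookup p (?y + ?y)"
  have ne: "?x + ?x \<noteq> ?x + ?y" "?x + ?x \<noteq> ?y + ?y" "?x + ?y \<noteq> ?y + ?y"
    by (auto dest: arg_cong[where f = "\<lambda>q. lookup q 0"] simp: lookup_add lookup_single)
  have "lookup p k = 0" if "k \<notin> {?x + ?x, ?x + ?y, ?y + ?y}" for k
  proof (rule ccontr)
    assume "lookup p k \<noteq> 0"
    then have "k \<in> monoms {..1} 2" using p by (auto simp: coord_space_def in_keys_iff)
    then obtain i j where ij: "i \<in> {..1}" "j \<in> {..1}" "k = single i 1 + single j 1"
      using monoms_2_split[of k "{..1}"] by auto
    then have "i = 0 \<or> i = 1" "j = 0 \<or> j = 1" by auto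
    then show False using that ij(3) by (auto simp: add.commute)
  qed
  then have p_eq: "p = single (?x + ?x) a + single (?x + ?y) b + single (?y + ?y) e"
    using ne by (intro poly_mapping_eqI)
      (auto simp: lookup_add[of "_ :: nat mpol"] lookup_single when_def a_def b_def e_def)
  have lin: "single ?x s + single ?y t \<in> forms {..1} 1" for s t
  proof -
    have "single ?x s \<in> coord_space (monoms {..1} 1)" "single ?y t \<in> coord_space (monoms {..1} 1)"
      by (auto simp: coord_space_def intro!: monoms_single)
    then show ?thesis unfolding forms_def by (rule cvs.subspace_add[OF coord_space_subspace])
  qed
  have mult: "(single ?x s + single ?y t) * (single ?x u + single ?y w)
      = single (?x + ?x) (s * u) + single (?x + ?y) (s * w + t * u)
        + single (?y + ?y) (t * w)" for s t u w :: complex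
    by (simp add: distrib_left distrib_right mult_single add.commute[of ?y ?x] single_add ac_simps
        del: One_nat_def)
  have "\<exists>s t u w. s * u = a \<and> s * w + t * u = b \<and> t * w = e"
  proof (cases "a = 0")
    case True
    then show ?thesis by (intro exI[of _ 0] exI[of _ 1] exI[of _ b] exI[of _ e]) auto
  next
    case False
    define r where "r = csqrt (b\<^sup>2 - 4 * a * e)"
    have r: "r * r = b * b - 4 * a * e" by (simp add: r_def flip: power2_eq_square)
    have "(b - r) / 2 * ((b + r) / (2 * a)) = (b * b - r * r) / (4 * a)"
      using False by (simp add: field_simps)
    also have "\<dots> = e" using False by (simp add: r)
    finally have "(b - r) / 2 * ((b + r) / (2 * a)) = e" .
    moreover have "a * ((b + r) / (2 * a)) + (b - r) / 2 * 1 = b"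
      using False by (simp add: field_simps)
    ultimately show ?thesis
      by (intro exI[of _ a] exI[of _ "(b - r) / 2"] exI[of _ 1] exI[of _ "(b + r) / (2 * a)"]) auto
  qed
  then obtain s t u w where "s * u = a" "s * w + t * u = b" "t * w = e" by blast
  then have "p = (single ?x s + single ?y t) * (single ?x u + single ?y w)"
    unfolding mult p_eq by simp
  then show "\<exists>q r. q \<in> forms {..1} 1 \<and> r \<in> forms {..1} 1 \<and> p = q * r" using lin by blast
qed

lemma SOS_1_degree:
  "proj_degree (monoms {..n} (2 * d)) (SOS n d 1) = 2 ^ (card (monoms {..n} d) - 1)"
proof -
  interpret square_forms n d .
  let ?k = "card S - 1"
  \<comment> \<open>Substituting \<open>2 * m\<close> multiplies the leading coefficient
    \<open>1 / k!\<close> by \<open>2 ^ k\<close>, which becomes the degree of the variety.\<close>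
  let ?Q1 = "pcompose (binomial_poly ?k) [:0, 2:]"
  let ?Q2 = "pcompose ?Q1 [:1, 1:]"
  have S: "S \<noteq> {}" using monoms_single[of 0 "{..n}" d] by (auto simp: S_def)
  have Q1: "poly ?Q1 (of_nat m) = of_nat (card (monoms S (2 * m)))" for m
    using card_monoms_binomial_poly[OF finite_S S, of "2 * m"] by (simp add: poly_pcompose mult.commute)
  have Q2: "poly ?Q2 (of_nat m) = of_nat (card (monoms S (2 * Suc m)))" for m
    using Q1[of "Suc m"] by (simp add: poly_pcompose add.commute)
  obtain e M where e: "\<And>m. m \<ge> M \<Longrightarrow> card (monoms S (2 * Suc m)) \<le> cvs.dim (cmon c ` monoms X (m + e))"
    using hilbert_function_ge by blast
  have dQ: "degree ?Q1 = ?k" "lead_coeff ?Q1 = 2 ^ ?k / fact ?k"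
    using lead_coeff_comp[of "[:0, 2:]" "binomial_poly ?k"] lead_coeff_binomial_poly[of ?k]
    by (simp_all add: degree_pcompose degree_binomial_poly)
  have "proj_degree X (SOS n d 1) = fact (degree ?Q1) * lead_coeff ?Q1"
  proof (rule proj_degree_sandwich[where e = e and ?Q2.0 = ?Q2])
    show "eventually_poly (\<lambda>m. of_nat (hilbert_function X (SOS n d 1) m))"
      unfolding hilbert_function_eq by (rule eventually_poly_dim_cmon[OF finite_X])
    show "\<forall>\<^sub>F m in sequentially. of_nat (hilbert_function X (SOS n d 1) m) \<le> poly ?Q1 (of_nat m)"
      unfolding hilbert_function_eq Q1 using hilbert_function_le by simp
    show "\<forall>\<^sub>F m in sequentially. poly ?Q2 (of_nat m) \<le> of_nat (hilbert_function X (SOS n d 1) (m + e))"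
      unfolding hilbert_function_eq Q2 using eventually_ge_at_top[of M]
      by eventually_elim (use e in simp)
    show "degree ?Q1 = degree ?Q2" "lead_coeff ?Q1 = lead_coeff ?Q2"
      by (simp_all only: degree_lead_coeff_shift)
    show "?Q1 \<noteq> 0" using dQ(2) by auto
  qed
  also have "\<dots> = 2 ^ ?k" unfolding dQ(2) unfolding dQ(1) by simp
  finally show ?thesis by (simp add: X_def S_def)
qed

text \<open>Both bounds have the leading term of half the square of \<open>binomial_poly k\<close>.
  Its degree is \<open>2 * k\<close>, so the result is half the central binomial
  coefficient.\<close>

lemma SOS_2_degree:
  assumes n: "n \<ge> 2" and d: "d \<ge> 1"
  defines "k \<equiv> card (monoms {..n} d) - 1"
  shows "k \<ge> 1" "proj_degree (monoms {..n} (2 * d)) (SOS n d 2) = fact (2 * k) / (2 * fact k ^ 2)"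
proof -
  interpret product_forms n d .
  have S: "S \<noteq> {}" using monoms_single[of 0 "{..n}" d] by (auto simp: S_def)
  have k: "k = card S - 1" by (simp add: k_def S_def)
  have "card {exp_b d, exp_a1 d} \<le> card S"
    using exps_mem_monoms[OF n d] by (intro card_mono finite_S) (auto simp: S_def)
  then show k1: "k \<ge> 1" using exps_distinct[OF d] by (simp add: k)
  let ?q = "binomial_poly k"
  let ?q' = "pcompose ?q [:1, 1:]"
  let ?Q1 = "smult (1/2) (?q * (?q + 1))"
  let ?Q2 = "smult (1/2) (?q' * ?q')"
  have q: "poly ?q (of_nat m) = of_nat (card (monoms S m))" for m
    using card_monoms_binomial_poly[OF finite_S S, of m] by (simp add: k)
  have q': "poly ?q' (of_nat m) = of_nat (card (monoms S (Suc m)))" for m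
    using q[of "Suc m"] by (simp add: poly_pcompose add.commute)
  \<comment> \<open>At \<open>k = 0\<close> the added 1 would alter the leading term;
    \<open>k1\<close> excludes this.\<close>
  have dq1: "degree (?q + 1) = k"
    using k1 by (subst degree_add_eq_left) (simp_all add: degree_binomial_poly)
  have lq1: "lead_coeff (?q + 1) = 1 / fact k"
  proof -
    have "lead_coeff (1 + ?q) = lead_coeff ?q"
      using k1 by (intro lead_coeff_add_le) (simp add: degree_binomial_poly)
    then show ?thesis by (simp only: add.commute[of ?q 1] lead_coeff_binomial_poly)
  qed
  have nz: "?q + 1 \<noteq> 0" using dq1 k1 by auto
  have nz': "?q' \<noteq> 0"
    using degree_lead_coeff_shift(2)[of ?q 1] binomial_poly_nz[of k] by auto
  have dQ1: "degree ?Q1 = 2 * k"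
    by (simp add: degree_mult_eq binomial_poly_nz nz dq1 degree_binomial_poly)
  have lQ1: "lead_coeff ?Q1 = 1 / (2 * fact k ^ 2)"
    unfolding lead_coeff_smult lead_coeff_mult lq1 lead_coeff_binomial_poly by (simp add: power2_eq_square)
  have dQ2: "degree ?Q2 = 2 * k"
    by (simp add: degree_mult_eq nz' degree_lead_coeff_shift degree_binomial_poly)
  have "lead_coeff ?q' = 1 / fact k"
    using degree_lead_coeff_shift[of ?q 1] lead_coeff_binomial_poly[of k] by simp
  then have lQ2: "lead_coeff ?Q2 = 1 / (2 * fact k ^ 2)"
    unfolding lead_coeff_smult lead_coeff_mult by (simp add: power2_eq_square)
  obtain e M where e: "\<And>m. m \<ge> M \<Longrightarrow> card (monoms S (Suc m)) * card (monoms S (Suc m))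
    \<le> 2 * cvs.dim (cmon c ` monoms X (m + e))"
    using hilbert_function_ge[OF n d] by blast
  have "proj_degree X (SOS n d 2) = fact (degree ?Q1) * lead_coeff ?Q1"
  proof (rule proj_degree_sandwich[where e = e and ?Q2.0 = ?Q2])
    show "eventually_poly (\<lambda>m. of_nat (hilbert_function X (SOS n d 2) m))"
      unfolding hilbert_function_eq by (rule eventually_poly_dim_cmon[OF finite_X])
    have "of_nat (cvs.dim (cmon c ` monoms X m)) \<le> poly ?Q1 (of_nat m)" for m
    proof -
      have "of_nat (2 * cvs.dim (cmon c ` monoms X m)) \<le> (of_nat (card (monoms S m) * (card (monoms S m) + 1)) :: rat)"
        using hilbert_function_le[of m] by (simp only: of_nat_le_iff)
      then show ?thesis by (simp add: q algebra_simps)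
    qed
    then show "\<forall>\<^sub>F m in sequentially. of_nat (hilbert_function X (SOS n d 2) m) \<le> poly ?Q1 (of_nat m)"
      unfolding hilbert_function_eq by simp
    have "poly ?Q2 (of_nat m) \<le> of_nat (cvs.dim (cmon c ` monoms X (m + e)))" if "m \<ge> M" for m
    proof -
      have "of_nat (card (monoms S (Suc m)) * card (monoms S (Suc m)))
          \<le> (of_nat (2 * cvs.dim (cmon c ` monoms X (m + e))) :: rat)"
        using e[OF that] by (simp only: of_nat_le_iff)
      then show ?thesis by (simp add: q')
    qed
    then show "\<forall>\<^sub>F m in sequentially. poly ?Q2 (of_nat m) \<le> of_nat (hilbert_function X (SOS n d 2) (m + e))"
      unfolding hilbert_function_eq eventually_sequentially by blast
    show "degree ?Q1 = degree ?Q2" by (rule trans[OF dQ1 dQ2[symmetric]])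
    show "lead_coeff ?Q1 = lead_coeff ?Q2" by (rule trans[OF lQ1 lQ2[symmetric]])
    show "?Q1 \<noteq> 0" using lQ1 by auto
  qed
  also have "\<dots> = fact (2 * k) / (2 * fact k ^ 2)" unfolding lQ1 unfolding dQ1 by simp
  finally show "proj_degree (monoms {..n} (2 * d)) (SOS n d 2) = fact (2 * k) / (2 * fact k ^ 2)"
    by (simp add: X_def)
qed

section \<open>Telescoping of the product of binomial quotients\<close>

definition superfact :: "nat \<Rightarrow> rat" where
  "superfact k = (\<Prod>j<k. fact j)"

lemma superfact_nz: "superfact k \<noteq> 0"
  by (simp add: superfact_def)

lemma superfact_add: "superfact (k + r) = superfact k * (\<Prod>i<r. fact (k + i))"
  by (induction r) (simp_all add: superfact_def)

lemma superfact_odd_even: "(\<Prod>i<m. fact (2 * i + 1) * fact (2 * i + 2)) = superfact (2 * m + 1)"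
  by (induction m) (simp_all add: superfact_def mult_ac)

text \<open>The factorials \<open>(m + 2 + i)!\<close> fill the gap between
  \<open>superfact (m + 2)\<close> and \<open>superfact (2 * m + 2)\<close>, and
  \<open>(2 * i + 1)! (2 * i + 2)!\<close> multiply to \<open>superfact (2 * m + 1)\<close>. The
  factors \<open>(m - i)!\<close> cancel against \<open>(1 + i)!\<close> after reversal. What is
  left is \<open>(2 * m + 1)! / (m! (m + 1)!)\<close>, half of
  \<open>binomial (2 * m + 2) (m + 1)\<close>.\<close>

lemma binomial_product_identity:
  "(\<Prod>i<m. of_nat ((m + 2 + i) choose (m - i)) / of_nat ((2 * i + 1) choose i))
     = (fact (2 * (m + 1)) / (2 * fact (m + 1) ^ 2) :: rat)"
proof -
  have "(\<Prod>i<m. of_nat ((m + 2 + i) choose (m - i)) / of_nat ((2 * i + 1) choose i))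
      = (\<Prod>i<m. (fact (m + 2 + i) * (fact i * fact (1 + i))) /
          (fact (m - i) * (fact (2 * i + 1) * fact (2 * i + 2))) :: rat)"
  proof (rule prod.cong[OF refl])
    fix i assume i: "i \<in> {..<m}"
    have "m + 2 + i - (m - i) = 2 * i + 2" using i by simp
    then have "of_nat ((m + 2 + i) choose (m - i)) = (fact (m + 2 + i) / (fact (m - i) * fact (2 * i + 2)) :: rat)"
      by (simp only: binomial_fact[of "m - i" "m + 2 + i"])
    moreover have "of_nat ((2 * i + 1) choose i) = (fact (2 * i + 1) / (fact i * fact (1 + i)) :: rat)"
    proof -
      have le: "i \<le> 2 * i + 1" and "2 * i + 1 - i = 1 + i" by simp_all
      then show ?thesis by (subst binomial_fact[OF le]) (simp only:)
    qed
    ultimately show "of_nat ((m + 2 + i) choose (m - i)) / of_nat ((2 * i + 1) choose i)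
        = (fact (m + 2 + i) * (fact i * fact (1 + i))) / (fact (m - i) * (fact (2 * i + 1) * fact (2 * i + 2)) :: rat)"
      by (simp add: mult_ac del: fact_Suc)
  qed
  also have "\<dots> = ((\<Prod>i<m. fact (m + 2 + i)) * (superfact m * (\<Prod>i<m. fact (1 + i)))) /
      ((\<Prod>i<m. fact (m - i)) * superfact (2 * m + 1))"
    unfolding superfact_odd_even[symmetric] by (simp only: prod_dividef prod.distrib superfact_def)
  also have "(\<Prod>i<m. fact (m - i)) = (\<Prod>i<m. fact (1 + i) :: rat)"
  proof -
    have "(\<Prod>i<m. fact (m - i)) = (\<Prod>i<m. fact (1 + (m - Suc i)) :: rat)"
      by (rule prod.cong) (auto simp: Suc_diff_Suc simp del: fact_Suc)
    also have "\<dots> = (\<Prod>i<m. fact (1 + i))" by (rule prod.nat_diff_reindex)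
    finally show ?thesis .
  qed
  also have "((\<Prod>i<m. fact (m + 2 + i)) * (superfact m * (\<Prod>i<m. fact (1 + i)))) /
      ((\<Prod>i<m. fact (1 + i)) * superfact (2 * m + 1)) = (\<Prod>i<m. fact (m + 2 + i)) * superfact m / superfact (2 * m + 1)"
    by simp
  also have "(\<Prod>i<m. fact (m + 2 + i)) * superfact m / superfact (2 * m + 1) = fact (2 * m + 1) / (fact m * fact (m + 1))"
  proof -
    have 1: "superfact (m + 2) * (\<Prod>i<m. fact (m + 2 + i)) = superfact (2 * m + 1) * fact (2 * m + 1)"
      using superfact_add[of "m + 2" m] superfact_add[of "2 * m + 1" 1] by (simp add: mult_2 del: fact_Suc)
    have 2: "superfact (m + 2) = superfact m * (fact m * fact (m + 1))"
      using superfact_add[of m 2] by (simp add: numeral_2_eq_2 del: fact_Suc)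
    have "superfact m * ((fact m * fact (m + 1)) * (\<Prod>i<m. fact (m + 2 + i))) = superfact (2 * m + 1) * fact (2 * m + 1)"
      using 1 unfolding 2 by (simp only: mult.assoc)
    then show ?thesis using superfact_nz[of "2 * m + 1"]
      by (simp add: field_simps del: fact_Suc)
  qed
  also have "\<dots> = fact (2 * (m + 1)) / (2 * fact (m + 1) ^ 2)"
  proof -
    have gen: "F / (G * (t * G)) = 2 * t * F / (2 * (t * G) ^ 2)" if "t \<noteq> 0" for F G t :: rat
      using that by (simp add: power2_eq_square)
    have 1: "fact (2 * (m + 1)) = (2 * of_nat (Suc m) * fact (2 * m + 1) :: rat)" by simp
    have 2: "fact (m + 1) = (of_nat (Suc m) * fact m :: rat)" by simp
    show ?thesis unfolding 1 2 by (rule gen) (simp del: of_nat_Suc)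
  qed
  finally show ?thesis .
qed

theorem theorem1p6:
  fixes n d N :: nat
  assumes "N = cvs.dim (forms {..n} d)"
  shows "N = (n + d) choose d \<and>
    proj_degree (monoms {..n} (2 * d)) (SOS n d 1) = 2 ^ (N - 1) \<and>
    (\<not> (n = 1 \<and> d \<ge> 2) \<longrightarrow>
      proj_degree (monoms {..n} (2 * d)) (SOS n d 2) =
        (\<Prod>i<N - 2. of_nat ((N + i) choose (N - 2 - i)) / of_nat ((2 * i + 1) choose i)))"
proof -
  have N: "N = card (monoms {..n} d)"
    using assms by (simp add: forms_def dim_coord_space finite_monoms)
  have binom: "N = (n + d) choose d"
    using card_monoms[of "{..n}" d] by (simp add: N add.commute)
  have "proj_degree (monoms {..n} (2 * d)) (SOS n d 2) =
        (\<Prod>i<N - 2. of_nat ((N + i) choose (N - 2 - i)) / of_nat ((2 * i + 1) choose i))"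
    if cases: "\<not> (n = 1 \<and> d \<ge> 2)"
  proof -
    consider "n = 0 \<or> d = 0" | "n = 1" "d = 1" | "n \<ge> 2" "d \<ge> 1" using cases by linarith
    then show ?thesis
    proof cases
      case 1
      \<comment> \<open>Here \<open>N - 2\<close> truncates to 0 and the product is empty; for
        \<open>N = 2\<close> it is empty as well.\<close>
      then have "N = 1" using binom by auto
      then show ?thesis using SOS_2_degree_point[OF 1] by simp
    next
      case 2
      then have "N = 2" using binom by simp
      then show ?thesis using SOS_2_degree_binary_quadratic 2 by simp
    next
      case 3
      then have "N \<ge> 2" using SOS_2_degree(1)[of n d] N by simp
      \<comment> \<open>With this index \<open>N - 1 = m + 1\<close>, the \<open>k\<close> of the
        degree formula.\<close>
      then obtain m where m: "N = m + 2" using le_Suc_ex[of 2 N] by (auto simp: add.commute)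
      then show ?thesis
        using SOS_2_degree(2)[of n d] 3 N binomial_product_identity[of m] by (simp add: add.commute)
    qed
  qed
  then show ?thesis using binom SOS_1_degree[of n d] N by simp
qed

end
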